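(* Let $\mathcal{L} \subset \mathbb{R}^n$ be a stable full-rank lattice, $s > n/2$, and $0 \leq q \leq \frac{2s-n}{n+2}$. Then \[ \zeta'(\mathcal{L}, s; q) \leq \zeta'(\mathbb{Z}^n, s; q), \] with equality if and only if $\mathcal{L}$ is isomorphic to $\mathbb{Z}^n$.
   Context: A lattice of rank $d$ is the set of integer combinations of $d$ linearly independent vectors $\mathbf{B}\in\mathbb{R}^{n\times d}$; $\det(\mathcal{L})=\sqrt{\det(\mathbf{B}^T\mathbf{B})}$, $\det(\{\vec 0\}):=1$. A sublattice is any additive subgroup. A lattice $\mathcal{L}$ is stable if $\det(\mathcal{L}) = 1$ and $\det(\mathcal{L}') \geq 1$ for all sublattices $\mathcal{L}' \subseteq \mathcal{L}$. For $q \geq 0$, $\zeta'(\mathcal{L}, s; q) := \sum_{\vec{y} \in \mathcal{L}\setminus\{\vec 0\}} (\|\vec{y}\|^2 + q)^{-s}$. Isomorphic means $R\mathcal{L}=\mathbb{Z}^n$ for some orthogonal $R\in\mathsf{O}_n(\mathbb{R})$. *)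

theory Defs
  imports "HOL-Analysis.Analysis"
begin

definition int_span :: "('a::real_vector) list \<Rightarrow> 'a set" where
  "int_span vs = {(\<Sum>i<length vs. of_int (c i) *\<^sub>R (vs ! i)) | c :: nat \<Rightarrow> int. True}"

definition lattice_basis :: "('a::real_vector) list \<Rightarrow> 'a set \<Rightarrow> bool" where
  "lattice_basis vs L \<longleftrightarrow> distinct vs \<and> independent (set vs) \<and> int_span vs = L"

definition gram_det :: "('a::real_inner) list \<Rightarrow> real" where
  "gram_det vs = (\<Sum>p | p permutes {..<length vs}.
      of_int (sign p) * (\<Prod>i<length vs. inner (vs ! i) (vs ! p i)))"

definition lattice_det :: "('a::real_inner) set \<Rightarrow> real" where
  "lattice_det L = (if L = {0} then 1 else sqrt (gram_det (SOME vs. lattice_basis vs L)))"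

definition full_rank_lattice :: "(real^'n) set \<Rightarrow> bool" where
  "full_rank_lattice L \<longleftrightarrow> (\<exists>vs. lattice_basis vs L \<and> length vs = CARD('n))"

text \<open>Sublattice = additive subgroup.\<close>
definition additive_subgroup :: "('a::ab_group_add) set \<Rightarrow> bool" where
  "additive_subgroup H \<longleftrightarrow> 0 \<in> H \<and> (\<forall>x\<in>H. \<forall>y\<in>H. x + y \<in> H \<and> - x \<in> H)"

definition stable_lattice :: "(real^'n) set \<Rightarrow> bool" where
  "stable_lattice L \<longleftrightarrow> lattice_det L = 1 \<and>
     (\<forall>L'. L' \<subseteq> L \<and> additive_subgroup L' \<longrightarrow> lattice_det L' \<ge> 1)"

definition Zn :: "(real^'n) set" where
  "Zn = {x. \<forall>i. x $ i \<in> \<int>}"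

definition epstein_zeta' :: "(real^'n) set \<Rightarrow> real \<Rightarrow> real \<Rightarrow> real" where
  "epstein_zeta' L s q = (\<Sum>\<^sub>\<infinity> y \<in> L - {0}. (norm y ^ 2 + q) powr (- s))"

definition isomorphic_to_Zn :: "(real^'n) set \<Rightarrow> bool" where
  "isomorphic_to_Zn L \<longleftrightarrow> (\<exists>R :: real^'n \<Rightarrow> real^'n. orthogonal_transformation R \<and> R ` L = Zn)"

end

theory Submission
  imports Defs "Jordan_Normal_Form.Determinant"
begin

text \<open>Lattices all of whose sublattices have determinant at least 1 and which have determinant 1
have LLL-reduced bases of bounded length, so the zeta sum attains its maximum over them at some
\<open>L\<close>. For a sublattice of determinant 1, replacing \<open>L\<close> by the orthogonal sum of this sublattice and
of the projection of \<open>L\<close> to its complement does not decrease the sum, and increases it unless \<open>L\<close>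
splits already: a Gaussian sum over a lattice is at least the one over a translate of the lattice
(which a duplication formula yields without Poisson summation), and a power of \<open>\<parallel>y\<parallel>\<^sup>2 + q\<close> is a
mixture of Gaussians. So the maximizer is an orthogonal sum of indecomposable lattices of
determinant 1. All proper sublattices of an indecomposable summand have determinant greater than 1;
a summand of rank at least two hence stays stable under small shears. The second variation of the
sum, averaged over an isotropic family of shears, is positive when
\<open>q \<le> (2 s - n) / (n + 2)\<close>, which contradicts maximality. The summands are therefore spanned
by unit vectors, so that \<open>L\<close> is isometric to the integer lattice.\<close>

text \<open>The obstacle is the boundary of the set of stable lattices: where a proper sublattice
  has determinant exactly 1, an arbitrarily small deformation can leave the set, and derivative
  tests at a maximum are lost. Splitting turns such points into orthogonal sums whose indecomposable
  summands can be deformed freely, one at a time. The bound on \<open>q\<close> comes from the last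
  estimate. Let the deformed summand have rank \<open>d\<close> and its complement rank
  \<open>m\<close>, with \<open>n = m + d\<close>, and let \<rho> be the squared norm of a nonzero
  vector of the summand. Averaged over the shears, the terms in the coset of that vector have a
  positive sum as soon as \<open>(q + \<rho>) * (d + 2) < \<rho> * (2 * s + 2 - m)\<close>, that is
  \<open>q * (d + 2) < \<rho> * (2 * s - n)\<close>. Indecomposability gives \<rho> > 1, and
  \<open>d \<le> n\<close> leads to \<open>(2 * s - n) / (n + 2)\<close>. The complement enters this
  condition through a Laplacian: its power sum is largest for the untranslated lattice, so the
  Laplacian there is at most 0.\<close>

no_notation vec_index (infixl "$" 100)

section \<open>Integer spans\<close>

lemma int_span_Nil [simp]: "int_span [] = {0}"
  by (auto simp: int_span_def)

lemma int_span_Cons: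
  "int_span (v # vs) = {of_int m *\<^sub>R v + x | m x. x \<in> int_span vs}" (is "?A = ?B")
proof
  have "(\<Sum>i<length (v # vs). of_int (c i) *\<^sub>R (v # vs) ! i)
      = of_int (c 0) *\<^sub>R v + (\<Sum>i<length vs. of_int (c (Suc i)) *\<^sub>R vs ! i)" for c
    by (simp only: length_Cons sum.lessThan_Suc_shift) simp
  then show "?A \<subseteq> ?B"
    unfolding int_span_def by fastforce
  show "?B \<subseteq> ?A"
  proof clarify
    fix m :: int and x assume "x \<in> int_span vs"
    then obtain c :: "nat \<Rightarrow> int" where x: "x = (\<Sum>i<length vs. of_int (c i) *\<^sub>R vs ! i)"
      unfolding int_span_def by blast
    have "of_int m *\<^sub>R v + x
        = (\<Sum>i<length (v # vs). of_int (case_nat m c i) *\<^sub>R (v # vs) ! i)"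
      by (simp only: length_Cons sum.lessThan_Suc_shift x) simp
    then show "of_int m *\<^sub>R v + x \<in> ?A"
      unfolding int_span_def by blast
  qed
qed

lemma additive_subgroup_int_span: "additive_subgroup (int_span vs)"
  unfolding additive_subgroup_def
proof (intro conjI ballI)
  show "0 \<in> int_span vs"
    unfolding int_span_def by (rule CollectI, rule exI[of _ "\<lambda>_. 0"]) simp
next
  fix x y assume "x \<in> int_span vs" "y \<in> int_span vs"
  then obtain c d :: "nat \<Rightarrow> int" where xy: "x = (\<Sum>i<length vs. of_int (c i) *\<^sub>R vs ! i)"
    "y = (\<Sum>i<length vs. of_int (d i) *\<^sub>R vs ! i)"
    unfolding int_span_def by blast
  have "x + y = (\<Sum>i<length vs. of_int (c i + d i) *\<^sub>R vs ! i)"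
    "- x = (\<Sum>i<length vs. of_int (- c i) *\<^sub>R vs ! i)"
    by (simp_all add: xy sum.distrib scaleR_left_distrib sum_negf)
  then show "x + y \<in> int_span vs" and "- x \<in> int_span vs"
    unfolding int_span_def mem_Collect_eq by iprover+
qed

lemma additive_subgroup_0: "additive_subgroup L \<Longrightarrow> 0 \<in> L"
  and additive_subgroup_add: "additive_subgroup L \<Longrightarrow> x \<in> L \<Longrightarrow> y \<in> L \<Longrightarrow> x + y \<in> L"
  and additive_subgroup_minus: "additive_subgroup L \<Longrightarrow> x \<in> L \<Longrightarrow> - x \<in> L"
  by (auto simp: additive_subgroup_def)

lemma additive_subgroup_diff: "additive_subgroup L \<Longrightarrow> x \<in> L \<Longrightarrow> y \<in> L \<Longrightarrow> x - y \<in> L"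
  using additive_subgroup_add[of L x "- y"] additive_subgroup_minus[of L y] by simp

lemma additive_subgroup_scale:
  fixes x :: "'a::real_vector"
  assumes L: "additive_subgroup L" and x: "x \<in> L"
  shows "of_int m *\<^sub>R x \<in> L"
proof -
  have nat: "of_nat k *\<^sub>R x \<in> L" for k :: nat
    by (induction k) (use L x in \<open>auto simp: scaleR_left_distrib additive_subgroup_0 additive_subgroup_add\<close>)
  show ?thesis
  proof (cases "m \<ge> 0")
    case True
    then show ?thesis using nat[of "nat m"] by simp
  next
    case False
    then show ?thesis
      using additive_subgroup_minus[OF L nat[of "nat (- m)"]] by simp
  qed
qed

lemma int_span_least:
  assumes "additive_subgroup L" "set vs \<subseteq> L"
  shows "int_span vs \<subseteq> L"
  using assms(2)
  by (induction vs)
    (auto simp: int_span_Cons additive_subgroup_0[OF assms(1)] intro!: additive_subgroup_add[OF assms(1)]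
      additive_subgroup_scale[OF assms(1)])

lemma set_subset_int_span: "set vs \<subseteq> int_span vs"
proof (induction vs)
  case (Cons v vs)
  have "of_int 1 *\<^sub>R v + 0 \<in> int_span (v # vs)" "of_int 0 *\<^sub>R v + x \<in> int_span (v # vs)"
    if "x \<in> int_span vs" for x
    using that additive_subgroup_0[OF additive_subgroup_int_span]
    unfolding int_span_Cons by blast+
  then show ?case
    using Cons additive_subgroup_0[OF additive_subgroup_int_span[of vs]] by auto
qed simp

lemma int_span_subset_iff: "int_span us \<subseteq> int_span vs \<longleftrightarrow> set us \<subseteq> int_span vs"
  using int_span_least[OF additive_subgroup_int_span] set_subset_int_span by blast

lemma int_span_cong_set: "set us = set vs \<Longrightarrow> int_span us = int_span vs"
  by (metis int_span_subset_iff set_subset_int_span subset_antisym)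

lemma int_span_append: "int_span (us @ vs) = {x + y | x y. x \<in> int_span us \<and> y \<in> int_span vs}"
proof (induction us)
  case (Cons u us)
  have "int_span ((u # us) @ vs) = {of_int m *\<^sub>R u + (x + y) | m x y. x \<in> int_span us \<and> y \<in> int_span vs}"
    unfolding append_Cons int_span_Cons Cons by blast
  also have "\<dots> = {(of_int m *\<^sub>R u + x) + y | m x y. x \<in> int_span us \<and> y \<in> int_span vs}"
    by (simp only: add.assoc)
  also have "\<dots> = {x + y | x y. x \<in> int_span (u # us) \<and> y \<in> int_span vs}"
    unfolding int_span_Cons by blast
  finally show ?case .
qed auto

lemma int_span_subset_span: "int_span vs \<subseteq> span (set vs)"
proof
  fix x assume "x \<in> int_span vs"
  then obtain c :: "nat \<Rightarrow> int" where "x = (\<Sum>i<length vs. of_int (c i) *\<^sub>R vs ! i)"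
    unfolding int_span_def by blast
  also have "\<dots> \<in> span (set vs)"
    by (intro span_sum span_scale span_base) simp
  finally show "x \<in> span (set vs)" .
qed

lemma span_int_span [simp]: "span (int_span vs) = span (set vs)"
  by (meson int_span_subset_span set_subset_int_span span_mono span_span subset_antisym span_minimal subspace_span)

lemma int_span_map:
  assumes "linear f" shows "int_span (map f vs) = f ` int_span vs"
proof (induction vs)
  case (Cons v vs)
  have "f ` {of_int m *\<^sub>R v + x | m x. x \<in> int_span vs}
      = {f (of_int m *\<^sub>R v + x) | m x. x \<in> int_span vs}"
    by blast
  also have "\<dots> = {of_int m *\<^sub>R f v + f x | m x. x \<in> int_span vs}"
    by (simp only: linear_add[OF assms] linear_scale[OF assms])
  also have "\<dots> = {of_int m *\<^sub>R f v + y | m y. y \<in> f ` int_span vs}"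
    by blast
  finally show ?case
    by (simp only: list.map int_span_Cons Cons)
qed (simp add: linear_0[OF assms])

section \<open>Residuals and volumes\<close>

text \<open>The Gram-Schmidt residual of \<open>v\<close>, its projection to the orthogonal
  complement of \<open>span S\<close>. Describing it by its two properties frees it from a basis of
  \<open>S\<close>; \<open>res_unique\<close> identifies every candidate.\<close>

definition res :: "'a::euclidean_space set \<Rightarrow> 'a \<Rightarrow> 'a" where
  "res S v = (THE z. (\<forall>w\<in>span S. inner z w = 0) \<and> v - z \<in> span S)"

lemma res_unique:
  assumes "\<And>w. w \<in> span S \<Longrightarrow> inner z w = 0" "v - z \<in> span S"
  shows "res S v = z"
  unfolding res_def
proof (rule the_equality)
  fix z' assume z': "(\<forall>w\<in>span S. inner z' w = 0) \<and> v - z' \<in> span S"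
  have "z' - z \<in> span S"
    using span_diff[OF assms(2), of "v - z'"] z' by simp
  then have "inner (z' - z) (z' - z) = 0"
    using z' assms(1) by (simp add: inner_diff_left)
  then show "z' = z" by simp
qed (use assms in auto)

lemma res_props: "(\<forall>w\<in>span S. inner (res S v) w = 0) \<and> v - res S v \<in> span S"
proof -
  obtain y z where "y \<in> span S" "\<And>w. w \<in> span S \<Longrightarrow> real_inner_class.orthogonal z w" "v = y + z"
    using orthogonal_subspace_decomp_exists by metis
  then have "res S v = z" "\<forall>w\<in>span S. inner z w = 0" "v - z \<in> span S"
    by (auto intro!: res_unique simp: real_inner_class.orthogonal_def)
  then show ?thesis by simp
qed

lemma res_orth: "w \<in> span S \<Longrightarrow> inner (res S v) w = 0"
  and res_orth': "w \<in> span S \<Longrightarrow> inner w (res S v) = 0"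
  and res_diff: "v - res S v \<in> span S"
  using res_props by (auto simp: inner_commute)

lemma res_eqI:
  assumes "\<And>w. w \<in> S \<Longrightarrow> inner z w = 0" "v - z \<in> span S"
  shows "res S v = z"
proof (rule res_unique[OF _ assms(2)])
  fix w assume "w \<in> span S"
  then show "inner z w = 0"
    by (induction rule: span_induct_alt) (auto simp: inner_add_right assms)
qed

lemma res_orthogonal: "(\<And>w. w \<in> S \<Longrightarrow> inner v w = 0) \<Longrightarrow> res S v = v"
  by (rule res_eqI) (auto simp: span_zero)

lemma linear_res: "linear (res S)"
proof
  fix x y :: 'a and c :: real
  show "res S (x + y) = res S x + res S y"
  proof (rule res_unique)
    show "x + y - (res S x + res S y) \<in> span S"
      using span_add[OF res_diff[of x S] res_diff[of y S]] by (simp add: algebra_simps)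
  qed (simp add: inner_add_left res_orth)
  show "res S (c *\<^sub>R x) = c *\<^sub>R res S x"
  proof (rule res_unique)
    show "c *\<^sub>R x - c *\<^sub>R res S x \<in> span S"
      using span_scale[OF res_diff[of x S], of c] by (simp add: algebra_simps)
  qed (simp add: res_orth)
qed

lemmas res_add = linear_add[OF linear_res] and res_scale = linear_scale[OF linear_res]
  and res_minus = linear_diff[OF linear_res] and res_0 [simp] = linear_0[OF linear_res]

lemma res_eq_0_iff: "res S v = 0 \<longleftrightarrow> v \<in> span S"
  by (metis diff_zero diff_self inner_zero_left res_diff res_unique span_zero)

lemma res_empty [simp]: "res {} v = v"
  by (rule res_orthogonal) simp

lemma norm_sq_add_orth:
  fixes x y :: "'a::real_inner"
  shows "inner x y = 0 \<Longrightarrow> (norm (x + y))\<^sup>2 = (norm x)\<^sup>2 + (norm y)\<^sup>2"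
  by (simp add: power2_norm_eq_inner inner_add inner_commute)

lemma norm_res_le: "w \<in> span S \<Longrightarrow> norm (res S v) \<le> norm (v - w)"
proof -
  assume w: "w \<in> span S"
  have "v - res S v - w \<in> span S"
    using span_diff[OF res_diff[of v S] w] .
  then have "(norm (res S v + (v - res S v - w)))\<^sup>2 = (norm (res S v))\<^sup>2 + (norm (v - res S v - w))\<^sup>2"
    by (intro norm_sq_add_orth) (simp add: res_orth)
  then have "(norm (res S v))\<^sup>2 \<le> (norm (v - w))\<^sup>2" by simp
  then show ?thesis by (rule power2_le_imp_le) simp
qed

text \<open>Projection in two stages: the residuals modulo \<open>S\<close> of the vectors of
  \<open>T\<close> are orthogonal to \<open>S\<close>, so removing them afterwards preserves
  orthogonality to \<open>S\<close>. For lattices this is the passage to the quotient by a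
  sublattice.\<close>

lemma res_Un: "res (S \<union> T) v = res (res S ` T) (res S v)"
proof (rule res_eqI)
  have 1: "res S w \<in> span (S \<union> T)" if "w \<in> T" for w
    using span_diff[of w "S \<union> T" "w - res S w"] res_diff[of w S] span_mono[of S "S \<union> T"]
      span_base[of w "S \<union> T"] that by auto
  have 2: "span (res S ` T) \<subseteq> span (S \<union> T)"
    using 1 by (intro span_minimal) auto
  let ?z = "res (res S ` T) (res S v)"
  have "v - ?z = (v - res S v) + (res S v - ?z)" by simp
  also have "\<dots> \<in> span (S \<union> T)"
    using res_diff[of v S] res_diff[of "res S v" "res S ` T"] 2 span_mono[of S "S \<union> T"]
    by (intro span_add) auto
  finally show "v - ?z \<in> span (S \<union> T)" .
  have orthS: "inner ?z w = 0" if "w \<in> S" for w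
  proof -
    have "inner u w = 0" if "u \<in> span (res S ` T)" for u
      using that by (induction rule: span_induct_alt)
        (auto simp: inner_add_left res_orth span_base \<open>w \<in> S\<close>)
    from this[OF res_diff[of "res S v" "res S ` T"]]
    show ?thesis using that by (simp add: inner_diff_left res_orth span_base)
  qed
  have orthS': "inner ?z w = 0" if "w \<in> span S" for w
    using that by (induction rule: span_induct_alt) (auto simp: inner_add_right orthS)
  fix w assume "w \<in> S \<union> T"
  then show "inner ?z w = 0"
  proof
    assume "w \<in> T"
    have "inner ?z w = inner ?z (res S w) + inner ?z (w - res S w)"
      by (simp add: inner_diff_right)
    then show ?thesis
      using \<open>w \<in> T\<close> orthS' res_diff[of w S] by (simp add: res_orth span_base)
  qed (rule orthS)
qed

lemma norm_res_antimono: "S \<subseteq> span T \<Longrightarrow> norm (res T v) \<le> norm (res S v)"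
proof -
  assume "S \<subseteq> span T"
  then have "v - res S v \<in> span T"
    using res_diff[of v S] by (meson span_minimal subspace_span subsetD)
  from norm_res_le[OF this, of v] show ?thesis by simp
qed

text \<open>The Gram-Schmidt product, i.e. the square root of the Gram determinant
  (\<open>gram_det_vol\<close>). Every vector is measured against those behind it, so the suffixes
  of a list act as a flag of sublattices.\<close>

primrec vol :: "'a::euclidean_space list \<Rightarrow> real" where
  "vol [] = 1"
| "vol (v # vs) = norm (res (set vs) v) * vol vs"

lemma vol_nonneg [simp]: "vol vs \<ge> 0"
  by (induction vs) auto

lemma vol_eq_0_iff: "vol vs = 0 \<longleftrightarrow> \<not> (distinct vs \<and> independent (set vs))"
proof (induction vs)
  case Nil
  show ?case using independent_empty by simp
qed (auto simp: res_eq_0_iff independent_insert span_base)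

lemma vol_pos_iff: "vol vs > 0 \<longleftrightarrow> distinct vs \<and> independent (set vs)"
  using vol_eq_0_iff[of vs] vol_nonneg[of vs] by linarith

text \<open>The determinant of a lattice is that of a sublattice times that of the projection away
  from it; by \<open>res_Un\<close> the residuals in the front part are residuals of projected
  vectors.\<close>

lemma vol_append: "vol (us @ vs) = vol (map (res (set vs)) us) * vol vs"
proof (induction us)
  case (Cons u us)
  have "res (set us \<union> set vs) u = res (res (set vs) ` set us) (res (set vs) u)"
    by (metis Un_commute res_Un)
  then show ?case using Cons by simp
qed simp

lemma vol_orthogonal_append:
  assumes "\<And>u v. u \<in> set us \<Longrightarrow> v \<in> set vs \<Longrightarrow> inner u v = 0"
  shows "vol (us @ vs) = vol us * vol vs"
proof -
  have "map (res (set vs)) us = us"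
    using assms by (intro map_idI res_orthogonal)
  then show ?thesis by (simp add: vol_append)
qed

section \<open>Gram determinants\<close>

lemma gram_det_eq_det:
  "gram_det vs = Determinant.det (Matrix.mat (length vs) (length vs) (\<lambda>(i, j). inner (vs ! i) (vs ! j)))"
  (is "_ = Determinant.det ?G")
proof -
  have "Determinant.det ?G = (\<Sum>p | p permutes {0..<length vs}.
      of_int (sign p) * (\<Prod>i = 0..<length vs. ?G $$ (i, p i)))"
    by (rule det_def') simp
  also have "\<dots> = gram_det vs"
    unfolding gram_det_def atLeast0LessThan
  proof (rule sum.cong[OF refl])
    fix p assume "p \<in> {p. p permutes {..<length vs}}"
    then have "p i < length vs" if "i < length vs" for i
      using permutes_in_image[of p "{..<length vs}" i] that by simp
    then show "of_int (sign p) * (\<Prod>i<length vs. ?G $$ (i, p i))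
        = of_int (sign p) * (\<Prod>i<length vs. inner (vs ! i) (vs ! p i))"
      by simp
  qed
  finally show ?thesis by simp
qed

text \<open>In matrix form the Gram matrix of \<open>us\<close> is
  \<open>M * G vs * transpose_mat M\<close>. Integer coefficients yield indices of sublattices, real
  ones the change of volume under linear maps.\<close>

lemma gram_det_lincomb:
  fixes us vs :: "'a::real_inner list" and H :: "nat \<Rightarrow> nat \<Rightarrow> real"
  assumes len: "length us = length vs"
    and us: "\<And>i. i < length vs \<Longrightarrow> us ! i = (\<Sum>j<length vs. H i j *\<^sub>R vs ! j)"
  shows "gram_det us = (Determinant.det (Matrix.mat (length vs) (length vs) (\<lambda>(i, j). H i j)))\<^sup>2 * gram_det vs"
proof -
  define k where "k = length vs"
  define M where "M = Matrix.mat k k (\<lambda>(i, j). H i j)"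
  define G where "G ws = Matrix.mat k k (\<lambda>(i, j). inner (ws ! i) (ws ! j))" for ws :: "'a list"
  have carr: "M \<in> carrier_mat k k" "G vs \<in> carrier_mat k k"
    by (auto simp: M_def G_def)
  have MG: "M * G vs \<in> carrier_mat k k"
    using carr by simp
  have "G us = M * G vs * transpose_mat M"
  proof (rule eq_matI)
    fix i j assume "i < dim_row (M * G vs * transpose_mat M)" "j < dim_col (M * G vs * transpose_mat M)"
    then have ij: "i < k" "j < k" by (auto simp: M_def)
    have MGil: "(M * G vs) $$ (i, l) = (\<Sum>m<k. H i m * inner (vs ! m) (vs ! l))" if "l < k" for l
      using ij that by (simp add: M_def G_def scalar_prod_def atLeast0LessThan)
    have "(M * G vs * transpose_mat M) $$ (i, j) = (\<Sum>l<k. (M * G vs) $$ (i, l) * H j l)"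
      using ij MG unfolding scalar_prod_def
      by (auto simp: M_def scalar_prod_def atLeast0LessThan intro!: sum.cong)
    also have "\<dots> = (\<Sum>l<k. (\<Sum>m<k. H i m * inner (vs ! m) (vs ! l)) * H j l)"
      by (intro sum.cong refl) (simp add: MGil)
    also have "\<dots> = inner (us ! i) (us ! j)"
      using ij by (simp add: us k_def inner_sum_left inner_sum_right sum_distrib_right mult_ac)
    also have "\<dots> = G us $$ (i, j)"
      using ij by (simp add: G_def)
    finally show "G us $$ (i, j) = (M * G vs * transpose_mat M) $$ (i, j)" ..
  qed (auto simp: G_def M_def)
  then have "Determinant.det (G us) = Determinant.det M * Determinant.det (G vs) * Determinant.det (transpose_mat M)"
    using carr MG by (simp add: det_mult)
  also have "Determinant.det (transpose_mat M) = Determinant.det M"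
    using carr(1) by (rule Determinant.det_transpose)
  finally show ?thesis
    by (simp add: gram_det_eq_det len G_def k_def M_def power2_eq_square)
qed

lemma span_set_conv_sum: "x \<in> span (set vs) \<Longrightarrow> \<exists>c. x = (\<Sum>i<length vs. c i *\<^sub>R vs ! i)"
proof (induction vs arbitrary: x)
  case (Cons v vs)
  then obtain k where "x - k *\<^sub>R v \<in> span (set vs)"
    by (auto simp: span_insert)
  then obtain c where "x - k *\<^sub>R v = (\<Sum>i<length vs. c i *\<^sub>R vs ! i)"
    using Cons.IH by blast
  then have "x = (\<Sum>i<length (v # vs). case_nat k c i *\<^sub>R (v # vs) ! i)"
    by (simp only: length_Cons sum.lessThan_Suc_shift) (simp add: algebra_simps)
  then show ?case by blast
qed simp

text \<open>Replacing \<open>v\<close> by its residual is a unipotent change of basis; afterwards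
  the Gram matrix is block diagonal, with the squared norm of the residual as first block. This ties
  the Leibniz sum to the recursion of \<open>vol\<close>.\<close>

lemma gram_det_Cons:
  fixes v :: "'a::euclidean_space"
  shows "gram_det (v # vs) = (norm (res (set vs) v))\<^sup>2 * gram_det vs"
proof -
  define v' where "v' = res (set vs) v"
  define k where "k = length vs"
  obtain c where c: "v - v' = (\<Sum>i<length vs. c i *\<^sub>R vs ! i)"
    using span_set_conv_sum res_diff unfolding v'_def by metis
  \<comment> \<open>Row 0 is 1 followed by the coefficients \<open>c\<close>, the other rows are
    those of the identity: upper triangular with unit diagonal, hence of determinant 1.\<close>
  define H where "H i j = (if i = j then 1 else if i = 0 then c (j - 1) else 0)" for i j :: nat
  let ?M = "Matrix.mat (Suc k) (Suc k) (\<lambda>(i, j). H i j)"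
  have "gram_det (v # vs) = (Determinant.det (Matrix.mat (length (v' # vs)) (length (v' # vs)) (\<lambda>(i, j). H i j)))\<^sup>2
      * gram_det (v' # vs)"
  proof (rule gram_det_lincomb)
    fix i assume i: "i < length (v' # vs)"
    show "(v # vs) ! i = (\<Sum>j<length (v' # vs). H i j *\<^sub>R (v' # vs) ! j)"
    proof (cases i)
      case 0
      have "(\<Sum>j<length (v' # vs). H i j *\<^sub>R (v' # vs) ! j) = v' + (\<Sum>i<length vs. c i *\<^sub>R vs ! i)"
        by (simp only: length_Cons sum.lessThan_Suc_shift) (simp add: 0 H_def)
      then show ?thesis using c 0 by (simp add: algebra_simps)
    next
      case (Suc m)
      have "(\<Sum>j<length (v' # vs). H i j *\<^sub>R (v' # vs) ! j)
          = (\<Sum>j<length (v' # vs). if j = i then (v' # vs) ! j else 0)"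
        by (intro sum.cong refl) (auto simp: H_def Suc)
      then show ?thesis using i Suc by simp
    qed
  qed simp
  moreover have "Determinant.det ?M = 1"
  proof -
    have "upper_triangular ?M"
      by (auto simp: upper_triangular_def H_def)
    then have "Determinant.det ?M = prod_list (diag_mat ?M)"
      by (rule det_upper_triangular[of _ "Suc k"]) simp
    also have "\<dots> = (\<Prod>i = 0..<Suc k. ?M $$ (i, i))"
      by (simp only: prod_list_diag_prod dim_row_mat)
    also have "\<dots> = 1"
      by (rule prod.neutral) (simp add: H_def)
    finally show ?thesis .
  qed
  ultimately have 1: "gram_det (v # vs) = gram_det (v' # vs)"
    by (simp add: k_def)
  define G where "G ws = Matrix.mat (length ws) (length ws) (\<lambda>(i, j). inner (ws ! i) (ws ! j))" for ws :: "'a list"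
  have orth: "inner v' (vs ! i) = 0" if "i < k" for i
    using that by (simp add: v'_def res_orth span_base k_def)
  then have orth': "inner (vs ! i) v' = 0" if "i < k" for i
    using that by (simp add: inner_commute)
  have "G (v' # vs) = four_block_mat (Matrix.mat 1 1 (\<lambda>_. (norm v')\<^sup>2)) (0\<^sub>m 1 k) (0\<^sub>m k 1) (G vs)"
  proof (rule eq_matI)
    fix i j assume "i < dim_row (four_block_mat (Matrix.mat 1 1 (\<lambda>_. (norm v')\<^sup>2)) (0\<^sub>m 1 k) (0\<^sub>m k 1) (G vs))"
      "j < dim_col (four_block_mat (Matrix.mat 1 1 (\<lambda>_. (norm v')\<^sup>2)) (0\<^sub>m 1 k) (0\<^sub>m k 1) (G vs))"
    then have ij: "i < Suc k" "j < Suc k"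
      by (simp_all add: G_def k_def)
    show "G (v' # vs) $$ (i, j)
      = four_block_mat (Matrix.mat 1 1 (\<lambda>_. (norm v')\<^sup>2)) (0\<^sub>m 1 k) (0\<^sub>m k 1) (G vs) $$ (i, j)"
      using ij by (cases i; cases j)
        (simp_all add: G_def k_def[symmetric] power2_norm_eq_inner orth orth')
  qed (simp_all add: G_def k_def)
  then have "Determinant.det (G (v' # vs))
      = Determinant.det (Matrix.mat 1 1 (\<lambda>_. (norm v')\<^sup>2)) * Determinant.det (G vs)"
    by (simp, intro det_four_block_mat_lower_left_zero_col) (auto simp: G_def k_def)
  also have "Determinant.det (Matrix.mat 1 1 (\<lambda>_. (norm v')\<^sup>2)) = (norm v')\<^sup>2"
    by (subst det_single) auto
  finally show ?thesis
    using 1 by (simp add: gram_det_eq_det G_def v'_def)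
qed

lemma gram_det_vol: "gram_det vs = (vol vs)\<^sup>2"
proof (induction vs)
  case Nil
  show ?case by (simp add: gram_det_def)
qed (simp add: gram_det_Cons power_mult_distrib)

text \<open>The factor is the absolute determinant of the integer coordinate matrix; for independent
  lists it is the index of the sublattice.\<close>

lemma vol_int_lincomb:
  assumes len: "length us = length vs" and us: "set us \<subseteq> int_span vs"
  shows "\<exists>m::nat. vol us = of_nat m * vol vs"
proof -
  have "\<exists>c :: nat \<Rightarrow> int. us ! i = (\<Sum>j<length vs. of_int (c j) *\<^sub>R vs ! j)" if "i < length vs" for i
  proof -
    have "us ! i \<in> int_span vs" using us len that by auto
    then show ?thesis unfolding int_span_def by blast
  qed
  then obtain c :: "nat \<Rightarrow> nat \<Rightarrow> int"
    where c: "\<And>i. i < length vs \<Longrightarrow> us ! i = (\<Sum>j<length vs. of_int (c i j) *\<^sub>R vs ! j)"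
    by metis
  let ?k = "length vs"
  define d where "d = Determinant.det (Matrix.mat ?k ?k (\<lambda>(i, j). c i j))"
  have "Matrix.mat ?k ?k (\<lambda>(i, j). of_int (c i j) :: real)
      = map_mat of_int (Matrix.mat ?k ?k (\<lambda>(i, j). c i j))"
    by (rule eq_matI) auto
  then have "Determinant.det (Matrix.mat ?k ?k (\<lambda>(i, j). of_int (c i j) :: real)) = of_int d"
    by (simp add: d_def of_int_hom.hom_det)
  then have "(vol us)\<^sup>2 = (of_int d)\<^sup>2 * (vol vs)\<^sup>2"
    using gram_det_lincomb[OF len, of "\<lambda>i j. of_int (c i j)"] c by (simp add: gram_det_vol)
  also have "\<dots> = (\<bar>of_int d\<bar> * vol vs)\<^sup>2"
    by (simp add: power_mult_distrib)
  finally have "vol us = \<bar>of_int d\<bar> * vol vs"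
    by (rule power2_eq_imp_eq) auto
  then show ?thesis
    by (intro exI[of _ "nat \<bar>d\<bar>"]) simp
qed

text \<open>Each volume is a natural multiple of the other, so for nonzero volumes both factors are
  1. Equal lengths matter: a redundant generator keeps the span but brings the volume to 0.\<close>

lemma vol_cong_int_span:
  assumes len: "length us = length vs" and eq: "int_span us = int_span vs"
  shows "vol us = vol vs"
proof -
  have "set us \<subseteq> int_span vs" "set vs \<subseteq> int_span us"
    using eq set_subset_int_span[of us] set_subset_int_span[of vs] by auto
  then obtain m m' :: nat where m: "vol us = of_nat m * vol vs" "vol vs = of_nat m' * vol us"
    using vol_int_lincomb[OF len] vol_int_lincomb[OF len[symmetric]] by blast
  show ?thesis
  proof (cases "vol us = 0")
    case False
    have "vol us = real m * (real m' * vol us)"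
      by (simp only: m(1)[symmetric] m(2)[symmetric])
    then have "vol us * (real m * real m' - 1) = 0"
      by (simp add: algebra_simps)
    with False have "real m * real m' = 1" by simp
    then have "m * m' = 1" by (metis of_nat_1 of_nat_eq_iff of_nat_mult)
    then show ?thesis using m(1) by simp
  next
    case True
    then have "vol vs = 0" by (simp add: m(2))
    then show ?thesis using True by simp
  qed
qed

lemma vol_perm: "mset us = mset vs \<Longrightarrow> vol us = vol vs"
  by (intro vol_cong_int_span int_span_cong_set) (auto dest: mset_eq_length mset_eq_setD)

section \<open>Semistable subgroups\<close>

text \<open>Lists stand for sublattices, so no bases of subgroups have to be chosen. Dependent lists have
  volume \<open>0\<close>.\<close>
definition semistable :: "'a::euclidean_space set \<Rightarrow> bool" where
  "semistable L \<longleftrightarrow> (\<forall>vs. set vs \<subseteq> L \<longrightarrow> vol vs = 0 \<or> 1 \<le> vol vs)"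

lemma semistableD: "semistable L \<Longrightarrow> set vs \<subseteq> L \<Longrightarrow> vol vs > 0 \<Longrightarrow> 1 \<le> vol vs"
  unfolding semistable_def by fastforce

lemma semistable_subset: "semistable L \<Longrightarrow> M \<subseteq> L \<Longrightarrow> semistable M"
  unfolding semistable_def by blast

lemma semistable_norm_ge: "semistable L \<Longrightarrow> x \<in> L \<Longrightarrow> x \<noteq> 0 \<Longrightarrow> 1 \<le> norm x"
  using semistableD[of L "[x]"] by simp

text \<open>Differences of distinct points have norm at least 1, so points of \<open>L\<close>
  cannot accumulate; compactness of the ball does the rest.\<close>

lemma finite_semistable_cball:
  assumes L: "additive_subgroup L" "semistable L"
  shows "finite (L \<inter> cball 0 C)"
proof (rule ccontr)
  assume "infinite (L \<inter> cball 0 C)"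
  moreover have "compact (cball (0::'a) C)" by simp
  ultimately obtain l where "l islimpt (L \<inter> cball 0 C)"
    using Heine_Borel_imp_Bolzano_Weierstrass[of "cball 0 C" "L \<inter> cball 0 C"] by auto
  then have "infinite (L \<inter> cball 0 C \<inter> ball l (1/2))"
    by (simp add: islimpt_eq_infinite_ball)
  then obtain x where x: "x \<in> L \<inter> ball l (1/2)"
    using infinite_imp_nonempty by blast
  have "infinite (L \<inter> cball 0 C \<inter> ball l (1/2) - {x})"
    using \<open>infinite (L \<inter> cball 0 C \<inter> ball l (1/2))\<close> by simp
  then obtain y where y: "y \<in> L \<inter> ball l (1/2)" "y \<noteq> x"
    using infinite_imp_nonempty by blast
  have "dist x y < 1"
    using x y dist_triangle_half_r[of l x 1 y] by auto
  moreover have "1 \<le> norm (x - y)"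
    using x y by (intro semistable_norm_ge[OF L(2)] additive_subgroup_diff[OF L(1)]) auto
  ultimately show False by (simp add: dist_norm)
qed

text \<open>Dirichlet's pigeonhole argument. Reduced modulo \<open>int_span ys\<close>, the
  multiples of \<open>y\<close> all lie in one bounded set, which contains finitely many points of
  \<open>L\<close>; two of them coincide, and the difference of the two multiples is the relation.
  In a discrete group, real dependence is integer dependence.\<close>

lemma span_int_relation:
  assumes L: "additive_subgroup L" "semistable L"
    and ys: "set (y # ys) \<subseteq> L" and y: "y \<in> span (set ys)"
  obtains m :: int where "m \<noteq> 0" "of_int m *\<^sub>R y \<in> int_span ys"
proof -
  obtain c where c: "y = (\<Sum>i<length ys. c i *\<^sub>R ys ! i)"
    using span_set_conv_sum[OF y] by blast
  define w where "w k = (\<Sum>i<length ys. of_int \<lfloor>of_nat k * c i\<rfloor> *\<^sub>R ys ! i)" for k :: nat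
  define f where "f k = of_nat k *\<^sub>R y - w k" for k :: nat
  have w: "w k \<in> int_span ys" for k
    unfolding w_def int_span_def by (rule CollectI) (rule exI[of _ "\<lambda>i. \<lfloor>of_nat k * c i\<rfloor>"], simp)
  have "range f \<subseteq> L \<inter> cball 0 (\<Sum>i<length ys. norm (ys ! i))"
  proof clarify
    fix k
    have "f k \<in> L"
    proof -
      have "of_int (int k) *\<^sub>R y \<in> L"
        using ys by (intro additive_subgroup_scale[OF L(1)]) auto
      moreover have "w k \<in> L"
        using w[of k] int_span_least[OF L(1), of ys] ys by auto
      ultimately show ?thesis
        unfolding f_def using additive_subgroup_diff[OF L(1)] by simp
    qed
    moreover have "f k = (\<Sum>i<length ys. frac (of_nat k * c i) *\<^sub>R ys ! i)"
      unfolding f_def w_def frac_def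
      by (subst c) (simp add: scaleR_sum_right sum_subtractf[symmetric] scaleR_diff_left)
    then have "norm (f k) \<le> (\<Sum>i<length ys. norm (ys ! i))"
      by (auto intro!: order.trans[OF norm_sum] sum_mono mult_left_le_one_le
          simp: frac_ge_0 less_imp_le[OF frac_lt_1])
    ultimately show "f k \<in> L \<inter> cball 0 (\<Sum>i<length ys. norm (ys ! i))" by simp
  qed
  then have "finite (range f)"
    using finite_semistable_cball[OF L] finite_subset by blast
  then have "\<not> inj f"
    using finite_imageD infinite_UNIV_nat by blast
  then obtain a b where ab: "f a = f b" "a \<noteq> b"
    unfolding inj_def by blast
  have "of_int (int a - int b) *\<^sub>R y = w a - w b"
    using ab(1) by (simp add: f_def algebra_simps)
  also have "\<dots> \<in> int_span ys"
    by (rule additive_subgroup_diff[OF additive_subgroup_int_span w w])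
  finally show ?thesis
    using that[of "int a - int b"] ab(2) by simp
qed

text \<open>This is the Euclidean algorithm, run on the coordinates of \<open>x\<close>.\<close>
lemma int_span_basis_multiple:
  assumes "vs \<noteq> []" "x \<in> int_span vs"
  shows "\<exists>us u g. Suc (length us) = length vs \<and> int_span (us @ [u]) = int_span vs \<and> x = of_int g *\<^sub>R u"
  using assms
proof (induction vs arbitrary: x)
  case (Cons v vs)
  obtain m x' where x: "x = of_int m *\<^sub>R v + x'" "x' \<in> int_span vs"
    using Cons.prems(2) unfolding int_span_Cons by blast
  show ?case
  proof (cases "vs = []")
    case True
    then show ?thesis
      using x by (intro exI[of _ "[]"] exI[of _ v] exI[of _ m]) simp
  next
    case False
    then obtain us u g where IH: "Suc (length us) = length vs" "int_span (us @ [u]) = int_span vs"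
        "x' = of_int g *\<^sub>R u"
      using Cons.IH[OF False x(2)] by blast
    have vus: "int_span (v # us @ [u]) = int_span (v # vs)"
      using IH(2) by (simp add: int_span_Cons)
    show ?thesis
    proof (cases "gcd m g = 0")
      case True
      then have "m = 0" "g = 0" by simp_all
      then show ?thesis
        using x IH vus by (intro exI[of _ "v # us"] exI[of _ u] exI[of _ 0]) simp
    next
      case False
      then obtain m' g' where mg: "m = m' * gcd m g" "g = g' * gcd m g" "coprime m' g'"
        using gcd_coprime_exists[of m g] by blast
      obtain a b where "a * m' + b * g' = gcd m' g'"
        using bezout_int by blast
      then have ab: "a * m' + b * g' = 1"
        using mg(3) by (simp add: coprime_iff_gcd_eq_1)
      then have ab': "of_int a * of_int m' + of_int b * of_int g' = (1::real)"
        by (metis of_int_1 of_int_add of_int_mult)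
      \<comment> \<open>The integer matrix with rows \<open>(m', g')\<close> and
        \<open>(- b, a)\<close> has determinant \<open>a * m' + b * g' = 1\<close>, so
        \<open>u', w\<close> and \<open>v, u\<close> generate the same group.\<close>
      define u' where "u' = of_int m' *\<^sub>R v + of_int g' *\<^sub>R u"
      define w where "w = of_int (- b) *\<^sub>R v + of_int a *\<^sub>R u"
      have "of_int a *\<^sub>R u' - of_int g' *\<^sub>R w
          = (of_int a * of_int m' + of_int b * of_int g') *\<^sub>R v"
        by (simp add: u'_def w_def algebra_simps)
      then have v: "v = of_int a *\<^sub>R u' - of_int g' *\<^sub>R w"
        by (simp add: ab')
      have "of_int b *\<^sub>R u' + of_int m' *\<^sub>R w
          = (of_int a * of_int m' + of_int b * of_int g') *\<^sub>R u"
        by (simp add: u'_def w_def algebra_simps)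
      then have u: "u = of_int b *\<^sub>R u' + of_int m' *\<^sub>R w"
        by (simp add: ab')
      note gr = additive_subgroup_add[OF additive_subgroup_int_span]
        additive_subgroup_diff[OF additive_subgroup_int_span]
        additive_subgroup_scale[OF additive_subgroup_int_span]
        set_subset_int_span[THEN subsetD]
      have "set (w # us @ [u']) \<subseteq> int_span (v # us @ [u])"
      proof -
        have vu: "v \<in> int_span (v # us @ [u])" "u \<in> int_span (v # us @ [u])"
          by (auto intro!: gr(4))
        have "w \<in> int_span (v # us @ [u])" "u' \<in> int_span (v # us @ [u])"
          unfolding w_def u'_def by (intro gr(1,3) vu)+
        then show ?thesis
          using set_subset_int_span[of "v # us @ [u]"] by auto
      qed
      moreover have "set (v # us @ [u]) \<subseteq> int_span (w # us @ [u'])"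
      proof -
        have wu: "w \<in> int_span (w # us @ [u'])" "u' \<in> int_span (w # us @ [u'])"
          by (auto intro!: gr(4))
        have "v \<in> int_span (w # us @ [u'])"
          by (subst v) (intro gr(2,3) wu)
        moreover have "u \<in> int_span (w # us @ [u'])"
          by (subst u) (intro gr(1,3) wu)
        ultimately show ?thesis
          using set_subset_int_span[of "w # us @ [u']"] by auto
      qed
      ultimately have "int_span (w # us @ [u']) = int_span (v # us @ [u])"
        by (meson int_span_subset_iff subset_antisym)
      moreover have "x = of_int (gcd m g) *\<^sub>R u'"
        unfolding x(1) IH(3) u'_def by (subst (1) mg(1), subst (2) mg(2)) (simp add: algebra_simps)
      ultimately show ?thesis
        using IH(1) vus by (intro exI[of _ "w # us"] exI[of _ u'] exI[of _ "gcd m g"]) simp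
    qed
  qed
qed simp

lemma vol_eq_0_split: "vol vs = 0 \<Longrightarrow> \<exists>as v bs. vs = as @ v # bs \<and> v \<in> span (set bs)"
proof (induction vs)
  case (Cons v vs)
  show ?case
  proof (cases "vol vs = 0")
    case True
    then obtain as w bs where "vs = as @ w # bs" "w \<in> span (set bs)"
      using Cons.IH by blast
    then show ?thesis by (intro exI[of _ "v # as"]) auto
  next
    case False
    then show ?thesis
      using Cons.prems by (intro exI[of _ "[]"]) (auto simp: res_eq_0_iff)
  qed
qed simp

section \<open>Semistability of orthogonal sums and of projections\<close>

lemma vol_map_res_le: "vol (map (res T) vs) \<le> vol vs"
proof (induction vs)
  case (Cons v vs)
  have "norm (res (res T ` set vs) (res T v)) \<le> norm (res (set vs) v)"
    by (subst res_Un[symmetric]) (intro norm_res_antimono, auto intro: span_base)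
  then show ?case using Cons by (auto intro: mult_mono)
qed simp

lemma additive_subgroup_sum:
  assumes "additive_subgroup L1" "additive_subgroup L2"
  shows "additive_subgroup {x + y | x y. x \<in> L1 \<and> y \<in> L2}"
  unfolding additive_subgroup_def
proof (intro conjI ballI)
  show "0 \<in> {x + y | x y. x \<in> L1 \<and> y \<in> L2}"
    using assms[THEN additive_subgroup_0] by force
next
  fix a b assume "a \<in> {x + y | x y. x \<in> L1 \<and> y \<in> L2}" "b \<in> {x + y | x y. x \<in> L1 \<and> y \<in> L2}"
  then obtain x y x' y' where *: "a = x + y" "b = x' + y'" "x \<in> L1" "y \<in> L2" "x' \<in> L1" "y' \<in> L2"
    by blast
  have "a + b = (x + x') + (y + y')" "- a = - x + - y"
    by (simp_all add: *)
  then show "a + b \<in> {x + y | x y. x \<in> L1 \<and> y \<in> L2}" and "- a \<in> {x + y | x y. x \<in> L1 \<and> y \<in> L2}"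
    using * assms additive_subgroup_add additive_subgroup_minus by blast+
qed

text \<open>If the projections of a list to \<open>L2\<close> are independent, its volume is at
  least their volume, which is at least 1. Otherwise an integer relation between the projections
  yields a nonzero vector of the spanned lattice that lies in \<open>L1\<close>; after a change of
  basis it is a multiple of a basis vector, which is split off.\<close>

lemma semistable_orthogonal_sum:
  fixes L1 L2 :: "'a::euclidean_space set"
  assumes grp: "additive_subgroup L1" "additive_subgroup L2"
    and ss: "semistable L1" "semistable L2"
    and orth: "\<And>x y. x \<in> L1 \<Longrightarrow> y \<in> L2 \<Longrightarrow> inner x y = 0"
  shows "semistable {x + y | x y. x \<in> L1 \<and> y \<in> L2}" (is "semistable ?L")
proof -
  define \<phi> where "\<phi> = res L1"
  note lin = linear_res[of L1, folded \<phi>_def]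
  have phi1: "\<phi> x = 0" if "x \<in> span L1" for x
    using that by (simp add: \<phi>_def res_eq_0_iff)
  have phi: "\<phi> (x + y) = y" if "x \<in> L1" "y \<in> L2" for x y
  proof -
    have "res L1 y = y"
      using orth that by (intro res_orthogonal) (simp add: inner_commute)
    then show ?thesis
      using that phi1[of x] by (simp add: linear_add[OF lin] span_base) (simp add: \<phi>_def)
  qed
  have phiL: "\<phi> z \<in> L2" if "z \<in> ?L" for z
    using that phi by auto
  \<comment> \<open>The second list \<open>ts\<close> collects vectors already found in
    \<open>L1\<close>; the induction on the length of \<open>vs\<close> moves one vector across per
    step.\<close>
  have *: "1 \<le> vol (vs @ ts)" if "set vs \<subseteq> ?L" "set ts \<subseteq> L1" "vol (vs @ ts) > 0" for vs ts
    using that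
  proof (induction "length vs" arbitrary: vs ts)
    case 0
    then show ?case using semistableD[OF ss(1)] by simp
  next
    case (Suc k)
    have pos: "vol (map (res (set ts)) vs) > 0" "vol ts > 0" "vol vs > 0"
    proof -
      show *: "vol (map (res (set ts)) vs) > 0" "vol ts > 0"
        using Suc.prems(3) vol_nonneg[of ts] vol_nonneg[of "map (res (set ts)) vs"]
        by (auto simp: vol_append zero_less_mult_iff)
      then show "vol vs > 0" using vol_map_res_le[of "set ts" vs] by linarith
    qed
    show ?case
    proof (cases "vol (map \<phi> vs) = 0")
      case False
      have "map \<phi> vs = map \<phi> (map (res (set ts)) vs)"
      proof -
        have "\<phi> v = \<phi> (res (set ts) v)" for v
        proof -
          have "v - res (set ts) v \<in> span L1"
            using res_diff span_mono[OF Suc.prems(2)] by blast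
          then show ?thesis
            using phi1 linear_diff[OF lin, of v] by fastforce
        qed
        then show ?thesis by simp
      qed
      then have "vol (map \<phi> vs) \<le> vol (map (res (set ts)) vs)"
        unfolding \<phi>_def using vol_map_res_le by metis
      moreover have "1 \<le> vol (map \<phi> vs)"
        using False vol_nonneg[of "map \<phi> vs"] Suc.prems(1) phiL
        by (intro semistableD[OF ss(2)]) (fastforce, linarith)
      moreover have "1 \<le> vol ts"
        using pos Suc.prems(2) by (intro semistableD[OF ss(1)])
      ultimately show ?thesis
        unfolding vol_append using mult_mono[of 1 "vol (map (res (set ts)) vs)" 1 "vol ts"] by simp
    next
      case True
      then obtain as' v' bs' where "map \<phi> vs = as' @ v' # bs'" "v' \<in> span (set bs')"
        using vol_eq_0_split by blast
      then obtain as v bs where vs: "vs = as @ v # bs" "\<phi> v \<in> span (\<phi> ` set bs)"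
        by (fastforce simp: map_eq_append_conv map_eq_Cons_conv)
      have "set (\<phi> v # map \<phi> bs) \<subseteq> L2"
        using Suc.prems(1) vs(1) phiL by fastforce
      then obtain m where m: "m \<noteq> 0" "of_int m *\<^sub>R \<phi> v \<in> int_span (map \<phi> bs)"
        using span_int_relation[OF grp(2) ss(2), of "\<phi> v" "map \<phi> bs"] vs(2) by auto
      then obtain b where b: "b \<in> int_span bs" "of_int m *\<^sub>R \<phi> v = \<phi> b"
        unfolding int_span_map[OF lin] by blast
      define x where "x = of_int m *\<^sub>R v - b"
      have "set bs \<subseteq> int_span vs" "v \<in> int_span vs"
        using set_subset_int_span[of vs] vs(1) by auto
      then have "b \<in> int_span vs" "v \<in> int_span vs"
        using b(1) int_span_subset_iff[of bs vs] by auto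
      then have x_in: "x \<in> int_span vs"
        unfolding x_def
        by (intro additive_subgroup_diff additive_subgroup_scale additive_subgroup_int_span)
      have phix: "\<phi> x = 0"
        using b(2) by (simp add: x_def linear_diff[OF lin] linear_scale[OF lin])
      have "x \<noteq> 0"
      proof
        assume "x = 0"
        then have "of_int m *\<^sub>R v \<in> span (set bs)"
          using b(1) int_span_subset_span unfolding x_def by auto
        then have "v \<in> span (set bs)"
          using m(1) span_scale[of "of_int m *\<^sub>R v" "set bs" "1 / of_int m"] by simp
        then have "vol vs = 0"
          using vs(1) by (simp add: vol_append res_eq_0_iff)
        then show False using pos(3) by simp
      qed
      have "vs \<noteq> []" using Suc(2) by auto
      then obtain us u g where us: "Suc (length us) = length vs" "int_span (us @ [u]) = int_span vs"
        "x = of_int g *\<^sub>R u"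
        using int_span_basis_multiple x_in by blast
      have "\<phi> u = 0"
        using phix us(3) \<open>x \<noteq> 0\<close> by (simp add: linear_scale[OF lin])
      have usL: "set (us @ [u]) \<subseteq> ?L"
      proof -
        have "int_span (us @ [u]) \<subseteq> ?L"
          using us(2) int_span_least[OF additive_subgroup_sum[OF grp] Suc.prems(1)] by simp
        then show ?thesis using set_subset_int_span by blast
      qed
      then have "u \<in> L1"
        using \<open>\<phi> u = 0\<close> phi by auto
      have "int_span (vs @ ts) = int_span (us @ (u # ts))"
        using int_span_append[of vs ts] int_span_append[of "us @ [u]" ts] us(2) by simp
      then have "vol (vs @ ts) = vol (us @ (u # ts))"
        using us(1) by (intro vol_cong_int_span) auto
      moreover have "1 \<le> vol (us @ (u # ts))"
        using Suc usL us(1) \<open>u \<in> L1\<close> calculation by (intro Suc.hyps(1)) auto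
      ultimately show ?thesis by simp
    qed
  qed
  show ?thesis
    unfolding semistable_def
  proof (intro allI impI)
    fix vs assume "set vs \<subseteq> ?L"
    then show "vol vs = 0 \<or> 1 \<le> vol vs"
      using *[of vs "[]"] vol_nonneg[of vs] by (cases "vol vs = 0") auto
  qed
qed

text \<open>Lift the vectors to \<open>L\<close> and append \<open>ws\<close>: as
  \<open>vol ws = 1\<close>, the volume of the projected list is that of a list in
  \<open>L\<close>.\<close>

lemma semistable_res_image:
  assumes "semistable L" "set ws \<subseteq> L" "vol ws = 1"
  shows "semistable (res (set ws) ` L)"
  unfolding semistable_def
proof (intro allI impI)
  fix ys assume "set ys \<subseteq> res (set ws) ` L"
  then have "\<exists>xs. set xs \<subseteq> L \<and> ys = map (res (set ws)) xs"
  proof (induction ys)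
    case (Cons y ys)
    then obtain xs x where "set xs \<subseteq> L" "ys = map (res (set ws)) xs" "x \<in> L" "y = res (set ws) x"
      by auto
    then show ?case by (intro exI[of _ "x # xs"]) auto
  qed simp
  then obtain xs where "set xs \<subseteq> L" "ys = map (res (set ws)) xs" by blast
  then have "vol ys = vol (xs @ ws)" "set (xs @ ws) \<subseteq> L"
    using assms by (auto simp: vol_append)
  then show "vol ys = 0 \<or> 1 \<le> vol ys"
    using assms(1) by (simp add: semistable_def)
qed

section \<open>Bases extending a sublattice of determinant one\<close>

text \<open>Cramer's rule for volumes: modulo the other vectors only the \<open>i\<close>-th term of
  the combination survives.\<close>

lemma vol_list_update:
  assumes i: "i < length xs"
  shows "vol (xs[i := \<Sum>j<length xs. c j *\<^sub>R xs ! j]) = \<bar>c i\<bar> * vol xs"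
proof -
  define z where "z = (\<Sum>j<length xs. c j *\<^sub>R xs ! j)"
  define r where "r = take i xs @ drop (Suc i) xs"
  have xs: "xs = take i xs @ xs ! i # drop (Suc i) xs"
    using i by (simp add: Cons_nth_drop_Suc)
  have 1: "vol (xs[i := x]) = vol (x # r)" for x
    by (rule vol_perm) (simp add: upd_conv_take_nth_drop[OF i] r_def)
  have 2: "vol xs = vol (xs ! i # r)"
    using 1[of "xs ! i"] by simp
  have "z - c i *\<^sub>R xs ! i = (\<Sum>j\<in>{..<length xs} - {i}. c j *\<^sub>R xs ! j)"
    unfolding z_def using i by (subst sum.remove[of _ i]) auto
  also have "\<dots> \<in> span (set r)"
  proof (intro span_sum span_scale span_base)
    fix j assume j: "j \<in> {..<length xs} - {i}"
    show "xs ! j \<in> set r"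
    proof (cases "j < i")
      case True
      then have "xs ! j \<in> set (take i xs)"
        using i by (auto simp: in_set_conv_nth intro!: exI[of _ j])
      then show ?thesis by (simp add: r_def)
    next
      case False
      then have "xs ! j = drop (Suc i) xs ! (j - Suc i)" "j - Suc i < length (drop (Suc i) xs)"
        using j by auto
      then have "xs ! j \<in> set (drop (Suc i) xs)" by (metis nth_mem)
      then show ?thesis by (simp add: r_def)
    qed
  qed
  finally have "res (set r) (z - c i *\<^sub>R xs ! i) = 0"
    by (simp add: res_eq_0_iff)
  then have "res (set r) z = c i *\<^sub>R res (set r) (xs ! i)"
    by (simp add: res_minus res_scale)
  then show ?thesis
    by (simp add: z_def[symmetric] 1 2)
qed

text \<open>Reduction into the fundamental cell of \<open>xs\<close>: the integer parts of the
  coordinates are removed.\<close>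

lemma frac_representation:
  assumes L: "additive_subgroup L" and xs: "set xs \<subseteq> L" and z: "z \<in> L" "z \<in> span (set xs)"
  obtains c where "(\<Sum>j<length xs. c j *\<^sub>R xs ! j) \<in> L" "\<And>j. 0 \<le> c j" "\<And>j. c j < 1"
    "z - (\<Sum>j<length xs. c j *\<^sub>R xs ! j) \<in> int_span xs"
proof -
  obtain c where c: "z = (\<Sum>i<length xs. c i *\<^sub>R xs ! i)"
    using span_set_conv_sum[OF z(2)] by blast
  let ?s = "\<Sum>j<length xs. frac (c j) *\<^sub>R xs ! j"
  have "z - ?s = (\<Sum>i<length xs. of_int \<lfloor>c i\<rfloor> *\<^sub>R xs ! i)"
    by (simp add: c sum_subtractf[symmetric] frac_def scaleR_diff_left)
  then have 1: "z - ?s \<in> int_span xs"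
    unfolding int_span_def by (intro CollectI exI[of _ "\<lambda>i. \<lfloor>c i\<rfloor>"]) simp
  then have "z - ?s \<in> L"
    using int_span_least[OF L xs] by blast
  then have "?s \<in> L"
    using additive_subgroup_diff[OF L z(1), of "z - ?s"] by simp
  then show ?thesis
    using that[of "\<lambda>j. frac (c j)"] 1 frac_lt_1 frac_ge_0 by blast
qed

text \<open>A sublattice of determinant 1 is primitive: a coordinate strictly between 0 and 1 would,
  by \<open>vol_list_update\<close>, produce a list in \<open>L\<close> with that coordinate as its
  volume.\<close>

lemma vol_1_int_span:
  assumes L: "additive_subgroup L" "semistable L"
    and ws: "set ws \<subseteq> L" "vol ws = 1" and z: "z \<in> L" "z \<in> span (set ws)"
  shows "z \<in> int_span ws"
proof -
  obtain c where c: "(\<Sum>j<length ws. c j *\<^sub>R ws ! j) \<in> L" "\<And>j. 0 \<le> c j" "\<And>j. c j < 1"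
    "z - (\<Sum>j<length ws. c j *\<^sub>R ws ! j) \<in> int_span ws"
    using frac_representation[OF L(1) ws(1) z] by blast
  have "c j = 0" if j: "j < length ws" for j
  proof (rule ccontr)
    assume "c j \<noteq> 0"
    then have "0 < c j" using c(2)[of j] by simp
    then have *: "vol (ws[j := \<Sum>j<length ws. c j *\<^sub>R ws ! j]) = c j"
      using vol_list_update[OF j] ws(2) by simp
    have "1 \<le> vol (ws[j := \<Sum>j<length ws. c j *\<^sub>R ws ! j])"
      using * \<open>0 < c j\<close> set_update_subset_insert[of ws j] ws(1) c(1)
      by (intro semistableD[OF L(2)]) auto
    then show False using * c(3)[of j] by simp
  qed
  then have "(\<Sum>j<length ws. c j *\<^sub>R ws ! j) = 0" by simp
  then show ?thesis using c(4) by simp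
qed

text \<open>Among the completions of \<open>ws\<close> to an independent list of full length in the
  lattice, one of least volume is a basis. A fractional coordinate at a vector of \<open>us\<close>
  would give a completion of smaller volume, and vectors with fractional coordinates at
  \<open>ws\<close> alone are handled by \<open>vol_1_int_span\<close>.\<close>

lemma vol_1_extend:
  assumes bs: "vol bs = 1" and ss: "semistable (int_span bs)"
    and ws: "set ws \<subseteq> int_span bs" "vol ws = 1"
  obtains us where "int_span (us @ ws) = int_span bs" "length (us @ ws) = length bs"
proof -
  define L where "L = int_span bs"
  have L: "additive_subgroup L" "semistable L"
    using ss by (auto simp: L_def additive_subgroup_int_span)
  have ind: "independent (set bs)" "distinct bs" "independent (set ws)" "distinct ws"
    using vol_pos_iff[of bs] vol_pos_iff[of ws] bs ws by auto
  have spL: "span L = span (set bs)"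
    by (simp add: L_def)
  define P where "P us \<longleftrightarrow> set us \<subseteq> L \<and> length (us @ ws) = length bs \<and> vol (us @ ws) > 0" for us
  have "\<exists>us. P us"
  proof -
    obtain B where B: "set ws \<subseteq> B" "B \<subseteq> set ws \<union> set bs" "independent B" "set ws \<union> set bs \<subseteq> span B"
      using maximal_independent_subset_extend[of "set ws" "set ws \<union> set bs"] ind by auto
    have "B \<subseteq> span (set bs)"
      using B(2) ws(1) int_span_subset_span[of bs] span_superset[of "set bs"] by auto
    then have "span B = span (set bs)"
      using B(4) by (meson le_sup_iff span_minimal subset_antisym subspace_span)
    then have "card B = card (set bs)"
      using B(3) ind(1) by (metis dim_eq_card_independent dim_span)
    moreover have "finite B" using B(2) finite_subset by blast
    moreover obtain us where us: "set us = B - set ws" "distinct us"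
      using finite_distinct_list[of "B - set ws"] \<open>finite B\<close> by auto
    moreover have "card (set ws) \<le> card B"
      using B(1) \<open>finite B\<close> by (rule card_mono[rotated])
    ultimately have len: "length (us @ ws) = length bs"
      using ind B(1) by (simp add: distinct_card[symmetric] card_Diff_subset)
    have "set (us @ ws) = B" using us B(1) by auto
    then have "vol (us @ ws) > 0"
      unfolding vol_pos_iff using B(3) us ind by auto
    moreover have "set us \<subseteq> L"
      using us(1) B(2) set_subset_int_span[of bs] by (auto simp: L_def)
    ultimately show ?thesis unfolding P_def using len by blast
  qed
  \<comment> \<open>Relative to the basis \<open>bs\<close> of volume 1 the volumes of completions
    are natural numbers, so a least one exists.\<close>
  moreover have volnat: "\<exists>m::nat. vol (us @ ws) = of_nat m" if "P us" for us
    using vol_int_lincomb[of "us @ ws" bs] that ws bs by (auto simp: P_def L_def)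
  ultimately obtain us where us: "P us" and min: "\<And>us'. P us' \<Longrightarrow> vol (us @ ws) \<le> vol (us' @ ws)"
  proof -
    assume *: "\<And>us. P us \<Longrightarrow> (\<And>us'. P us' \<Longrightarrow> vol (us @ ws) \<le> vol (us' @ ws)) \<Longrightarrow> thesis"
    define us where "us = arg_min (\<lambda>us. nat \<lfloor>vol (us @ ws)\<rfloor>) P"
    obtain us0 where "P us0" using \<open>\<exists>us. P us\<close> by blast
    have 1: "P us" unfolding us_def by (rule arg_min_natI[where P = P, OF \<open>P us0\<close>])
    have "vol (us @ ws) \<le> vol (us' @ ws)" if "P us'" for us'
    proof -
      have "nat \<lfloor>vol (us @ ws)\<rfloor> \<le> nat \<lfloor>vol (us' @ ws)\<rfloor>"
        unfolding us_def by (rule arg_min_nat_le[where P = P, OF that])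
      then show ?thesis
        using volnat[OF 1] volnat[OF that] by auto
    qed
    then show thesis using * 1 by blast
  qed
  define xs where "xs = us @ ws"
  have xs: "set xs \<subseteq> L" "length xs = length bs" "vol xs > 0"
    using us ws by (auto simp: P_def xs_def L_def)
  have "set bs \<subseteq> span (set xs)"
  proof -
    have "card (set xs) = card (set bs)"
      using xs ind by (metis distinct_card vol_pos_iff)
    moreover have "set xs \<subseteq> span (set bs)"
      using xs(1) int_span_subset_span unfolding L_def by blast
    ultimately show ?thesis
      using xs(3) ind(1) vol_pos_iff[of xs]
      by (metis card_ge_dim_independent dim_eq_card_independent dim_span order_refl span_superset subset_trans)
  qed
  then have spx: "L \<subseteq> span (set xs)"
    unfolding L_def using int_span_subset_span[of bs] by (meson span_minimal subspace_span subset_trans)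
  have "L \<subseteq> int_span xs"
  proof
    fix z assume z: "z \<in> L"
    obtain c where c: "(\<Sum>j<length xs. c j *\<^sub>R xs ! j) \<in> L" "\<And>j. 0 \<le> c j" "\<And>j. c j < 1"
      "z - (\<Sum>j<length xs. c j *\<^sub>R xs ! j) \<in> int_span xs"
      using frac_representation[OF L(1) xs(1) z] spx z by blast
    define y where "y = (\<Sum>j<length xs. c j *\<^sub>R xs ! j)"
    have c0: "c j = 0" if j: "j < length us" for j
    proof (rule ccontr)
      assume "c j \<noteq> 0"
      then have cj: "0 < c j" using c(2)[of j] by simp
      have *: "us[j := y] @ ws = xs[j := y]"
        using j by (simp add: xs_def list_update_append)
      then have v: "vol (us[j := y] @ ws) = c j * vol xs"
        using vol_list_update[of j xs c] j cj by (simp add: y_def xs_def)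
      then have "P (us[j := y])"
        using us cj xs(3) c(1) set_update_subset_insert[of us j y]
        by (auto simp: P_def y_def)
      from min[OF this] have "vol xs \<le> c j * vol xs"
        using v by (simp add: xs_def)
      then show False using c(3)[of j] xs(3) by simp
    qed
    have "y = (\<Sum>j<length us + length ws. c j *\<^sub>R xs ! j)"
      by (simp add: y_def xs_def)
    also have "\<dots> \<in> span (set ws)"
    proof (rule span_sum)
      fix j assume "j \<in> {..<length us + length ws}"
      then have "j < length us \<or> xs ! j \<in> set ws"
        by (auto simp: xs_def nth_append)
      then show "c j *\<^sub>R xs ! j \<in> span (set ws)"
        using c0[of j] span_base[of "xs ! j" "set ws"] by (auto simp: span_zero intro: span_scale)
    qed
    finally have "y \<in> int_span ws"
      using c(1) ws by (intro vol_1_int_span[OF L]) (auto simp: y_def L_def)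
    then have "y \<in> int_span xs"
      using int_span_subset_iff[of ws xs] set_subset_int_span[of xs] by (auto simp: xs_def)
    then show "z \<in> int_span xs"
      using additive_subgroup_add[OF additive_subgroup_int_span c(4), of y] by (simp add: y_def)
  qed
  then have "int_span xs = L"
    using int_span_least[OF L(1) xs(1)] by blast
  then show ?thesis
    using that[of us] xs(2) by (simp add: xs_def L_def)
qed

lemma vol_append_pos: "vol (us @ vs) > 0 \<Longrightarrow> vol vs > 0"
  using vol_nonneg[of vs] vol_nonneg[of "map (res (set vs)) us"]
  by (auto simp: vol_append zero_less_mult_iff)

section \<open>Lattice determinants\<close>

lemma lattice_basis_iff: "lattice_basis vs L \<longleftrightarrow> vol vs > 0 \<and> int_span vs = L"
  by (auto simp: lattice_basis_def vol_pos_iff)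

text \<open>Whichever basis \<open>SOME\<close> picks, it has the same real span, hence the same
  length, and \<open>vol_cong_int_span\<close> applies. For \<open>L = {0}\<close> the basis is
  empty and both conventions give 1.\<close>

lemma lattice_det_eq_vol:
  fixes vs :: "'a::euclidean_space list"
  assumes vs: "vol vs > 0" "int_span vs = L"
  shows "lattice_det L = vol vs"
proof (cases "L = {0}")
  case True
  then have "set vs \<subseteq> {0}" using set_subset_int_span[of vs] vs(2) by simp
  moreover have "0 \<notin> set vs" using vs(1) vol_pos_iff dependent_zero by blast
  ultimately have "vs = []" by (cases vs) auto
  then show ?thesis using True by (simp add: lattice_det_def)
next
  case False
  define ws where "ws = (SOME ws. lattice_basis ws L)"
  have "lattice_basis ws L"
    unfolding ws_def by (rule someI[of _ vs]) (simp add: lattice_basis_iff vs)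
  then have ws: "vol ws > 0" "int_span ws = L"
    by (simp_all add: lattice_basis_iff)
  have "span (set ws) = span (set vs)"
    using ws(2) vs(2) span_int_span by metis
  then have "card (set ws) = card (set vs)"
    using ws(1) vs(1) by (metis dim_eq_card_independent dim_span vol_pos_iff)
  then have "length ws = length vs"
    using ws(1) vs(1) by (simp add: vol_pos_iff distinct_card)
  then have "vol ws = vol vs"
    using ws vs by (intro vol_cong_int_span) auto
  then show ?thesis
    using False by (simp add: lattice_det_def ws_def[symmetric] gram_det_vol)
qed

text \<open>The domain of the maximization: stability phrased through volumes of lists. In this form
  it passes to orthogonal sums and is a closed condition on basis matrices.\<close>

definition unimodular_lattices :: "'a::euclidean_space set set" where
  "unimodular_lattices = {int_span vs | vs. length vs = DIM('a) \<and> vol vs = 1 \<and> semistable (int_span vs)}"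

lemma stable_lattice_unimodular:
  assumes "full_rank_lattice L" "stable_lattice L"
  shows "L \<in> unimodular_lattices"
proof -
  obtain vs where vs: "vol vs > 0" "int_span vs = L" "length vs = CARD('a)"
    using assms(1) by (auto simp: full_rank_lattice_def lattice_basis_iff)
  have "vol vs = 1"
    using assms(2) lattice_det_eq_vol[OF vs(1,2)] by (simp add: stable_lattice_def)
  moreover have "semistable L"
    unfolding semistable_def
  proof (intro allI impI)
    fix us assume us: "set us \<subseteq> L"
    show "vol us = 0 \<or> 1 \<le> vol us"
    proof (cases "vol us = 0")
      case False
      then have "vol us > 0" using vol_nonneg[of us] by linarith
      moreover have "int_span us \<subseteq> L"
        using us vs(2) int_span_least[OF additive_subgroup_int_span] by blast
      ultimately show ?thesis
        using assms(2) additive_subgroup_int_span[of us] lattice_det_eq_vol[OF \<open>vol us > 0\<close> refl]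
        unfolding stable_lattice_def by metis
    qed simp
  qed
  ultimately show ?thesis
    unfolding unimodular_lattices_def using vs by auto
qed

section \<open>Reduced bases\<close>

text \<open>The potential of the LLL algorithm: the product of the determinants of the sublattices
  spanned by the suffixes of the basis. No algorithm is needed here, since a basis whose potential
  is close to the infimum is already reduced.\<close>

primrec potential :: "'a::euclidean_space list \<Rightarrow> real" where
  "potential [] = 1"
| "potential (v # vs) = vol (v # vs) * potential vs"

lemma potential_ge_1:
  assumes "semistable L"
  shows "set vs \<subseteq> L \<Longrightarrow> vol vs > 0 \<Longrightarrow> potential vs \<ge> 1"
proof (induction vs)
  case (Cons v vs)
  have "vol (v # vs) \<ge> 1"
    using Cons.prems by (intro semistableD[OF assms])
  moreover have "vol vs > 0"
    using Cons.prems(2) vol_nonneg[of vs] by (auto simp: zero_less_mult_iff)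
  then have "potential vs \<ge> 1"
    using Cons by auto
  ultimately show ?case
    using mult_mono[of 1 "vol (v # vs)" 1 "potential vs"] by simp
qed simp

lemma potential_nonneg [simp]: "potential vs \<ge> 0"
  by (induction vs) auto

text \<open>Factors from suffixes that begin inside \<open>zs\<close> depend only on the spanned
  lattice, so the potentials differ only through \<open>xs\<close> and \<open>ys\<close>. The
  quotient is written in cross-multiplied form.\<close>

lemma potential_append_cong:
  assumes "int_span xs = int_span ys" "length xs = length ys"
  shows "potential (zs @ xs) * potential ys = potential (zs @ ys) * potential xs"
proof (induction zs)
  case (Cons z zs)
  have "int_span ((z # zs) @ xs) = int_span ((z # zs) @ ys)"
    by (simp only: int_span_append assms)
  then have "vol ((z # zs) @ xs) = vol ((z # zs) @ ys)"
    using assms(2) by (intro vol_cong_int_span) auto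
  then show ?case using Cons by (simp add: algebra_simps)
qed simp

lemma res_insert_eq:
  obtains k where "res (set vs) v = res (set (u # vs)) v + k *\<^sub>R res (set vs) u"
proof -
  have "res (set vs \<union> {u}) v = res {res (set vs) u} (res (set vs) v)"
    using res_Un[of "set vs" "{u}" v] by simp
  moreover have "res (set vs) v - res {res (set vs) u} (res (set vs) v) \<in> span {res (set vs) u}"
    by (rule res_diff)
  ultimately obtain k where "res (set vs) v - res (set vs \<union> {u}) v = k *\<^sub>R res (set vs) u"
    unfolding span_singleton by auto
  then show ?thesis
    using that[of k] by (simp add: algebra_simps)
qed

text \<open>The infimum of the potential over all bases is at least 1, hence positive, and a basis
  within a constant factor of it cannot be improved much. Swapping two neighbours after rounding
  changes just one factor of the potential, which yields a Lovasz condition.\<close>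

lemma reduced_basis_exists:
  assumes L: "additive_subgroup L" "semistable L" and vs: "set vs \<subseteq> L" "vol vs > 0"
  obtains us where "length us = length vs" "int_span us = int_span vs"
    "\<And>as v u bs. us = as @ v # u # bs \<Longrightarrow> norm (res (set bs) u) \<le> 2 * norm (res (set (u # bs)) v)"
proof -
  define Q where "Q us \<longleftrightarrow> length us = length vs \<and> int_span us = int_span vs" for us
  have Qvol: "vol us > 0" "set us \<subseteq> L" if "Q us" for us
  proof -
    show "vol us > 0"
      using that vs(2) vol_cong_int_span[of us vs] by (simp add: Q_def)
    show "set us \<subseteq> L"
      using that set_subset_int_span[of us] int_span_least[OF L(1) vs(1)] by (auto simp: Q_def)
  qed
  define m where "m = Inf (potential ` Collect Q)"
  have Qvs: "Q vs" by (simp add: Q_def)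
  have "m \<ge> 1"
    unfolding m_def using Qvs potential_ge_1[OF L(2)] Qvol by (intro cInf_greatest) auto
  \<comment> \<open>Any factor \<lambda> > 1 with
    \<open>1 / \<lambda>\<^sup>2 - 1 / 4 \<ge> 1 / 4\<close> would do: the term 1/4 on the left is
    the rounding error, and the right-hand side is what the factor 2 in the conclusion asks
    for.\<close>
  then have "Inf (potential ` Collect Q) < 11/10 * m" by (simp add: m_def)
  then obtain us where us: "Q us" "potential us < 11/10 * m"
    using Qvs cInf_lessD[of "potential ` Collect Q"] by fastforce
  have bdd: "bdd_below (potential ` Collect Q)"
    by (rule bdd_belowI[of _ 0]) auto
  have near: "potential us \<le> 11/10 * potential us'" if "Q us'" for us'
  proof -
    have "m \<le> potential us'"
      unfolding m_def using that bdd by (intro cInf_lower) auto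
    then show ?thesis using us(2) by simp
  qed
  have "norm (res (set bs) u) \<le> 2 * norm (res (set (u # bs)) v)" if us_eq: "us = as @ v # u # bs"
    for as v u bs
  proof -
    obtain k where k: "res (set bs) v = res (set (u # bs)) v + k *\<^sub>R res (set bs) u"
      by (rule res_insert_eq)
    \<comment> \<open>\<open>w\<close> is \<open>v\<close> reduced by the nearest multiple of
      \<open>u\<close>; in the competing basis \<open>u\<close> and \<open>w\<close> stand in
      exchanged order.\<close>
    define w where "w = v - of_int (round k) *\<^sub>R u"
    have sp: "int_span (u # w # bs) = int_span (v # u # bs)"
    proof
      note gr = additive_subgroup_add[OF additive_subgroup_int_span]
        additive_subgroup_diff[OF additive_subgroup_int_span]
        additive_subgroup_scale[OF additive_subgroup_int_span]
      have "u \<in> int_span (v # u # bs)" "v \<in> int_span (v # u # bs)" "set bs \<subseteq> int_span (v # u # bs)"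
        using set_subset_int_span[of "v # u # bs"] by auto
      then show "int_span (u # w # bs) \<subseteq> int_span (v # u # bs)"
        unfolding int_span_subset_iff w_def by (auto intro!: gr)
      have *: "u \<in> int_span (u # w # bs)" "w \<in> int_span (u # w # bs)" "set bs \<subseteq> int_span (u # w # bs)"
        using set_subset_int_span[of "u # w # bs"] by auto
      then have "w + of_int (round k) *\<^sub>R u \<in> int_span (u # w # bs)"
        by (intro gr)
      then have "v \<in> int_span (u # w # bs)"
        by (simp add: w_def)
      then show "int_span (v # u # bs) \<subseteq> int_span (u # w # bs)"
        unfolding int_span_subset_iff using * by simp
    qed
    have "int_span (as @ u # w # bs) = int_span us"
      unfolding us_eq by (simp only: int_span_append sp)
    then have Q': "Q (as @ u # w # bs)"
      using us(1) us_eq by (simp add: Q_def)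
    have volsp: "vol (v # u # bs) = vol (u # w # bs)"
      using sp by (intro vol_cong_int_span) auto
    have pos: "vol (v # u # bs) > 0" "vol (u # bs) > 0" "vol bs > 0" "potential bs \<ge> 1"
    proof -
      have "vol us > 0" using Qvol us(1) by blast
      then show "vol (v # u # bs) > 0" "vol (u # bs) > 0" "vol bs > 0"
        using vol_append_pos[of as "v # u # bs"] vol_append_pos[of "[v]" "u # bs"]
          vol_append_pos[of "[u]" bs] by (simp_all add: us_eq)
      then show "potential bs \<ge> 1"
        using Qvol(2)[OF us(1)] us_eq by (intro potential_ge_1[OF L(2)]) auto
    qed
    have "potential us * potential (u # w # bs) = potential (as @ u # w # bs) * potential (v # u # bs)"
      unfolding us_eq by (rule potential_append_cong) (simp_all add: sp)
    then have "potential us * (vol (u # w # bs) * (vol (w # bs) * potential bs))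
        = potential (as @ u # w # bs) * (vol (u # w # bs) * (vol (u # bs) * potential bs))"
      unfolding potential.simps volsp .
    then have "(potential us * vol (w # bs)) * (vol (u # w # bs) * potential bs)
        = (potential (as @ u # w # bs) * vol (u # bs)) * (vol (u # w # bs) * potential bs)"
      by (simp only: mult_ac)
    moreover have "vol (u # w # bs) * potential bs \<noteq> 0"
      using pos(1,4) volsp by (metis less_irrefl mult_eq_0_iff not_one_le_zero)
    ultimately have "potential us * vol (w # bs) = potential (as @ u # w # bs) * vol (u # bs)"
      by (metis mult_right_cancel)
    then have "potential us * norm (res (set bs) w) = potential (as @ u # w # bs) * norm (res (set bs) u)"
      using pos(3) by simp
    also have "\<dots> \<ge> (10/11 * potential us) * norm (res (set bs) u)"
      using near[OF Q'] by (intro mult_right_mono) auto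
    finally have "potential us * (10/11 * norm (res (set bs) u)) \<le> potential us * norm (res (set bs) w)"
      by (simp add: algebra_simps)
    moreover have "potential us > 0"
      using potential_ge_1[OF L(2) Qvol(2)[OF us(1)] Qvol(1)[OF us(1)]] by linarith
    ultimately have 1: "10/11 * norm (res (set bs) u) \<le> norm (res (set bs) w)"
      by simp
    have "res (set bs) w = res (set (u # bs)) v + (k - of_int (round k)) *\<^sub>R res (set bs) u"
      by (simp add: w_def res_minus res_scale k algebra_simps)
    moreover have "inner (res (set (u # bs)) v) (res (set bs) u) = 0"
    proof -
      have "u - res (set bs) u \<in> span (set (u # bs))"
        using res_diff[of u "set bs"] span_mono[of "set bs" "set (u # bs)"] by auto
      moreover have "u \<in> span (set (u # bs))"
        by (simp add: span_base)
      ultimately have "u - (u - res (set bs) u) \<in> span (set (u # bs))"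
        by (rule span_diff[rotated])
      then show ?thesis by (simp add: res_orth)
    qed
    ultimately have "(norm (res (set bs) w))\<^sup>2
        = (norm (res (set (u # bs)) v))\<^sup>2 + (k - of_int (round k))\<^sup>2 * (norm (res (set bs) u))\<^sup>2"
      by (simp add: norm_sq_add_orth power_mult_distrib)
    moreover have "(k - of_int (round k))\<^sup>2 \<le> (1/2)\<^sup>2"
    proof (rule power2_le_iff_abs_le[THEN iffD2])
      show "\<bar>k - of_int (round k)\<bar> \<le> 1/2"
        using of_int_round_abs_le[of k] by (simp add: abs_minus_commute)
    qed simp
    moreover have "(10/11 * norm (res (set bs) u))\<^sup>2 \<le> (norm (res (set bs) w))\<^sup>2"
      using 1 by (intro power_mono) auto
    ultimately have "(10/11)\<^sup>2 * (norm (res (set bs) u))\<^sup>2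
        \<le> (norm (res (set (u # bs)) v))\<^sup>2 + (1/2)\<^sup>2 * (norm (res (set bs) u))\<^sup>2"
      using mult_right_mono[of "(k - of_int (round k))\<^sup>2" "(1/2)\<^sup>2" "(norm (res (set bs) u))\<^sup>2"]
      unfolding power_mult_distrib by simp
    then have "(norm (res (set bs) u))\<^sup>2 \<le> (2 * norm (res (set (u # bs)) v))\<^sup>2"
    proof -
      have "a \<le> 4 * b" if "(10/11)\<^sup>2 * a \<le> b + (1/2)\<^sup>2 * a" "0 \<le> b" for a b :: real
      proof -
        have "(100/121) * a \<le> b + (1/4) * a"
          using that(1) by (simp only: power_divide) simp
        then show ?thesis using that(2) by linarith
      qed
      moreover assume "(10/11)\<^sup>2 * (norm (res (set bs) u))\<^sup>2
        \<le> (norm (res (set (u # bs)) v))\<^sup>2 + (1/2)\<^sup>2 * (norm (res (set bs) u))\<^sup>2"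
      ultimately have "(norm (res (set bs) u))\<^sup>2 \<le> 4 * (norm (res (set (u # bs)) v))\<^sup>2"
        using zero_le_power2 by blast
      then show ?thesis by (simp add: power_mult_distrib)
    qed
    then show ?thesis by (rule power2_le_imp_le) simp
  qed
  then show ?thesis
    using that us(1) by (auto simp: Q_def)
qed

section \<open>Nearest planes and size reduction\<close>

primrec res_sum :: "'a::euclidean_space list \<Rightarrow> real" where
  "res_sum [] = 0"
| "res_sum (v # vs) = norm (res (set vs) v) + res_sum vs"

lemma res_sum_nonneg [simp]: "res_sum vs \<ge> 0"
  by (induction vs) auto

text \<open>Babai's nearest plane procedure: the component along each Gram-Schmidt direction is
  rounded in turn, at a cost of at most the length of that direction. The sharper factor 1/2 is
  given away.\<close>

lemma nearest_plane: "\<exists>w\<in>int_span vs. norm (v - w) \<le> norm (res (set vs) v) + res_sum vs"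
proof (induction vs arbitrary: v)
  case (Cons u vs)
  obtain k where k: "res (set vs) v = res (set (u # vs)) v + k *\<^sub>R res (set vs) u"
    by (rule res_insert_eq)
  define v' where "v' = v - of_int (round k) *\<^sub>R u"
  obtain w where w: "w \<in> int_span vs" "norm (v' - w) \<le> norm (res (set vs) v') + res_sum vs"
    using Cons by blast
  have "res (set vs) v' = res (set (u # vs)) v + (k - of_int (round k)) *\<^sub>R res (set vs) u"
    by (simp add: v'_def res_minus res_scale k algebra_simps)
  then have "norm (res (set vs) v') \<le> norm (res (set (u # vs)) v) + \<bar>k - of_int (round k)\<bar> * norm (res (set vs) u)"
    by (metis norm_scaleR norm_triangle_ineq)
  also have "\<bar>k - of_int (round k)\<bar> * norm (res (set vs) u) \<le> 1 * norm (res (set vs) u)"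
    using of_int_round_abs_le[of k] by (intro mult_right_mono) (auto simp: abs_minus_commute)
  finally have "norm (v - (of_int (round k) *\<^sub>R u + w)) \<le> norm (res (set (u # vs)) v) + res_sum (u # vs)"
    using w(2) by (simp add: v'_def algebra_simps)
  moreover have "of_int (round k) *\<^sub>R u + w \<in> int_span (u # vs)"
    using w(1) unfolding int_span_Cons by blast
  ultimately show ?case by blast
qed simp

text \<open>From every vector a nearby point of the lattice spanned by the later ones is subtracted;
  \<open>nearest_plane\<close> then bounds all norms at once.\<close>

lemma size_reduce: "\<exists>us. length us = length vs \<and> int_span us = int_span vs \<and> (\<forall>u\<in>set us. norm u \<le> res_sum vs)"
proof (induction vs)
  case (Cons v vs)
  then obtain us where us: "length us = length vs" "int_span us = int_span vs" "\<forall>u\<in>set us. norm u \<le> res_sum vs"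
    by blast
  obtain w where w: "w \<in> int_span vs" "norm (v - w) \<le> norm (res (set vs) v) + res_sum vs"
    using nearest_plane by blast
  have "int_span ((v - w) # us) = int_span (v # vs)"
  proof -
    have sub: "set us \<subseteq> int_span (v # vs)" "set vs \<subseteq> int_span ((v - w) # us)" "w \<in> int_span (v # vs)"
      "w \<in> int_span ((v - w) # us)"
    proof -
      have *: "int_span xs \<subseteq> int_span (x # xs)" for x :: 'a and xs
        using set_subset_int_span[of "x # xs"] by (simp add: int_span_subset_iff)
      show "set us \<subseteq> int_span (v # vs)" "set vs \<subseteq> int_span ((v - w) # us)"
        using *[of vs v] *[of us "v - w"] us(2) set_subset_int_span by blast+
      show "w \<in> int_span (v # vs)" "w \<in> int_span ((v - w) # us)"
        using *[of vs v] *[of us "v - w"] us(2) w(1) by blast+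
    qed
    have "v \<in> int_span (v # vs)" "v - w \<in> int_span ((v - w) # us)"
      using set_subset_int_span[of "v # vs"] set_subset_int_span[of "(v - w) # us"] by auto
    then have "v - w \<in> int_span (v # vs)" "v - w + w \<in> int_span ((v - w) # us)"
      using sub additive_subgroup_diff[OF additive_subgroup_int_span]
        additive_subgroup_add[OF additive_subgroup_int_span] by blast+
    then show ?thesis
      using sub by (intro subset_antisym) (auto simp: int_span_subset_iff)
  qed
  moreover have "\<forall>u\<in>set ((v - w) # us). norm u \<le> res_sum (v # vs)"
    using us(3) w(2) by (auto intro: order.trans)
  ultimately show ?case
    using us(1) by (intro exI[of _ "(v - w) # us"]) auto
qed simp

text \<open>If no Gram-Schmidt norm is below \<open>c\<close>, each of them is at most the volume
  divided by a power of \<open>c\<close>, since the product of the others is bounded below.\<close>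

lemma res_sum_le:
  assumes c: "0 < c" "c \<le> 1" and "\<And>as v bs. vs = as @ v # bs \<Longrightarrow> c \<le> norm (res (set bs) v)"
  shows "c ^ length vs * res_sum vs \<le> of_nat (length vs) * vol vs" "c ^ length vs \<le> vol vs"
proof -
  have "c ^ length vs * res_sum vs \<le> of_nat (length vs) * vol vs \<and> c ^ length vs \<le> vol vs"
    using assms(3)
  proof (induction vs)
    case (Cons v vs)
    have "c \<le> norm (res (set bs) w)" if "vs = as @ w # bs" for as w bs
      using Cons.prems[of "v # as"] that by simp
    then have IH: "c ^ length vs * res_sum vs \<le> of_nat (length vs) * vol vs" "c ^ length vs \<le> vol vs"
      using Cons.IH by auto
    define r where "r = norm (res (set vs) v)"
    have r: "c \<le> r" using Cons.prems[of "[]"] by (simp add: r_def)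
    have "c * c ^ length vs * res_sum vs \<le> r * (of_nat (length vs) * vol vs)"
      using mult_mono[OF r IH(1)] c r by (simp add: mult.assoc)
    moreover have "c * c ^ length vs * r \<le> vol vs * r"
      using mult_mono[of c 1 "c ^ length vs" "vol vs"] IH(2) c r by (intro mult_right_mono) auto
    moreover have "c * c ^ length vs \<le> r * vol vs"
      using mult_mono[OF r IH(2)] c r by simp
    ultimately show ?case
      by (simp add: r_def[symmetric] algebra_simps)
  qed simp
  then show "c ^ length vs * res_sum vs \<le> of_nat (length vs) * vol vs" "c ^ length vs \<le> vol vs" by auto
qed

text \<open>The bound involves rank and determinant alone, which is what compactness rests on. The
  last Gram-Schmidt vector is a lattice vector, of norm at least 1, and by reducedness each one is
  at least half as long as the one after it; \<open>res_sum_le\<close> turns these lower bounds into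
  upper ones.\<close>

lemma bounded_basis_exists:
  assumes L: "additive_subgroup L" "semistable L" and vs: "set vs \<subseteq> L" "vol vs > 0"
  obtains us where "length us = length vs" "int_span us = int_span vs"
    "\<And>u. u \<in> set us \<Longrightarrow> norm u \<le> of_nat (length vs) * 2 ^ (length vs * length vs) * vol vs"
proof -
  obtain us where us: "length us = length vs" "int_span us = int_span vs"
    "\<And>as v u bs. us = as @ v # u # bs \<Longrightarrow> norm (res (set bs) u) \<le> 2 * norm (res (set (u # bs)) v)"
    using reduced_basis_exists[OF L vs] by metis
  have vol: "vol us = vol vs"
    by (rule vol_cong_int_span[OF us(1,2)])
  have usL: "set us \<subseteq> L"
    using us(2) set_subset_int_span[of us] int_span_least[OF L(1) vs(1)] by auto
  have *: "(1/2) ^ length bs \<le> norm (res (set bs) v)" if "us = as @ v # bs" for as v bs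
    using that
  proof (induction bs arbitrary: as v)
    case Nil
    then have "vol us \<noteq> 0" "v \<in> L" using vol vs(2) usL by auto
    then have "v \<noteq> 0" using Nil by (auto simp: vol_append)
    then show ?case using semistable_norm_ge[OF L(2) \<open>v \<in> L\<close>] by simp
  next
    case (Cons u bs)
    have "(1/2) ^ length bs \<le> norm (res (set bs) u)"
      using Cons.IH[of "as @ [v]" u] Cons.prems by simp
    then show ?case
      using us(3)[OF Cons.prems] by simp
  qed
  \<comment> \<open>A common lower bound of the Gram-Schmidt norms; its power
    \<open>c ^ length us\<close> is the source of
    \<open>2 ^ (length vs * length vs)\<close>.\<close>
  define c :: real where "c = (1/2) ^ length vs"
  have "c \<le> norm (res (set bs) v)" if "us = as @ v # bs" for as v bs
  proof -
    have "length bs \<le> length vs" using us(1) that by simp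
    then have "c \<le> (1/2) ^ length bs"
      unfolding c_def by (intro power_decreasing) auto
    then show ?thesis using *[OF that] by linarith
  qed
  moreover have "0 < c" "c \<le> 1"
    by (auto simp: c_def power_le_one)
  ultimately have "c ^ length us * res_sum us \<le> of_nat (length us) * vol us"
    using res_sum_le(1)[of c us] by blast
  then have "res_sum us \<le> of_nat (length vs) * vol vs * 2 ^ (length vs * length vs)"
    by (simp add: us(1) vol c_def power_mult[symmetric] power_one_over field_simps)
  moreover obtain ws where ws: "length ws = length us" "int_span ws = int_span us" "\<forall>u\<in>set ws. norm u \<le> res_sum us"
    using size_reduce by blast
  ultimately show ?thesis
    using that[of ws] us by (fastforce simp: mult_ac)
qed

section \<open>Gaussian sums over shifted lattices\<close>

text \<open>The theta series of the translate of \<open>M\<close> by \<open>u\<close>, with Gaussian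
  parameter \<open>t\<close>.\<close>

definition gsum :: "'a::real_inner set \<Rightarrow> real \<Rightarrow> 'a \<Rightarrow> real" where
  "gsum M t u = (\<Sum>\<^sub>\<infinity>x\<in>M. exp (- t * (norm (x + u))\<^sup>2))"

lemma norm_sq_shift_le:
  fixes x u :: "'a::real_inner"
  shows "(norm x)\<^sup>2 \<le> 2 * (norm (x + u))\<^sup>2 + 2 * (norm u)\<^sup>2"
proof -
  have "2 * (norm (x + u))\<^sup>2 + 2 * (norm u)\<^sup>2 - (norm x)\<^sup>2 = (norm (x + 2 *\<^sub>R u))\<^sup>2"
    by (simp add: power2_norm_eq_inner inner_add inner_commute algebra_simps)
  then show ?thesis by (metis diff_ge_0_iff_ge zero_le_power2)
qed

lemma has_sum_product_nonneg:
  fixes f :: "'a \<Rightarrow> real" and g :: "'b \<Rightarrow> real"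
  assumes f: "(f has_sum a) A" and g: "(g has_sum b) B"
    and nonneg: "\<And>x. x \<in> A \<Longrightarrow> 0 \<le> f x" "\<And>y. y \<in> B \<Longrightarrow> 0 \<le> g y"
  shows "((\<lambda>(x, y). f x * g y) has_sum a * b) (A \<times> B)"
proof -
  have 1: "((\<lambda>y. (case (x, y) of (x, y) \<Rightarrow> f x * g y)) has_sum f x * b) B" for x
    using has_sum_cmult_right[OF g, of "f x"] by simp
  have 2: "((\<lambda>x. f x * b) has_sum a * b) A"
    using has_sum_cmult_left[OF f] by simp
  have "(\<lambda>(x, y). f x * g y) summable_on A \<times> B"
    using 1 has_sum_imp_summable[OF 2] nonneg by (intro summable_on_SigmaI) auto
  then show ?thesis
    using 1 2 by (intro has_sum_SigmaI)
qed

text \<open>Summability for every \<open>t\<close> stands for discreteness; the rank of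
  \<open>M\<close> is left open, as it will be a sublattice whose rank may be smaller than the
  dimension.\<close>

locale gaussian_group =
  fixes M :: "'a::real_inner set"
  assumes M: "additive_subgroup M"
    and summable: "\<And>t. t > 0 \<Longrightarrow> (\<lambda>x. exp (- t * (norm x)\<^sup>2)) summable_on M"
begin

lemma exp_shift_le:
  fixes x u :: 'a
  assumes "t > 0"
  shows "exp (- t * (norm (x + u))\<^sup>2) \<le> exp (t * (norm u)\<^sup>2) * exp (- (t/2) * (norm x)\<^sup>2)"
proof -
  have "- t * (norm (x + u))\<^sup>2 \<le> t * (norm u)\<^sup>2 + - (t/2) * (norm x)\<^sup>2"
    using mult_left_mono[OF norm_sq_shift_le[of x u], of "t/2"] assms by (simp add: algebra_simps)
  then show ?thesis by (simp add: exp_add[symmetric])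
qed

lemma summable_shift:
  assumes "t > 0" shows "(\<lambda>x. exp (- t * (norm (x + u))\<^sup>2)) summable_on M"
  using assms exp_shift_le
  by (intro summable_on_comparison_test[OF summable_on_cmult_right[OF summable[of "t/2"]]]) auto

lemma has_sum_gsum: "t > 0 \<Longrightarrow> ((\<lambda>x. exp (- t * (norm (x + u))\<^sup>2)) has_sum gsum M t u) M"
  unfolding gsum_def using summable_shift by (rule has_sum_infsum)

lemma gsum_nonneg: "gsum M t u \<ge> 0"
  unfolding gsum_def by (rule infsum_nonneg) simp

lemma gsum_periodic:
  assumes "m \<in> M" shows "gsum M t (u + m) = gsum M t u"
proof -
  have "bij_betw (\<lambda>x. x + m) M M"
    by (rule bij_betwI[where g = "\<lambda>x. x - m"])
      (use assms additive_subgroup_add[OF M] additive_subgroup_diff[OF M] in auto)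
  from infsum_reindex_bij_betw[OF this, of "\<lambda>x. exp (- t * (norm (x + u))\<^sup>2)"]
  show ?thesis by (simp add: gsum_def add_ac)
qed

lemma gsum_0_ge_1: "t > 0 \<Longrightarrow> gsum M t 0 \<ge> 1"
  using finite_sum_le_infsum[OF summable[of t], of "{0}"] additive_subgroup_0[OF M]
  by (simp add: gsum_def)

text \<open>A representative of the class of \<open>z\<close> modulo \<open>2 M\<close>. The
  predicate depends on that class alone, so \<open>SOME\<close> picks the same element throughout a
  class (\<open>rep_add\<close>).\<close>

definition rep :: "'a \<Rightarrow> 'a" where
  "rep z = (SOME c. c \<in> M \<and> (\<exists>p\<in>M. z = c + 2 *\<^sub>R p))"

lemma rep_props: "z \<in> M \<Longrightarrow> rep z \<in> M \<and> (\<exists>p\<in>M. z = rep z + 2 *\<^sub>R p)"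
  unfolding rep_def by (rule someI[of _ z]) (use additive_subgroup_0[OF M] in auto)

lemma rep_add: "p \<in> M \<Longrightarrow> rep (z + 2 *\<^sub>R p) = rep z"
proof -
  assume p: "p \<in> M"
  have "(\<exists>q\<in>M. z + 2 *\<^sub>R p = c + 2 *\<^sub>R q) \<longleftrightarrow> (\<exists>q\<in>M. z = c + 2 *\<^sub>R q)" for c
  proof safe
    fix q assume "q \<in> M" "z + 2 *\<^sub>R p = c + 2 *\<^sub>R q"
    then show "\<exists>q\<in>M. z = c + 2 *\<^sub>R q"
      using p by (intro bexI[of _ "q - p"]) (auto simp: algebra_simps additive_subgroup_diff[OF M])
  next
    fix q assume "q \<in> M"
    then show "\<exists>q'\<in>M. c + 2 *\<^sub>R q + 2 *\<^sub>R p = c + 2 *\<^sub>R q'"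
      using p by (intro bexI[of _ "q + p"]) (auto simp: algebra_simps additive_subgroup_add[OF M])
  qed
  then show ?thesis by (simp add: rep_def)
qed

lemma rep_rep: "z \<in> M \<Longrightarrow> rep (rep z) = rep z"
  using rep_props[of z] rep_add by metis

text \<open>The sum \<open>x + y\<close> determines its representative \<open>c\<close> and the
  vector \<open>p\<close> with \<open>x + y = c + 2 p\<close>; then \<open>r = p - y\<close>.
  Halving stays in \<open>M\<close> because \<open>x + y - c\<close> lies in
  \<open>2 M\<close>.\<close>

lemma bij_betw_sum_diff:
  "bij_betw (\<lambda>(c, p, r). (c + p + r, p - r)) (rep ` M \<times> M \<times> M) (M \<times> M)"
proof (rule bij_betwI[where g = "\<lambda>(x, y). (rep (x + y), (1/2) *\<^sub>R (x + y - rep (x + y)),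
    (1/2) *\<^sub>R (x + y - rep (x + y)) - y)"])
  note gr = additive_subgroup_add[OF M] additive_subgroup_diff[OF M]
  show "(\<lambda>(c, p, r). (c + p + r, p - r)) \<in> rep ` M \<times> M \<times> M \<rightarrow> M \<times> M"
    using gr rep_props by auto
  have half: "(1/2) *\<^sub>R (z - rep z) \<in> M" if z: "z \<in> M" for z
  proof -
    obtain p where p: "p \<in> M" "z = rep z + 2 *\<^sub>R p" using rep_props[OF z] by blast
    then have "z - rep z = 2 *\<^sub>R p" by (metis add_diff_cancel_left')
    then show ?thesis using p(1) by simp
  qed
  show "(\<lambda>(x, y). (rep (x + y), (1/2) *\<^sub>R (x + y - rep (x + y)),
      (1/2) *\<^sub>R (x + y - rep (x + y)) - y)) \<in> M \<times> M \<rightarrow> rep ` M \<times> M \<times> M"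
    using half gr by auto
next
  fix a assume "a \<in> rep ` M \<times> M \<times> M"
  then obtain c p r where a: "a = (rep c, p, r)" "c \<in> M" "p \<in> M" "r \<in> M" by auto
  have "rep (rep c + p + r + (p - r)) = rep (rep c + 2 *\<^sub>R p)"
    by (simp add: algebra_simps scaleR_2)
  then have "rep (rep c + p + r + (p - r)) = rep c"
    using a rep_add rep_rep by simp
  then show "(\<lambda>(x, y). (rep (x + y), (1/2) *\<^sub>R (x + y - rep (x + y)),
      (1/2) *\<^sub>R (x + y - rep (x + y)) - y)) ((\<lambda>(c, p, r). (c + p + r, p - r)) a) = a"
    by (simp add: a(1))
next
  fix b assume "b \<in> M \<times> M"
  then obtain x y where b: "b = (x, y)" by auto
  have "rep (x + y) + (1/2) *\<^sub>R (x + y - rep (x + y)) + (1/2) *\<^sub>R (x + y - rep (x + y))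
      = rep (x + y) + (x + y - rep (x + y))"
    by (metis (no_types) add.assoc scaleR_half_double scaleR_right_distrib)
  then have "rep (x + y) + (1/2) *\<^sub>R (x + y - rep (x + y)) + ((1/2) *\<^sub>R (x + y - rep (x + y)) - y) = x"
    by (simp add: algebra_simps)
  then show "(\<lambda>(c, p, r). (c + p + r, p - r)) ((\<lambda>(x, y). (rep (x + y), (1/2) *\<^sub>R (x + y - rep (x + y)),
      (1/2) *\<^sub>R (x + y - rep (x + y)) - y)) b) = b"
    by (simp add: b)
qed

text \<open>With \<open>c\<close> ranging over representatives of \<open>M\<close> modulo \<open>2M\<close>, the substitution \<open>x = c + p + r\<close>,
  \<open>y = p - r\<close> and the parallelogram identity separate the variables \<open>p\<close> and \<open>r\<close>. This elementary
  doubling trick replaces Poisson summation.\<close>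
lemma gsum_product:
  assumes t: "t > 0"
  shows "((\<lambda>c. gsum M (2 * t) ((1/2) *\<^sub>R (c + u + v)) * gsum M (2 * t) ((1/2) *\<^sub>R (c + u - v)))
    has_sum gsum M t u * gsum M t v) (rep ` M)"
proof -
  let ?E = "\<lambda>u x. exp (- t * (norm (x + u))\<^sup>2)"
  let ?h = "\<lambda>w p. exp (- (2 * t) * (norm (p + (1/2) *\<^sub>R w))\<^sup>2)"
  have id: "?E u (c + p + r) * ?E v (p - r) = ?h (c + u + v) p * ?h (c + u - v) r" for c p r
  proof -
    have nn: "(norm (c + p + r + u))\<^sup>2 + (norm (p - r + v))\<^sup>2
        = 2 * (norm (p + (1/2) *\<^sub>R (c + u + v)))\<^sup>2 + 2 * (norm (r + (1/2) *\<^sub>R (c + u - v)))\<^sup>2"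
    proof -
      have par: "(norm (a + b))\<^sup>2 + (norm (a - b))\<^sup>2 = 2 * (norm a)\<^sup>2 + 2 * (norm b)\<^sup>2" for a b :: 'a
        by (simp add: power2_norm_eq_inner inner_add inner_diff inner_commute algebra_simps)
      have half: "(1/2) *\<^sub>R x + (1/2) *\<^sub>R x = x" for x :: 'a
        by (simp add: scaleR_left_distrib[symmetric])
      have "c + p + r + u = (p + (1/2) *\<^sub>R (c + u + v)) + (r + (1/2) *\<^sub>R (c + u - v))"
        using half[of c] half[of u] by (simp add: algebra_simps) 
      moreover have "p - r + v = (p + (1/2) *\<^sub>R (c + u + v)) - (r + (1/2) *\<^sub>R (c + u - v))"
        using half[of v] by (simp add: algebra_simps)
      ultimately show ?thesis using par by presburger
    qed
    have "- t * (norm (c + p + r + u))\<^sup>2 + - t * (norm (p - r + v))\<^sup>2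
        = - t * ((norm (c + p + r + u))\<^sup>2 + (norm (p - r + v))\<^sup>2)"
      by (simp only: distrib_left)
    also have "\<dots> = - (2 * t) * (norm (p + (1/2) *\<^sub>R (c + u + v)))\<^sup>2 + - (2 * t) * (norm (r + (1/2) *\<^sub>R (c + u - v)))\<^sup>2"
      unfolding nn by (simp only: distrib_left mult.assoc mult.left_commute mult_minus_left)
    finally have "- t * (norm (c + p + r + u))\<^sup>2 + - t * (norm (p - r + v))\<^sup>2
        = - (2 * t) * (norm (p + (1/2) *\<^sub>R (c + u + v)))\<^sup>2 + - (2 * t) * (norm (r + (1/2) *\<^sub>R (c + u - v)))\<^sup>2" .
    then show ?thesis by (simp only: exp_add[symmetric])
  qed
  have "((\<lambda>(x, y). ?E u x * ?E v y) has_sum gsum M t u * gsum M t v) (M \<times> M)"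
    by (intro has_sum_product_nonneg has_sum_gsum t) auto
  then have "((\<lambda>z. (\<lambda>(x, y). ?E u x * ?E v y) ((\<lambda>(c, p, r). (c + p + r, p - r)) z)) has_sum gsum M t u * gsum M t v)
      (rep ` M \<times> M \<times> M)"
    by (simp only: has_sum_reindex_bij_betw[OF bij_betw_sum_diff])
  then have "((\<lambda>(c, p, r). ?h (c + u + v) p * ?h (c + u - v) r) has_sum gsum M t u * gsum M t v)
      (rep ` M \<times> M \<times> M)"
    by (simp only: case_prod_unfold id fst_conv snd_conv)
  moreover have "((\<lambda>y. (\<lambda>(c, p, r). ?h (c + u + v) p * ?h (c + u - v) r) (c, y))
      has_sum gsum M (2 * t) ((1/2) *\<^sub>R (c + u + v)) * gsum M (2 * t) ((1/2) *\<^sub>R (c + u - v))) (M \<times> M)" for c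
    using has_sum_product_nonneg[OF has_sum_gsum[of "2 * t" "(1/2) *\<^sub>R (c + u + v)"]
        has_sum_gsum[of "2 * t" "(1/2) *\<^sub>R (c + u - v)"]] t
    by (simp add: case_prod_unfold)
  ultimately show ?thesis
    by (rule has_sum_SigmaD)
qed

text \<open>The products for the pairs \<open>(2 u, 0)\<close>, \<open>(0, 0)\<close> and
  \<open>(u, u)\<close> are, class by class, the three terms of a squared difference. In the case of
  equality every square vanishes, and the class of 0 gives the statement at
  \<open>2 * t\<close>.\<close>

lemma gsum_double:
  assumes t: "t > 0"
  shows "2 * (gsum M t u)\<^sup>2 \<le> gsum M t (2 *\<^sub>R u) * gsum M t 0 + (gsum M t 0)\<^sup>2"
    and "2 * (gsum M t u)\<^sup>2 = gsum M t (2 *\<^sub>R u) * gsum M t 0 + (gsum M t 0)\<^sup>2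
      \<Longrightarrow> gsum M (2 * t) u = gsum M (2 * t) 0"
proof -
  define G where "G w = gsum M (2 * t) ((1/2) *\<^sub>R w)" for w
  define D where "D = gsum M t (2 *\<^sub>R u) * gsum M t 0 + gsum M t 0 * gsum M t 0 - 2 * (gsum M t u * gsum M t u)"
  have K: "((\<lambda>c. G (c + u + v) * G (c + u - v)) has_sum gsum M t u * gsum M t v) (rep ` M)" for u v
    unfolding G_def by (rule gsum_product[OF t])
  have "((\<lambda>c. G (c + 2 *\<^sub>R u) * G (c + 2 *\<^sub>R u) + G c * G c + (- 2) * (G (c + 2 *\<^sub>R u) * G c))
      has_sum (gsum M t (2 *\<^sub>R u) * gsum M t 0 + gsum M t 0 * gsum M t 0 + (- 2) * (gsum M t u * gsum M t u))) (rep ` M)"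
    using K[of "2 *\<^sub>R u" 0] K[of 0 0] K[of u u]
    by (intro has_sum_add has_sum_cmult_right) (simp_all add: add.assoc scaleR_2)
  moreover have "G (c + 2 *\<^sub>R u) * G (c + 2 *\<^sub>R u) + G c * G c + (- 2) * (G (c + 2 *\<^sub>R u) * G c)
      = (G (c + 2 *\<^sub>R u) - G c)\<^sup>2" for c
    by (simp add: power2_eq_square algebra_simps)
  ultimately have D: "((\<lambda>c. (G (c + 2 *\<^sub>R u) - G c)\<^sup>2) has_sum D) (rep ` M)"
    by (simp add: D_def)
  have "0 \<le> D" using D by (rule has_sum_nonneg) simp
  then show "2 * (gsum M t u)\<^sup>2 \<le> gsum M t (2 *\<^sub>R u) * gsum M t 0 + (gsum M t 0)\<^sup>2"
    by (simp add: D_def power2_eq_square)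
  assume "2 * (gsum M t u)\<^sup>2 = gsum M t (2 *\<^sub>R u) * gsum M t 0 + (gsum M t 0)\<^sup>2"
  then have "D = 0" by (simp add: D_def power2_eq_square)
  have "rep 0 \<in> rep ` M" using additive_subgroup_0[OF M] by blast
  then have "(G (rep 0 + 2 *\<^sub>R u) - G (rep 0))\<^sup>2 = 0"
    using nonneg_has_sum_le_0D[OF D] \<open>D = 0\<close> by simp
  then have "G (rep 0 + 2 *\<^sub>R u) = G (rep 0)" by simp
  moreover obtain p where p: "p \<in> M" "0 = rep 0 + 2 *\<^sub>R p"
    using rep_props additive_subgroup_0[OF M] by blast
  then have "rep 0 = 2 *\<^sub>R (- p)"
    by (metis add.commute minus_unique scaleR_minus_right)
  then have "G (rep 0 + w) = gsum M (2 * t) ((1/2) *\<^sub>R w + - p)" for w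
    by (simp add: G_def algebra_simps)
  then have "G (rep 0 + w) = G w" for w
    using gsum_periodic[of "- p"] additive_subgroup_minus[OF M p(1)] by (simp add: G_def)
  ultimately have "G (2 *\<^sub>R u) = G 0" by (metis add.right_neutral)
  then show "gsum M (2 * t) u = gsum M (2 * t) 0" by (simp add: G_def)
qed

text \<open>Let \<open>s\<close> be the supremum over the doubling-closed set \<open>U\<close> and
  \<open>g0\<close> the value at 0. Then \<open>gsum_double\<close> gives
  \<open>2 s\<^sup>2 \<le> s g0 + g0\<^sup>2\<close>, that is
  \<open>(s - g0) (2 s + g0) \<le> 0\<close>. The bounded distance from \<open>M\<close> makes
  \<open>s\<close> finite.\<close>

lemma gsum_le:
  assumes t: "t > 0" and U: "\<And>u. u \<in> U \<Longrightarrow> 2 *\<^sub>R u \<in> U"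
    and C: "\<And>u. u \<in> U \<Longrightarrow> \<exists>m\<in>M. norm (u - m) \<le> C" and u: "u \<in> U"
  shows "gsum M t u \<le> gsum M t 0"
proof -
  define g0 where "g0 = gsum M t 0"
  have g0: "g0 \<ge> 1" using gsum_0_ge_1[OF t] by (simp add: g0_def)
  define s where "s = (SUP u\<in>U. gsum M t u)"
  have "gsum M t u \<le> exp (t * C\<^sup>2) * gsum M (t/2) 0" if "u \<in> U" for u
  proof -
    obtain m where m: "m \<in> M" "norm (u - m) \<le> C" using C[OF \<open>u \<in> U\<close>] by blast
    have "gsum M t u = gsum M t (u - m)"
      using gsum_periodic[OF m(1), of t "u - m"] by simp
    also have "\<dots> \<le> exp (t * (norm (u - m))\<^sup>2) * gsum M (t/2) 0"
      using exp_shift_le[OF t] t has_sum_gsum[of "t/2" 0]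
      by (intro has_sum_mono[OF has_sum_gsum[OF t] has_sum_cmult_right]) auto
    also have "\<dots> \<le> exp (t * C\<^sup>2) * gsum M (t/2) 0"
    proof -
      have "(norm (u - m))\<^sup>2 \<le> C\<^sup>2"
        using m(2) by (intro power_mono) auto
      then show ?thesis
        using t gsum_nonneg by (intro mult_right_mono) auto
    qed
    finally show ?thesis .
  qed
  then have "bdd_above (gsum M t ` U)" by (intro bdd_aboveI2)
  then have le_s: "gsum M t u \<le> s" if "u \<in> U" for u
    unfolding s_def using that by (rule cSUP_upper[rotated])
  have "gsum M t v \<le> sqrt ((s * g0 + g0\<^sup>2) / 2)" if "v \<in> U" for v
  proof (rule real_le_rsqrt)
    have "gsum M t (2 *\<^sub>R v) * g0 \<le> s * g0"
      using le_s[OF U[OF that]] g0 by (intro mult_right_mono) auto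
    then show "(gsum M t v)\<^sup>2 \<le> (s * g0 + g0\<^sup>2) / 2"
      using gsum_double(1)[OF t, of v] by (simp add: g0_def)
  qed
  then have "s \<le> sqrt ((s * g0 + g0\<^sup>2) / 2)"
    unfolding s_def using u by (intro cSUP_least) auto
  moreover have "s \<ge> 0" using le_s[OF u] gsum_nonneg[of t u] by linarith
  moreover have "(sqrt ((s * g0 + g0\<^sup>2) / 2))\<^sup>2 = (s * g0 + g0\<^sup>2) / 2"
    using calculation g0 by (intro real_sqrt_pow2) auto
  ultimately have "s\<^sup>2 \<le> (s * g0 + g0\<^sup>2) / 2"
    using power_mono[of s "sqrt ((s * g0 + g0\<^sup>2) / 2)" 2] by simp
  then have "(s - g0) * (2 * s + g0) \<le> 0"
    by (simp add: algebra_simps power2_eq_square)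
  then have "s \<le> g0"
    using g0 \<open>s \<ge> 0\<close> by (simp add: mult_le_0_iff)
  then show ?thesis using le_s[OF u] by (simp add: g0_def)
qed

text \<open>Equality at \<open>t\<close> forces equality at \<open>2 t\<close>, hence at
  \<open>2 ^ k * t\<close> for all \<open>k\<close>. But as the parameter grows the sum at
  \<open>u\<close> tends to 0, while the sum at 0 stays at least 1.\<close>

lemma gsum_less:
  assumes t: "t > 0" and U: "\<And>u. u \<in> U \<Longrightarrow> 2 *\<^sub>R u \<in> U"
    and C: "\<And>u. u \<in> U \<Longrightarrow> \<exists>m\<in>M. norm (u - m) \<le> C" and u: "u \<in> U"
    and \<delta>: "\<delta> > 0" "\<And>x. x \<in> M \<Longrightarrow> \<delta> \<le> norm (x + u)"
  shows "gsum M t u < gsum M t 0"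
proof (rule ccontr)
  note le = gsum_le[OF _ U C]
  assume "\<not> gsum M t u < gsum M t 0"
  then have eq: "gsum M t u = gsum M t 0"
    using le[OF t _ _ u] by fastforce
  have eqk: "gsum M (2 ^ k * t) u = gsum M (2 ^ k * t) 0" for k
  proof (induction k)
    case (Suc k)
    have t': "2 ^ k * t > 0" using t by simp
    have "gsum M (2 ^ k * t) (2 *\<^sub>R u) \<le> gsum M (2 ^ k * t) 0"
      by (rule le[OF t']) (use U u in auto)
    then have "gsum M (2 ^ k * t) (2 *\<^sub>R u) * gsum M (2 ^ k * t) 0 \<le> gsum M (2 ^ k * t) 0 * gsum M (2 ^ k * t) 0"
      using gsum_nonneg by (rule mult_right_mono)
    then have "2 * (gsum M (2 ^ k * t) u)\<^sup>2
        = gsum M (2 ^ k * t) (2 *\<^sub>R u) * gsum M (2 ^ k * t) 0 + (gsum M (2 ^ k * t) 0)\<^sup>2"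
      using gsum_double(1)[OF t', of u] Suc by (simp add: power2_eq_square)
    from gsum_double(2)[OF t' this] show ?case by (simp add: mult.assoc)
  qed (simp add: eq)
  \<comment> \<open>The exponent is split by \<open>2 ^ k * t = (2 ^ k - 1) * t + t\<close>: the
    first part is estimated by the distance \<open>\<delta>\<close>, the second leaves the fixed sum
    at \<open>t\<close>.\<close>
  have "1 \<le> exp (- (2 ^ k - 1) * (t * \<delta>\<^sup>2)) * gsum M t u" for k :: nat
  proof -
    have t': "2 ^ k * t > 0" using t by simp
    have "1 \<le> gsum M (2 ^ k * t) u" using gsum_0_ge_1[OF t'] eqk by simp
    also have "gsum M (2 ^ k * t) u \<le> exp (- (2 ^ k - 1) * (t * \<delta>\<^sup>2)) * gsum M t u"
    proof (rule has_sum_mono[OF has_sum_gsum[OF t'] has_sum_cmult_right[OF has_sum_gsum[OF t]]])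
      fix x assume "x \<in> M"
      then have "\<delta>\<^sup>2 \<le> (norm (x + u))\<^sup>2"
        using \<delta> by (intro power_mono) auto
      then have "(2 ^ k - 1) * t * \<delta>\<^sup>2 \<le> (2 ^ k - 1) * t * (norm (x + u))\<^sup>2"
        using t by (intro mult_left_mono) auto
      then have "- (2 ^ k * t) * (norm (x + u))\<^sup>2 \<le> - (2 ^ k - 1) * (t * \<delta>\<^sup>2) + - t * (norm (x + u))\<^sup>2"
        by (simp add: algebra_simps)
      then show "exp (- (2 ^ k * t) * (norm (x + u))\<^sup>2)
          \<le> exp (- (2 ^ k - 1) * (t * \<delta>\<^sup>2)) * exp (- t * (norm (x + u))\<^sup>2)"
        by (simp only: exp_add[symmetric] exp_le_cancel_iff)
    qed
    finally show ?thesis .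
  qed
  moreover have "(\<lambda>k. exp (- (2 ^ k - 1) * (t * \<delta>\<^sup>2)) * gsum M t u) \<longlonglongrightarrow> 0 * gsum M t u"
  proof (intro tendsto_mult tendsto_const filterlim_compose[OF exp_at_bot])
    have "filterlim (\<lambda>k. (2 ^ k - 1 :: real)) at_top sequentially"
    proof (rule filterlim_at_top_mono[OF filterlim_real_sequentially], intro always_eventually allI)
      fix k :: nat
      have "real (Suc k) \<le> real (2 ^ k)"
        using less_exp[of k] by (simp only: of_nat_le_iff Suc_le_eq)
      then show "real k \<le> 2 ^ k - 1" by simp
    qed
    then have "filterlim (\<lambda>k. (2 ^ k - 1) * (t * \<delta>\<^sup>2)) at_top sequentially"
      using t \<delta>(1) by (intro filterlim_at_top_mult_tendsto_pos[where c = "t * \<delta>\<^sup>2"]) auto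
    then show "filterlim (\<lambda>k. - (2 ^ k - 1) * (t * \<delta>\<^sup>2)) at_bot sequentially"
      by (simp only: filterlim_uminus_at_bot mult_minus_left minus_minus)
  qed
  ultimately have "1 \<le> 0 * gsum M t u"
    by (intro LIMSEQ_le_const) auto
  then show False by simp
qed

end

section \<open>Power sums over shifted lattices\<close>

text \<open>Monotone convergence along an enumeration of \<open>M\<close>; indices outside the
  enumeration carry the value 0, so finite sets are included.\<close>

lemma nn_integral_infsum:
  fixes K :: "'a \<Rightarrow> real \<Rightarrow> real"
  assumes M: "countable M" and meas: "\<And>x. x \<in> M \<Longrightarrow> K x \<in> borel_measurable borel"
    and nonneg: "\<And>x t. 0 \<le> K x t" and summ: "\<And>t. (\<lambda>x. K x t) summable_on M"
    and int: "\<And>x. x \<in> M \<Longrightarrow> (\<integral>\<^sup>+t. ennreal (K x t) \<partial>lborel) = ennreal (F x)"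
    and F: "\<And>x. 0 \<le> F x" "F summable_on M"
  shows "(\<lambda>t. \<Sum>\<^sub>\<infinity>x\<in>M. K x t) \<in> borel_measurable borel" (is "?m")
    and "(\<integral>\<^sup>+t. ennreal (\<Sum>\<^sub>\<infinity>x\<in>M. K x t) \<partial>lborel) = ennreal (\<Sum>\<^sub>\<infinity>x\<in>M. F x)" (is "?i")
proof -
  define I where "I = to_nat_on M ` M"
  have sums: "(\<lambda>k. if k \<in> I then f (from_nat_into M k) else 0) sums (\<Sum>\<^sub>\<infinity>x\<in>M. f x)"
    if "f summable_on M" for f :: "'a \<Rightarrow> real"
  proof -
    have "((f \<circ> from_nat_into M) has_sum (\<Sum>\<^sub>\<infinity>x\<in>M. f x)) I"
      unfolding I_def
    proof (subst has_sum_reindex)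
      show "inj_on (to_nat_on M) M" by (rule inj_on_to_nat_on[OF M])
      have "(f has_sum (\<Sum>\<^sub>\<infinity>x\<in>M. f x)) M" using that by (rule has_sum_infsum)
      then show "((f \<circ> from_nat_into M) \<circ> to_nat_on M has_sum (\<Sum>\<^sub>\<infinity>x\<in>M. f x)) M"
        by (rule has_sum_cong[THEN iffD1, rotated]) (simp add: from_nat_into_to_nat_on[OF M])
    qed
    then have "((\<lambda>k. if k \<in> I then f (from_nat_into M k) else 0) has_sum (\<Sum>\<^sub>\<infinity>x\<in>M. f x)) UNIV"
      by (rule has_sum_cong_neutral[THEN iffD1, rotated -1]) auto
    then show ?thesis by (rule has_sum_imp_sums)
  qed
  have fnm: "from_nat_into M k \<in> M" if "k \<in> I" for k
    using that M by (auto simp: I_def from_nat_into_to_nat_on)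
  define a where "a k t = (if k \<in> I then K (from_nat_into M k) t else 0)" for k t
  have a: "(\<lambda>k. a k t) sums (\<Sum>\<^sub>\<infinity>x\<in>M. K x t)" for t
    using sums[OF summ[of t]] by (simp add: a_def)
  have [measurable]: "a k \<in> borel_measurable borel" for k
    unfolding a_def using meas[OF fnm] by (cases "k \<in> I") auto
  have eq: "(\<Sum>\<^sub>\<infinity>x\<in>M. K x t) = (\<Sum>k. a k t)" for t
    using a[of t] by (rule sums_unique)
  show ?m unfolding eq by measurable
  have "(\<integral>\<^sup>+t. ennreal (\<Sum>\<^sub>\<infinity>x\<in>M. K x t) \<partial>lborel) = (\<integral>\<^sup>+t. (\<Sum>k. ennreal (a k t)) \<partial>lborel)"
    unfolding eq using sums_summable[OF a] nonneg
    by (intro nn_integral_cong suminf_ennreal2[symmetric]) (auto simp: a_def)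
  also have "\<dots> = (\<Sum>k. \<integral>\<^sup>+t. ennreal (a k t) \<partial>lborel)"
    by (rule nn_integral_suminf) simp
  also have "\<dots> = (\<Sum>k. ennreal (if k \<in> I then F (from_nat_into M k) else 0))"
    by (intro suminf_cong) (use int fnm in \<open>auto simp: a_def\<close>)
  also have "\<dots> = ennreal (\<Sum>k. if k \<in> I then F (from_nat_into M k) else 0)"
    using sums_summable[OF sums[OF F(2)]] F(1) by (intro suminf_ennreal2) auto
  also have "(\<Sum>k. if k \<in> I then F (from_nat_into M k) else 0) = (\<Sum>\<^sub>\<infinity>x\<in>M. F x)"
    using sums[OF F(2)] by (rule sums_unique[symmetric])
  finally show ?i .
qed

text \<open>The Gamma integral with its variable scaled by \<open>b\<close>: a negative power of
  \<open>b\<close> becomes a mixture of exponentials in \<open>b\<close>.\<close>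

lemma nn_integral_Gamma_kernel:
  fixes p b :: real
  assumes p: "p > 0" and b: "b > 0"
  shows "(\<integral>\<^sup>+t. ennreal (indicator {0..} t * t powr (p - 1) * exp (- b * t)) \<partial>lborel)
    = ennreal (Gamma p * b powr (- p))"
proof -
  let ?f = "\<lambda>t. ennreal (indicator {0..} t * t powr (p - 1) / exp t)"
  let ?g = "\<lambda>t. ennreal (indicator {0..} t * t powr (p - 1) * exp (- b * t))"
  have "ennreal (Gamma p) = (\<integral>\<^sup>+t. ?f t \<partial>lborel)"
    by (rule Gamma_conv_nn_integral_real[OF p])
  also have "\<dots> = ennreal \<bar>b\<bar> * (\<integral>\<^sup>+t. ?f (0 + b * t) \<partial>lborel)"
    using b by (intro nn_integral_real_affine) auto
  also have "(\<integral>\<^sup>+t. ?f (0 + b * t) \<partial>lborel) = (\<integral>\<^sup>+t. ennreal (b powr (p - 1)) * ?g t \<partial>lborel)"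
  proof (rule nn_integral_cong)
    fix t :: real
    show "?f (0 + b * t) = ennreal (b powr (p - 1)) * ?g t"
      using b by (cases "t \<ge> 0")
        (auto simp: indicator_def ennreal_mult[symmetric] powr_mult exp_minus field_simps zero_le_mult_iff)
  qed
  also have "\<dots> = ennreal (b powr (p - 1)) * (\<integral>\<^sup>+t. ?g t \<partial>lborel)"
    by (rule nn_integral_cmult) simp
  finally have "ennreal (Gamma p) = ennreal (b powr p) * (\<integral>\<^sup>+t. ?g t \<partial>lborel)"
    using b by (simp add: mult.assoc[symmetric] ennreal_mult[symmetric] powr_diff)
  then have "ennreal (b powr (- p)) * ennreal (Gamma p)
      = ennreal (b powr (- p)) * ennreal (b powr p) * (\<integral>\<^sup>+t. ?g t \<partial>lborel)"
    by (simp add: mult.assoc)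
  also have "ennreal (b powr (- p)) * ennreal (b powr p) = 1"
    using b by (simp add: ennreal_mult[symmetric] powr_add[symmetric])
  finally show ?thesis
    using p by (simp add: ennreal_mult[symmetric] mult.commute Gamma_real_pos less_imp_le)
qed

text \<open>Translation by \<open>u\<close> costs a factor independent of \<open>x\<close>, which
  carries summability from \<open>M\<close> to its translates.\<close>

lemma powr_shift_le:
  fixes x u :: "'a::real_inner"
  assumes "R > 0" "p > 0"
  shows "(R + (norm (x + u))\<^sup>2) powr (- p)
    \<le> (2 + 2 * (norm u)\<^sup>2 / R) powr p * (R + (norm x)\<^sup>2) powr (- p)"
proof -
  define c where "c = 2 + 2 * (norm u)\<^sup>2 / R"
  have c: "c \<ge> 2" using assms by (simp add: c_def)
  have "R + (norm x)\<^sup>2 \<le> R + 2 * (norm (x + u))\<^sup>2 + 2 * (norm u)\<^sup>2"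
    using norm_sq_shift_le[of x u] by simp
  also have "\<dots> \<le> 2 * R + 2 * (norm (x + u))\<^sup>2 + 2 * (norm u)\<^sup>2 / R * (R + (norm (x + u))\<^sup>2)"
    using assms by (simp add: distrib_left)
  also have "\<dots> = c * (R + (norm (x + u))\<^sup>2)"
    by (simp add: c_def algebra_simps)
  finally have "(c * (R + (norm (x + u))\<^sup>2)) powr (- p) \<le> (R + (norm x)\<^sup>2) powr (- p)"
    using assms by (intro powr_mono2') (auto intro: add_pos_nonneg)
  then have "c powr p * (c * (R + (norm (x + u))\<^sup>2)) powr (- p) \<le> c powr p * (R + (norm x)\<^sup>2) powr (- p)"
    by (intro mult_left_mono) auto
  moreover have "c powr p * (c * y) powr (- p) = y powr (- p)" if "y > 0" for y
    using c that by (simp add: powr_mult powr_minus field_simps)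
  then have "c powr p * (c * (R + (norm (x + u))\<^sup>2)) powr (- p) = (R + (norm (x + u))\<^sup>2) powr (- p)"
    using assms(1) by (simp add: add_pos_nonneg)
  ultimately show ?thesis by (simp add: c_def)
qed

lemma exp_le_powr:
  fixes y t p :: real
  assumes "y > 0" "t > 0" "p > 0"
  shows "exp (- t * y) \<le> (p / t) powr p * y powr (- p)"
proof -
  have "t * y / p \<le> exp (t * y / p)"
    using exp_ge_add_one_self[of "t * y / p"] by linarith
  then have "(t * y / p) powr p \<le> exp (t * y / p) powr p"
    using assms by (intro powr_mono2) auto
  also have "exp (t * y / p) powr p = exp (t * y)"
    using assms by (simp add: exp_powr_real)
  finally have "(t * y / p) powr p \<le> exp (t * y)" .
  then have "exp (- t * y) \<le> inverse ((t * y / p) powr p)"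
    using assms by (simp add: exp_minus le_imp_inverse_le)
  also have "\<dots> = (p / t) powr p * y powr (- p)"
    using assms by (simp add: powr_mult powr_divide powr_minus field_simps)
  finally show ?thesis .
qed

text \<open>\<open>U\<close> is a set of shifts closed under doubling and within distance
  \<open>C\<close> of \<open>M\<close>, as \<open>gsum_le\<close> requires; it becomes the real span
  of a lattice.\<close>

locale power_group =
  fixes M :: "'a::real_inner set" and p R :: real and U C
  assumes M: "additive_subgroup M" and p: "p > 0" and R: "R > 0"
    and power_summable: "(\<lambda>x. (R + (norm x)\<^sup>2) powr (- p)) summable_on M"
    and U: "\<And>u. u \<in> U \<Longrightarrow> 2 *\<^sub>R u \<in> U"
    and C: "\<And>u. u \<in> U \<Longrightarrow> \<exists>m\<in>M. norm (u - m) \<le> C"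
begin

lemma R_pos: "R + (norm (x::'a))\<^sup>2 > 0"
  using R by (intro add_pos_nonneg) auto

sublocale gaussian_group M
proof
  fix t :: real assume t: "t > 0"
  show "(\<lambda>x. exp (- t * (norm x)\<^sup>2)) summable_on M"
  proof (rule summable_on_comparison_test)
    show "(\<lambda>x. (exp (t * R) * (p / t) powr p) * (R + (norm x)\<^sup>2) powr (- p)) summable_on M"
      by (rule summable_on_cmult_right[OF power_summable])
    fix x assume "x \<in> M"
    have "exp (- t * (norm x)\<^sup>2) = exp (t * R) * exp (- t * (R + (norm x)\<^sup>2))"
      by (simp add: exp_add[symmetric] algebra_simps)
    also have "\<dots> \<le> exp (t * R) * ((p / t) powr p * (R + (norm x)\<^sup>2) powr (- p))"
      using exp_le_powr[OF R_pos t p] by (intro mult_left_mono) auto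
    finally show "exp (- t * (norm x)\<^sup>2) \<le> (exp (t * R) * (p / t) powr p) * (R + (norm x)\<^sup>2) powr (- p)"
      by (simp add: mult.assoc)
  qed simp
qed (rule M)

lemma power_summable_shift: "(\<lambda>x. (R + (norm (x + u))\<^sup>2) powr (- p)) summable_on M"
  using powr_shift_le[OF R p, of _ u]
  by (intro summable_on_comparison_test[OF summable_on_cmult_right[OF power_summable]]) auto

definition psum :: "'a \<Rightarrow> real" where
  "psum u = (\<Sum>\<^sub>\<infinity>x\<in>M. (R + (norm (x + u))\<^sup>2) powr (- p))"

text \<open>The density, up to the factor \<open>Gamma p\<close>, of the mixture of Gaussian sums
  that represents \<open>psum\<close>.\<close>

definition weight :: "real \<Rightarrow> real" where
  "weight t = indicator {0..} t * t powr (p - 1) * exp (- R * t)"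

lemma weight_nonneg: "weight t \<ge> 0"
  by (simp add: weight_def)

lemma psum_integral:
  shows "(\<lambda>t. weight t * gsum M t u) \<in> borel_measurable borel"
    and "(\<integral>\<^sup>+t. ennreal (weight t * gsum M t u) \<partial>lborel) = ennreal (Gamma p * psum u)"
proof -
  define K where "K x t = indicator {0..} t * t powr (p - 1) * exp (- (R + (norm (x + u))\<^sup>2) * t)" for x t
  have K: "K x t = weight t * exp (- t * (norm (x + u))\<^sup>2)" for x t
  proof -
    have "exp (- (R + (norm (x + u))\<^sup>2) * t) = exp (- R * t) * exp (- t * (norm (x + u))\<^sup>2)"
      by (simp add: exp_add[symmetric] algebra_simps)
    then show ?thesis by (simp add: K_def weight_def)
  qed
  have Ksum: "(\<Sum>\<^sub>\<infinity>x\<in>M. K x t) = weight t * gsum M t u" for t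
    unfolding K gsum_def by (rule infsum_cmult_right')
  have "countable M"
    using summable_countable_real[OF power_summable] R_pos by (simp add: less_imp_neq[symmetric])
  moreover have "K x \<in> borel_measurable borel" for x
    unfolding K_def by measurable
  moreover have "0 \<le> K x t" for x t
    by (simp add: K_def)
  \<comment> \<open>At \<open>t = 0\<close> the Gaussian sum may diverge, but there the kernel
    vanishes because \<open>0 powr _ = 0\<close>.\<close>
  moreover have "(\<lambda>x. K x t) summable_on M" for t
  proof (cases "t > 0")
    case True
    then show ?thesis unfolding K by (intro summable_on_cmult_right summable_shift)
  next
    case False
    then have "K x t = 0" for x by (cases "t = 0") (auto simp: K_def)
    then show ?thesis by simp
  qed
  moreover have "(\<integral>\<^sup>+t. ennreal (K x t) \<partial>lborel) = ennreal (Gamma p * (R + (norm (x + u))\<^sup>2) powr (- p))" for x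
    unfolding K_def by (rule nn_integral_Gamma_kernel[OF p R_pos])
  moreover have "0 \<le> Gamma p * (R + (norm (x + u))\<^sup>2) powr (- p)" for x
    using Gamma_real_pos[OF p] by simp
  moreover have "(\<lambda>x. Gamma p * (R + (norm (x + u))\<^sup>2) powr (- p)) summable_on M"
    by (intro summable_on_cmult_right power_summable_shift)
  moreover have "(\<Sum>\<^sub>\<infinity>x\<in>M. Gamma p * (R + (norm (x + u))\<^sup>2) powr (- p)) = Gamma p * psum u"
    unfolding psum_def by (rule infsum_cmult_right')
  ultimately show "(\<lambda>t. weight t * gsum M t u) \<in> borel_measurable borel"
    and "(\<integral>\<^sup>+t. ennreal (weight t * gsum M t u) \<partial>lborel) = ennreal (Gamma p * psum u)"
    using nn_integral_infsum[of M K "\<lambda>x. Gamma p * (R + (norm (x + u))\<^sup>2) powr (- p)"]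
    unfolding Ksum by auto
qed

lemma weight_gsum_le:
  assumes "u \<in> U" shows "weight t * gsum M t u \<le> weight t * gsum M t 0"
proof (cases "t > 0")
  case True
  then show ?thesis
    using gsum_le[OF True, of U C u] U C assms weight_nonneg by (intro mult_left_mono) auto
next
  case False
  then have "weight t = 0" by (cases "t = 0") (auto simp: weight_def)
  then show ?thesis by simp
qed

lemma psum_nonneg: "psum u \<ge> 0"
  unfolding psum_def by (rule infsum_nonneg) simp

lemma psum_le: "u \<in> U \<Longrightarrow> psum u \<le> psum 0"
proof -
  assume u: "u \<in> U"
  have "ennreal (Gamma p * psum u) \<le> ennreal (Gamma p * psum 0)"
    unfolding psum_integral(2)[symmetric] using weight_gsum_le[OF u]
    by (intro nn_integral_mono ennreal_leI)
  then show ?thesis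
    using Gamma_real_pos[OF p] psum_nonneg by (simp add: ennreal_le_iff)
qed

text \<open>With equal integrals the pointwise inequality would be an equality almost everywhere,
  against the strict inequality of the Gaussian sums at every \<open>t\<close> of the unit
  interval.\<close>

lemma psum_less:
  assumes u: "u \<in> U" and \<delta>: "\<delta> > 0" "\<And>x. x \<in> M \<Longrightarrow> \<delta> \<le> norm (x + u)"
  shows "psum u < psum 0"
proof (rule ccontr)
  assume "\<not> psum u < psum 0"
  then have eq: "psum u = psum 0" using psum_le[OF u] by simp
  let ?f = "\<lambda>t. weight t * gsum M t u" and ?g = "\<lambda>t. weight t * gsum M t 0"
  note [measurable] = psum_integral(1)
  have "(\<integral>\<^sup>+t. ennreal (?g t) - ennreal (?f t) \<partial>lborel)
      = (\<integral>\<^sup>+t. ennreal (?g t) \<partial>lborel) - (\<integral>\<^sup>+t. ennreal (?f t) \<partial>lborel)"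
    using weight_gsum_le[OF u] by (intro nn_integral_diff) (auto simp: psum_integral(2) intro!: ennreal_leI)
  also have "\<dots> = 0" by (simp add: psum_integral(2) eq)
  finally have "AE t in lborel. ennreal (?g t) - ennreal (?f t) = 0"
    by (subst (asm) nn_integral_0_iff_AE) auto
  then have "AE t in lborel. t \<notin> {0<..<1::real}"
  proof eventually_elim
    case (elim t)
    show ?case
    proof
      assume t: "t \<in> {0<..<1::real}"
      then have "weight t > 0" by (simp add: weight_def)
      moreover have "gsum M t u < gsum M t 0"
        using gsum_less[of t U C u \<delta>] t U C u \<delta> by auto
      ultimately have "?f t < ?g t" by simp
      moreover have "0 \<le> ?f t" using weight_nonneg gsum_nonneg by simp
      ultimately have "ennreal (?g t) - ennreal (?f t) > 0"
        by (simp add: ennreal_minus)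
      then show False using elim by simp
    qed
  qed
  then have "{0<..<1::real} \<in> null_sets lborel"
    using AE_iff_null_sets[of "{0<..<1::real}" lborel] by simp
  then have "emeasure lborel {0<..<1::real} = 0"
    by (rule null_setsD1)
  moreover have "emeasure lborel {0<..<1::real} = ennreal (1 - 0)"
    by (rule emeasure_lborel_Ioo) simp
  ultimately have "ennreal (1 - 0) = 0" by metis
  then show False by simp
qed

end

section \<open>Second differences of power sums\<close>

lemma has_sum_difference:
  fixes f g :: "'a \<Rightarrow> real"
  shows "(f has_sum a) A \<Longrightarrow> (g has_sum b) A \<Longrightarrow> ((\<lambda>x. f x - g x) has_sum a - b) A"
  using has_sum_add[of f A a "\<lambda>x. - g x" "- b"] by (simp add: has_sum_uminus)

lemma has_sum_finite_sum:
  fixes f :: "'i \<Rightarrow> 'a \<Rightarrow> real"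
  shows "finite I \<Longrightarrow> (\<And>i. i \<in> I \<Longrightarrow> (f i has_sum s i) A) \<Longrightarrow> ((\<lambda>x. \<Sum>i\<in>I. f i x) has_sum (\<Sum>i\<in>I. s i)) A"
  by (induction I rule: finite_induct) (auto intro!: has_sum_add)

text \<open>Taylor's formula with remainder of order four: the fourth derivative is positive, so the
  cubic polynomial lies below the power on both sides of 0. A lower bound is what a comparison with
  a maximum calls for.\<close>

lemma powr_cubic_bound:
  fixes p w :: real
  assumes p: "p > 0" and w: "w > - 1"
  shows "1 - p * w + p * (p + 1) / 2 * w\<^sup>2 - p * (p + 1) * (p + 2) / 6 * w ^ 3 \<le> (1 + w) powr (- p)"
proof (cases "w = 0")
  case False
  \<comment> \<open>\<open>D m\<close> is the \<open>m\<close>-th derivative of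
    \<open>(1 + t) powr (- p)\<close>.\<close>
  define D where "D m t = (-1) ^ m * pochhammer p m * (1 + t) powr (- p - real m)" for m t
  have "\<exists>t. (if w < 0 then w < t \<and> t < 0 else 0 < t \<and> t < w) \<and>
      (1 + w) powr (- p) = (\<Sum>m<4. D m 0 / fact m * (w - 0) ^ m) + D 4 t / fact 4 * (w - 0) ^ 4"
  proof (rule Taylor[of 4 D "\<lambda>t. (1 + t) powr (- p)" "min 0 w" "max 0 w"])
    show "D 0 = (\<lambda>t. (1 + t) powr (- p))" by (rule ext) (simp add: D_def)
    show "\<forall>(m::nat) t. m < 4 \<and> min 0 w \<le> t \<and> t \<le> max 0 w \<longrightarrow> (D m has_real_derivative D (Suc m) t) (at t)"
    proof (intro allI impI)
      fix m :: nat and t :: real assume "m < 4 \<and> min 0 w \<le> t \<and> t \<le> max 0 w"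
      then have "1 + t > 0" using w by (auto simp: min_def split: if_splits)
      then show "(D m has_real_derivative D (Suc m) t) (at t)"
      proof -
        have "((\<lambda>t. (1 + t) powr a) has_real_derivative a * (1 + t) powr (a - 1)) (at t)" for a
          using \<open>1 + t > 0\<close> by (auto intro!: derivative_eq_intros)
        then have "((\<lambda>t. (-1) ^ m * pochhammer p m * (1 + t) powr (- p - real m)) has_real_derivative
            (-1) ^ m * pochhammer p m * ((- p - real m) * (1 + t) powr (- p - real m - 1))) (at t)"
          by (rule DERIV_cmult)
        moreover have "- p - real (Suc m) = - p - real m - 1" by simp
        then have "D (Suc m) t = (-1) ^ m * pochhammer p m * ((- p - real m) * (1 + t) powr (- p - real m - 1))"
          unfolding D_def by (simp only: pochhammer_Suc power_Suc) (simp add: algebra_simps)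
        ultimately show ?thesis unfolding D_def by simp
      qed
    qed
  qed (use False in auto)
  then obtain t where t': "if w < 0 then w < t \<and> t < 0 else 0 < t \<and> t < w"
    "(1 + w) powr (- p) = (\<Sum>m<4. D m 0 / fact m * (w - 0) ^ m) + D 4 t / fact 4 * (w - 0) ^ 4"
    by blast
  from t'(2) have eq: "(1 + w) powr (- p) = (\<Sum>m<4. D m 0 / fact m * w ^ m) + D 4 t / fact 4 * w ^ 4"
    by (simp only: diff_zero)
  have "D 4 t \<ge> 0"
    using p by (simp add: D_def pochhammer_nonneg)
  then have "D 4 t / fact 4 * w ^ 4 \<ge> 0" by simp
  moreover have "(\<Sum>m<4. D m 0 / fact m * w ^ m)
      = 1 - p * w + p * (p + 1) / 2 * w\<^sup>2 - p * (p + 1) * (p + 2) / 6 * w ^ 3"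
    by (simp add: D_def eval_nat_numeral pochhammer_Suc field_simps)
  ultimately show ?thesis using eq by linarith
qed simp

text \<open>The two bases are \<open>X * (1 + b + a)\<close> and \<open>X * (1 + b - a)\<close> with
  \<open>a\<close> of order \<epsilon> and \<open>b\<close> of order
  \<open>\<epsilon>\<^sup>2\<close>. Adding the two cubic bounds cancels the odd powers of
  \<open>a\<close>; what remains beyond second order is nonnegative or of fourth order.\<close>

lemma powr_second_difference:
  fixes X p c g \<kappa> \<epsilon> :: real
  assumes X: "X > 0" and p: "p > 0" and g: "0 \<le> g" "g \<le> \<kappa> * X" and c: "\<bar>c\<bar> \<le> \<kappa> * X"
    and \<epsilon>: "0 < \<epsilon>" "\<epsilon> \<le> 1"
    and pos: "X + 2 * \<epsilon> * c + \<epsilon>\<^sup>2 * g > 0" "X - 2 * \<epsilon> * c + \<epsilon>\<^sup>2 * g > 0"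
  shows "2 * X powr (- p)
      + \<epsilon>\<^sup>2 * (X powr (- p) * (4 * p * (p + 1) * c\<^sup>2 / X\<^sup>2 - 2 * p * g / X)
        - \<epsilon>\<^sup>2 * (5 * p * (p + 1) * (p + 2) * \<kappa> ^ 3 * X powr (- p)))
    \<le> (X + 2 * \<epsilon> * c + \<epsilon>\<^sup>2 * g) powr (- p) + (X - 2 * \<epsilon> * c + \<epsilon>\<^sup>2 * g) powr (- p)"
proof -
  define a b where "a = 2 * \<epsilon> * c / X" and "b = \<epsilon>\<^sup>2 * g / X"
  define P where "P = p * (p + 1) * (p + 2) / 6"
  have P: "P \<ge> 0" using p by (simp add: P_def)
  have fac: "X + 2 * \<epsilon> * c + \<epsilon>\<^sup>2 * g = X * (1 + (b + a))" "X - 2 * \<epsilon> * c + \<epsilon>\<^sup>2 * g = X * (1 + (b - a))"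
    using X by (simp_all add: a_def b_def field_simps)
  have pos': "b + a > - 1" "b - a > - 1"
    using pos X unfolding fac by (simp_all add: zero_less_mult_iff)
  have \<kappa>: "\<kappa> \<ge> 0" using g X by (metis mult_nonneg_nonneg mult_le_0_iff not_le order_trans zero_le_mult_iff)
  have b: "0 \<le> b" "b \<le> \<epsilon>\<^sup>2 * \<kappa>"
    using g X \<epsilon> by (simp_all add: b_def field_simps mult_left_mono)
  have a2: "a\<^sup>2 \<le> 4 * \<epsilon>\<^sup>2 * \<kappa>\<^sup>2"
  proof -
    have "\<bar>a\<bar> \<le> 2 * \<epsilon> * \<kappa>"
      using c X \<epsilon> by (simp add: a_def abs_mult field_simps)
    then have "\<bar>a\<bar>\<^sup>2 \<le> (2 * \<epsilon> * \<kappa>)\<^sup>2" by (intro power_mono) auto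
    then show ?thesis by (simp add: power_mult_distrib)
  qed
  have e4: "\<epsilon>\<^sup>2 \<le> 1" using \<epsilon> by (simp add: power_le_one)
  \<comment> \<open>The sum of \<open>(b + a) ^ 3\<close> and \<open>(b - a) ^ 3\<close> leaves this
    term. The estimates give 26, rounded up to 30 so that the 6 in \<open>P\<close> produces the
    constant 5.\<close>
  have cub: "2 * b ^ 3 + 6 * (b * a\<^sup>2) \<le> 30 * (\<epsilon>\<^sup>2 * \<epsilon>\<^sup>2 * \<kappa> ^ 3)"
  proof -
    have "b * a\<^sup>2 \<le> (\<epsilon>\<^sup>2 * \<kappa>) * (4 * \<epsilon>\<^sup>2 * \<kappa>\<^sup>2)"
      using a2 b \<kappa> by (intro mult_mono) auto
    moreover have "b ^ 3 \<le> (\<epsilon>\<^sup>2 * \<kappa>) ^ 3"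
      using b by (intro power_mono) auto
    moreover have "(\<epsilon>\<^sup>2 * \<kappa>) ^ 3 = \<epsilon>\<^sup>2 * (\<epsilon>\<^sup>2 * \<epsilon>\<^sup>2 * \<kappa> ^ 3)"
      by (simp add: power3_eq_cube)
    moreover have "\<epsilon>\<^sup>2 * (\<epsilon>\<^sup>2 * \<epsilon>\<^sup>2 * \<kappa> ^ 3) \<le> 1 * (\<epsilon>\<^sup>2 * \<epsilon>\<^sup>2 * \<kappa> ^ 3)"
      using e4 \<kappa> by (intro mult_right_mono) auto
    moreover have "(\<epsilon>\<^sup>2 * \<kappa>) * (4 * \<epsilon>\<^sup>2 * \<kappa>\<^sup>2) = 4 * (\<epsilon>\<^sup>2 * \<epsilon>\<^sup>2 * \<kappa> ^ 3)"
      by (simp add: power3_eq_cube power2_eq_square)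
    moreover have "0 \<le> \<epsilon>\<^sup>2 * \<epsilon>\<^sup>2 * \<kappa> ^ 3" using \<kappa> by simp
    ultimately show ?thesis by linarith
  qed
  define Q where "Q = p * (p + 1) / 2"
  have Q: "p * (p + 1) = 2 * Q" "Q \<ge> 0" using p by (simp_all add: Q_def)
  have "2 + (- 2 * p * b + p * (p + 1) * a\<^sup>2) - P * (2 * b ^ 3 + 6 * (b * a\<^sup>2))
      \<le> 2 + (- 2 * p * b + 2 * Q * a\<^sup>2) + 2 * Q * b\<^sup>2 - P * (2 * b ^ 3 + 6 * (b * a\<^sup>2))"
    using Q by simp
  also have "\<dots> = (1 - p * (b + a) + Q * (b + a)\<^sup>2 - P * (b + a) ^ 3)
      + (1 - p * (b - a) + Q * (b - a)\<^sup>2 - P * (b - a) ^ 3)"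
    by (simp add: power2_eq_square power3_eq_cube algebra_simps)
  also have "\<dots> \<le> (1 + (b + a)) powr (- p) + (1 + (b - a)) powr (- p)"
    unfolding P_def Q_def by (intro add_mono powr_cubic_bound p pos')
  finally have "2 + (- 2 * p * b + p * (p + 1) * a\<^sup>2) - P * (30 * (\<epsilon>\<^sup>2 * \<epsilon>\<^sup>2 * \<kappa> ^ 3))
      \<le> (1 + (b + a)) powr (- p) + (1 + (b - a)) powr (- p)"
    using mult_left_mono[OF cub P] by linarith
  then have "X powr (- p) * (2 + (- 2 * p * b + p * (p + 1) * a\<^sup>2) - P * (30 * (\<epsilon>\<^sup>2 * \<epsilon>\<^sup>2 * \<kappa> ^ 3)))
      \<le> X powr (- p) * ((1 + (b + a)) powr (- p) + (1 + (b - a)) powr (- p))"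
    by (intro mult_left_mono) auto
  also have "\<dots> = (X * (1 + (b + a))) powr (- p) + (X * (1 + (b - a))) powr (- p)"
  proof -
    have e: "(X * y) powr (- p) = X powr (- p) * y powr (- p)" if "y > 0" for y
      using X that by (simp add: powr_mult)
    have "1 + (b + a) > 0" "1 + (b - a) > 0" using pos' by auto
    then show ?thesis by (simp only: e distrib_left[of "X powr (- p)"])
  qed
  finally have main: "X powr (- p) * (2 + (- 2 * p * b + p * (p + 1) * a\<^sup>2) - P * (30 * (\<epsilon>\<^sup>2 * \<epsilon>\<^sup>2 * \<kappa> ^ 3)))
      \<le> (X + 2 * \<epsilon> * c + \<epsilon>\<^sup>2 * g) powr (- p) + (X - 2 * \<epsilon> * c + \<epsilon>\<^sup>2 * g) powr (- p)"
    unfolding fac .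
  have "- 2 * p * b + p * (p + 1) * a\<^sup>2 = \<epsilon>\<^sup>2 * (4 * p * (p + 1) * c\<^sup>2 / X\<^sup>2 - 2 * p * g / X)"
    by (simp add: a_def b_def power_mult_distrib power_divide right_diff_distrib mult_ac)
  moreover have "P * (30 * (\<epsilon>\<^sup>2 * \<epsilon>\<^sup>2 * \<kappa> ^ 3)) = \<epsilon>\<^sup>2 * (\<epsilon>\<^sup>2 * (5 * p * (p + 1) * (p + 2) * \<kappa> ^ 3))"
    by (simp add: P_def)
  ultimately have "X powr (- p) * (2 + (- 2 * p * b + p * (p + 1) * a\<^sup>2) - P * (30 * (\<epsilon>\<^sup>2 * \<epsilon>\<^sup>2 * \<kappa> ^ 3)))
      = 2 * X powr (- p)
      + \<epsilon>\<^sup>2 * (X powr (- p) * (4 * p * (p + 1) * c\<^sup>2 / X\<^sup>2 - 2 * p * g / X)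
        - \<epsilon>\<^sup>2 * (5 * p * (p + 1) * (p + 2) * \<kappa> ^ 3 * X powr (- p)))"
    by (simp only: distrib_left right_diff_distrib mult_ac)
  then show ?thesis using main by simp
qed

text \<open>The summands of the conclusion are the second derivatives of \<open>(X + 2 \<epsilon> c + \<epsilon>\<^sup>2 g) powr (- p)\<close>
  at \<open>\<epsilon> = 0\<close>.\<close>
lemma second_variation_le_0:
  fixes X c g :: "'i \<Rightarrow> real"
  assumes p: "p > 0" and X: "\<And>i. i \<in> A \<Longrightarrow> X i > 0"
    and bounds: "\<And>i. i \<in> A \<Longrightarrow> 0 \<le> g i" "\<And>i. i \<in> A \<Longrightarrow> g i \<le> \<kappa> * X i"
      "\<And>i. i \<in> A \<Longrightarrow> \<bar>c i\<bar> \<le> \<kappa> * X i"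
    and summ: "(\<lambda>i. X i powr (- p)) summable_on A"
    and \<eta>: "\<eta> > 0"
    and pos: "\<And>i \<epsilon>. i \<in> A \<Longrightarrow> \<bar>\<epsilon>\<bar> < \<eta> \<Longrightarrow> X i + 2 * \<epsilon> * c i + \<epsilon>\<^sup>2 * g i > 0"
    and summ': "\<And>\<epsilon>. \<bar>\<epsilon>\<bar> < \<eta> \<Longrightarrow> (\<lambda>i. (X i + 2 * \<epsilon> * c i + \<epsilon>\<^sup>2 * g i) powr (- p)) summable_on A"
    and le: "\<And>\<epsilon>. \<bar>\<epsilon>\<bar> < \<eta> \<Longrightarrow>
      (\<Sum>\<^sub>\<infinity>i\<in>A. (X i + 2 * \<epsilon> * c i + \<epsilon>\<^sup>2 * g i) powr (- p)) \<le> (\<Sum>\<^sub>\<infinity>i\<in>A. X i powr (- p))"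
  shows "(\<lambda>i. X i powr (- p) * (4 * p * (p + 1) * (c i)\<^sup>2 / (X i)\<^sup>2 - 2 * p * g i / X i)) summable_on A" (is "?h summable_on A")
    and "(\<Sum>\<^sub>\<infinity>i\<in>A. X i powr (- p) * (4 * p * (p + 1) * (c i)\<^sup>2 / (X i)\<^sup>2 - 2 * p * g i / X i)) \<le> 0"
proof -
  let ?S = "\<Sum>\<^sub>\<infinity>i\<in>A. X i powr (- p)"
  define K where "K = 5 * p * (p + 1) * (p + 2) * \<kappa> ^ 3"
  show h: "?h summable_on A"
  proof -
    have "norm (?h i) \<le> (4 * p * (p + 1) * \<kappa>\<^sup>2 + 2 * p * \<bar>\<kappa>\<bar>) * X i powr (- p)" if i: "i \<in> A" for i
    proof -
      have "\<bar>c i\<bar>\<^sup>2 \<le> (\<kappa> * X i)\<^sup>2" using bounds(3)[OF i] by (intro power_mono) auto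
      then have "(c i)\<^sup>2 / (X i)\<^sup>2 \<le> \<kappa>\<^sup>2"
        using X[OF i] by (simp add: power_mult_distrib divide_le_eq)
      then have "4 * p * (p + 1) * ((c i)\<^sup>2 / (X i)\<^sup>2) \<le> 4 * p * (p + 1) * \<kappa>\<^sup>2"
        using p by (intro mult_left_mono) auto
      moreover have "g i / X i \<le> \<bar>\<kappa>\<bar>"
      proof -
        have "g i / X i \<le> \<kappa>" using bounds(2)[OF i] X[OF i] by (simp add: divide_le_eq)
        then show ?thesis by simp
      qed
      then have "2 * p * (g i / X i) \<le> 2 * p * \<bar>\<kappa>\<bar>"
        using p by (intro mult_left_mono) auto
      moreover have "0 \<le> 4 * p * (p + 1) * ((c i)\<^sup>2 / (X i)\<^sup>2)" "0 \<le> 2 * p * (g i / X i)"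
        using p bounds(1)[OF i] X[OF i] by auto
      ultimately have "\<bar>4 * p * (p + 1) * (c i)\<^sup>2 / (X i)\<^sup>2 - 2 * p * g i / X i\<bar>
          \<le> 4 * p * (p + 1) * \<kappa>\<^sup>2 + 2 * p * \<bar>\<kappa>\<bar>"
        by simp
      then have "\<bar>4 * p * (p + 1) * (c i)\<^sup>2 / (X i)\<^sup>2 - 2 * p * g i / X i\<bar> * X i powr (- p)
          \<le> (4 * p * (p + 1) * \<kappa>\<^sup>2 + 2 * p * \<bar>\<kappa>\<bar>) * X i powr (- p)"
        by (rule mult_right_mono) simp
      moreover have "norm (?h i) = \<bar>4 * p * (p + 1) * (c i)\<^sup>2 / (X i)\<^sup>2 - 2 * p * g i / X i\<bar> * X i powr (- p)"
        unfolding real_norm_def abs_mult by (simp only: abs_of_nonneg[OF powr_ge_zero] mult.commute)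
      ultimately show ?thesis by simp
    qed
    then have "(\<lambda>i. norm (?h i)) summable_on A"
      by (intro Infinite_Sum.abs_summable_on_comparison_test'[OF summable_on_cmult_right[OF summ]])
    then show ?thesis by (rule abs_summable_summable)
  qed
  \<comment> \<open>The parameters \<epsilon> and -\<epsilon> are taken together, which removes the
    first-order term; after division by \<open>\<epsilon>\<^sup>2\<close> the uniform remainder
    still tends to 0.\<close>
  have bound: "infsum ?h A \<le> \<epsilon>\<^sup>2 * (K * ?S)" if \<epsilon>: "0 < \<epsilon>" "\<epsilon> < \<eta>" "\<epsilon> \<le> 1" for \<epsilon>
  proof -
    let ?P = "\<lambda>i. (X i + 2 * \<epsilon> * c i + \<epsilon>\<^sup>2 * g i) powr (- p)"
    let ?N = "\<lambda>i. (X i - 2 * \<epsilon> * c i + \<epsilon>\<^sup>2 * g i) powr (- p)"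
    have PN: "?P summable_on A" "?N summable_on A" "infsum ?P A \<le> ?S" "infsum ?N A \<le> ?S"
      using summ'[of \<epsilon>] summ'[of "- \<epsilon>"] le[of \<epsilon>] le[of "- \<epsilon>"] \<epsilon> by simp_all
    have "2 * ?S + \<epsilon>\<^sup>2 * (infsum ?h A - \<epsilon>\<^sup>2 * (K * ?S)) \<le> infsum ?P A + infsum ?N A"
    proof (rule has_sum_mono)
      show "((\<lambda>i. 2 * X i powr (- p) + \<epsilon>\<^sup>2 * (?h i - \<epsilon>\<^sup>2 * (K * X i powr (- p)))) has_sum
          2 * ?S + \<epsilon>\<^sup>2 * (infsum ?h A - \<epsilon>\<^sup>2 * (K * ?S))) A"
        by (intro has_sum_add has_sum_difference has_sum_cmult_right has_sum_infsum summ h)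
      show "((\<lambda>i. ?P i + ?N i) has_sum (infsum ?P A + infsum ?N A)) A"
        by (intro has_sum_add has_sum_infsum PN)
      fix i assume i: "i \<in> A"
      show "2 * X i powr (- p) + \<epsilon>\<^sup>2 * (?h i - \<epsilon>\<^sup>2 * (K * X i powr (- p))) \<le> ?P i + ?N i"
        unfolding K_def using pos[OF i, of \<epsilon>] pos[OF i, of "- \<epsilon>"] \<epsilon>
        by (intro powr_second_difference X bounds i p) auto
    qed
    then have "\<epsilon>\<^sup>2 * (infsum ?h A - \<epsilon>\<^sup>2 * (K * ?S)) \<le> 0" using PN by linarith
    then show ?thesis using \<epsilon>(1) by (simp add: mult_le_0_iff)
  qed
  show "infsum ?h A \<le> 0"
  proof (rule tendsto_lowerbound)
    have "((\<lambda>\<epsilon>::real. \<epsilon>\<^sup>2 * (K * ?S)) \<longlongrightarrow> 0\<^sup>2 * (K * ?S)) (at_right 0)"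
      by (intro tendsto_intros)
    then show "((\<lambda>\<epsilon>::real. \<epsilon>\<^sup>2 * (K * ?S)) \<longlongrightarrow> 0) (at_right 0)" by simp
    have "\<forall>\<^sub>F \<epsilon> in at_right 0. \<epsilon> \<in> {0<..<min \<eta> 1}"
      using \<eta> by (intro eventually_at_right_real) auto
    then show "\<forall>\<^sub>F \<epsilon> in at_right 0. infsum ?h A \<le> \<epsilon>\<^sup>2 * (K * ?S)"
      by eventually_elim (use bound in auto)
  qed simp
qed

section \<open>Second moments of power sums over a lattice\<close>

lemma int_span_covering:
  assumes "u \<in> span (set ws)"
  shows "\<exists>m\<in>int_span ws. norm (u - m) \<le> (\<Sum>i<length ws. norm (ws ! i))"
proof -
  obtain c where c: "u = (\<Sum>i<length ws. c i *\<^sub>R ws ! i)"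
    using span_set_conv_sum[OF assms] by blast
  let ?m = "\<Sum>i<length ws. of_int \<lfloor>c i\<rfloor> *\<^sub>R ws ! i"
  have "u - ?m = (\<Sum>i<length ws. frac (c i) *\<^sub>R ws ! i)"
    by (simp add: c sum_subtractf[symmetric] frac_def scaleR_diff_left)
  then have "norm (u - ?m) \<le> (\<Sum>i<length ws. norm (ws ! i))"
    by (auto intro!: order.trans[OF norm_sum] sum_mono mult_left_le_one_le
        simp: frac_ge_0 less_imp_le[OF frac_lt_1])
  moreover have "?m \<in> int_span ws"
    unfolding int_span_def by (intro CollectI exI[of _ "\<lambda>i. \<lfloor>c i\<rfloor>"]) simp
  ultimately show ?thesis by blast
qed

lemma power_group_int_span:
  assumes "p > 0" "R > 0" "(\<lambda>x. (R + (norm x)\<^sup>2) powr (- p)) summable_on int_span ws"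
  shows "power_group (int_span ws) p R (span (set ws)) (\<Sum>i<length ws. norm (ws ! i))"
  using assms int_span_covering additive_subgroup_int_span
  by unfold_locales (auto intro: span_scale)

text \<open>By \<open>psum_le\<close> the power sum over a translate is largest for the translation
  0, so its second derivative there is at most 0 in every direction of the span. Summing over an
  orthonormal basis bounds the Laplacian; \<open>(norm x)\<^sup>2 = X x - R\<close> turns it into an
  inequality between \<open>S 1\<close> and \<open>S 2\<close>.\<close>

lemma power_sum_second_moment:
  fixes ws :: "'a::euclidean_space list"
  assumes p: "p > 0" and R: "R > 0"
    and summ: "(\<lambda>x. (R + (norm x)\<^sup>2) powr (- p)) summable_on int_span ws"
  defines "S k \<equiv> \<Sum>\<^sub>\<infinity>x\<in>int_span ws. (R + (norm x)\<^sup>2) powr (- p - k)"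
  shows "(\<lambda>x. (R + (norm x)\<^sup>2) powr (- p - 1)) summable_on int_span ws"
    and "(\<lambda>x. (R + (norm x)\<^sup>2) powr (- p - 2)) summable_on int_span ws"
    and "(2 * p + 2 - of_nat (dim (set ws))) * S 1 \<le> 2 * (p + 1) * R * S 2"
proof -
  let ?M = "int_span ws"
  interpret power_group ?M p R "span (set ws)" "\<Sum>i<length ws. norm (ws ! i)"
    by (rule power_group_int_span[OF p R summ])
  define X where "X x = R + (norm x)\<^sup>2" for x :: 'a
  have X: "X x > 0" "X x \<ge> R" for x using R_pos by (auto simp: X_def)
  have summk: "(\<lambda>x. X x powr (- p - k)) summable_on ?M" if "k \<ge> 0" for k
  proof (rule summable_on_comparison_test)
    show "(\<lambda>x. R powr (- k) * X x powr (- p)) summable_on ?M"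
      unfolding X_def by (rule summable_on_cmult_right[OF summ])
    fix x
    have "X x powr (- k) \<le> R powr (- k)"
      using X R that by (intro powr_mono2') auto
    then have "X x powr (- p) * X x powr (- k) \<le> X x powr (- p) * R powr (- k)"
      by (intro mult_left_mono) auto
    moreover have "X x powr (- p - k) = X x powr (- p) * X x powr (- k)"
      by (simp add: powr_add[symmetric])
    ultimately show "X x powr (- p - k) \<le> R powr (- k) * X x powr (- p)"
      by (simp add: mult.commute)
  qed simp
  show s1: "(\<lambda>x. (R + (norm x)\<^sup>2) powr (- p - 1)) summable_on ?M"
    and s2: "(\<lambda>x. (R + (norm x)\<^sup>2) powr (- p - 2)) summable_on ?M"
    using summk[of 1] summk[of 2] by (simp_all add: X_def)
  obtain B where B: "B \<subseteq> span (set ws)" "pairwise real_inner_class.orthogonal B" "\<And>e. e \<in> B \<Longrightarrow> norm e = 1"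
    "independent B" "card B = dim (span (set ws))" "span B = span (set ws)"
    using orthonormal_basis_subspace[OF subspace_span[of "set ws"]] by metis
  have finB: "finite B" using B(4) by (rule independent_imp_finite)
  have parseval: "(\<Sum>e\<in>B. (inner x e)\<^sup>2) = (norm x)\<^sup>2" if "x \<in> ?M" for x
  proof -
    have "x \<in> span B" using that int_span_subset_span B(6) by blast
    then have x: "x = (\<Sum>e\<in>B. inner x e *\<^sub>R e)"
      using orthonormal_basis_expand[OF B(2,3) _ finB] by metis
    have "inner x (\<Sum>e\<in>B. inner x e *\<^sub>R e) = (\<Sum>e\<in>B. (inner x e)\<^sup>2)"
      by (simp add: inner_sum_right power2_eq_square)
    then show ?thesis using x by (simp add: power2_norm_eq_inner)
  qed
  define h where "h e x = X x powr (- p) * (4 * p * (p + 1) * (inner x e)\<^sup>2 / (X x)\<^sup>2 - 2 * p * 1 / X x)" for e x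
  \<comment> \<open>\<open>1 \<le> X x / R\<close> and
    \<open>norm x \<le> 1 + (norm x)\<^sup>2\<close> bound both coefficients of the variation by
    \<open>\<kappa> * X x\<close>.\<close>
  define \<kappa> where "\<kappa> = 1 + 1 / R"
  have h: "h e summable_on ?M" "infsum (h e) ?M \<le> 0" if e: "e \<in> B" for e
  proof -
    have expand: "X x + 2 * \<epsilon> * inner x e + \<epsilon>\<^sup>2 * 1 = R + (norm (x + \<epsilon> *\<^sub>R e))\<^sup>2" for x \<epsilon>
    proof -
      have "inner e e = 1" using B(3)[OF e] by (simp add: norm_eq_sqrt_inner)
      then have "(norm (x + \<epsilon> *\<^sub>R e))\<^sup>2 = (norm x)\<^sup>2 + 2 * \<epsilon> * inner x e + \<epsilon>\<^sup>2"
        unfolding power2_norm_eq_inner by (simp add: inner_add inner_commute power2_eq_square)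
      then show ?thesis by (simp add: X_def)
    qed
    have kx: "1 \<le> \<kappa> * X x" "\<bar>inner x e\<bar> \<le> \<kappa> * X x" for x
    proof -
      have "\<kappa> * X x = X x + X x / R" by (simp add: \<kappa>_def distrib_right)
      moreover have "X x / R \<ge> 1" using X(2)[of x] R by simp
      ultimately show 1: "1 \<le> \<kappa> * X x" using X(1)[of x] by linarith
      have "\<bar>inner x e\<bar> \<le> norm x * norm e" by (rule Cauchy_Schwarz_ineq2)
      also have "\<dots> = norm x" using B(3)[OF e] by simp
      also have "\<dots> \<le> 1 + (norm x)\<^sup>2"
        using zero_le_power2[of "norm x - 1/2"] by (simp add: power2_eq_square algebra_simps)
      also have "\<dots> \<le> \<kappa> * X x"
      proof -
        have "X x = R + (norm x)\<^sup>2" by (simp add: X_def)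
        then show ?thesis
          using \<open>\<kappa> * X x = X x + X x / R\<close> \<open>X x / R \<ge> 1\<close> R by linarith
      qed
      finally show "\<bar>inner x e\<bar> \<le> \<kappa> * X x" .
    qed
    have es: "\<epsilon> *\<^sub>R e \<in> span (set ws)" for \<epsilon> using e B(1) by (auto intro: span_scale)
    have *: "(\<lambda>x. X x powr (- p) * (4 * p * (p + 1) * (inner x e)\<^sup>2 / (X x)\<^sup>2 - 2 * p * 1 / X x)) summable_on ?M
      \<and> (\<Sum>\<^sub>\<infinity>x\<in>?M. X x powr (- p) * (4 * p * (p + 1) * (inner x e)\<^sup>2 / (X x)\<^sup>2 - 2 * p * 1 / X x)) \<le> 0"
    proof (rule conjI; rule second_variation_le_0[where \<eta> = 1 and \<kappa> = \<kappa> and g = "\<lambda>_. 1"])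
      show "(\<lambda>x. X x powr (- p)) summable_on ?M" "(\<lambda>x. X x powr (- p)) summable_on ?M"
        unfolding X_def by (rule summ)+
      show "(\<Sum>\<^sub>\<infinity>x\<in>?M. (X x + 2 * \<epsilon> * inner x e + \<epsilon>\<^sup>2 * 1) powr (- p)) \<le> (\<Sum>\<^sub>\<infinity>x\<in>?M. X x powr (- p))"
        "(\<Sum>\<^sub>\<infinity>x\<in>?M. (X x + 2 * \<epsilon> * inner x e + \<epsilon>\<^sup>2 * 1) powr (- p)) \<le> (\<Sum>\<^sub>\<infinity>x\<in>?M. X x powr (- p))" for \<epsilon>
        unfolding expand using psum_le[OF es[of \<epsilon>]] by (simp_all add: psum_def X_def)
      show "(\<lambda>x. (X x + 2 * \<epsilon> * inner x e + \<epsilon>\<^sup>2 * 1) powr (- p)) summable_on ?M"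
        "(\<lambda>x. (X x + 2 * \<epsilon> * inner x e + \<epsilon>\<^sup>2 * 1) powr (- p)) summable_on ?M" for \<epsilon>
        unfolding expand by (rule power_summable_shift)+
      show "X x + 2 * \<epsilon> * inner x e + \<epsilon>\<^sup>2 * 1 > 0" "X x + 2 * \<epsilon> * inner x e + \<epsilon>\<^sup>2 * 1 > 0" for x \<epsilon>
        unfolding expand by (rule R_pos)+
    qed (use p X kx in auto)
    then show "h e summable_on ?M" "infsum (h e) ?M \<le> 0" by (auto simp: h_def[abs_def])
  qed
  define m :: real where "m = of_nat (card B)"
  have hs: "((\<lambda>x. \<Sum>e\<in>B. h e x) has_sum (\<Sum>e\<in>B. infsum (h e) ?M)) ?M"
    using h(1) by (intro has_sum_finite_sum finB) auto
  have heq: "(\<Sum>e\<in>B. h e x) = 2 * p * ((2 * p + 2 - m) * X x powr (- p - 1) - 2 * (p + 1) * R * X x powr (- p - 2))"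
    if "x \<in> ?M" for x
  proof -
    have "(\<Sum>e\<in>B. h e x) = X x powr (- p) * (4 * p * (p + 1) * (\<Sum>e\<in>B. (inner x e)\<^sup>2) / (X x)\<^sup>2 - m * (2 * p / X x))"
      by (simp add: h_def m_def sum_distrib_left[symmetric] sum_divide_distrib[symmetric] sum_subtractf)
    also have "\<dots> = X x powr (- p) * (4 * p * (p + 1) * (X x - R) / (X x)\<^sup>2 - m * (2 * p / X x))"
      using parseval[OF that] by (simp add: X_def)
    also have "4 * p * (p + 1) * (X x - R) / (X x)\<^sup>2 = 4 * p * (p + 1) * (1 / X x - R / (X x)\<^sup>2)"
      using X(1)[of x] by (simp add: field_simps power2_eq_square)
    also have "X x powr (- p) * (4 * p * (p + 1) * (1 / X x - R / (X x)\<^sup>2) - m * (2 * p / X x))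
        = X x powr (- p) * (2 * p * ((2 * p + 2 - m) / X x - 2 * (p + 1) * R / (X x)\<^sup>2))"
      by (simp add: divide_inverse algebra_simps)
    also have "\<dots> = 2 * p * ((2 * p + 2 - m) * (X x powr (- p) / X x) - 2 * (p + 1) * R * (X x powr (- p) / (X x)\<^sup>2))"
    proof -
      have "P * (2 * p * (a / y - b / z)) = 2 * p * (a * (P / y) - b * (P / z))" for P a b y z :: real
        by (simp add: divide_inverse right_diff_distrib mult_ac)
      then show ?thesis .
    qed
    also have "X x powr (- p) / X x = X x powr (- p - 1)"
      using X(1)[of x] by (simp add: powr_diff)
    also have "X x powr (- p) / (X x)\<^sup>2 = X x powr (- p - 2)"
      using X(1)[of x] by (simp add: powr_diff)
    finally show ?thesis .
  qed
  have "((\<lambda>x. 2 * p * ((2 * p + 2 - m) * X x powr (- p - 1) - 2 * (p + 1) * R * X x powr (- p - 2)))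
      has_sum 2 * p * ((2 * p + 2 - m) * S 1 - 2 * (p + 1) * R * S 2)) ?M"
    unfolding S_def using s1 s2
    by (intro has_sum_cmult_right has_sum_difference) (auto simp: X_def)
  moreover have "((\<lambda>x. 2 * p * ((2 * p + 2 - m) * X x powr (- p - 1) - 2 * (p + 1) * R * X x powr (- p - 2)))
      has_sum (\<Sum>e\<in>B. infsum (h e) ?M)) ?M"
    using hs heq by (subst has_sum_cong[symmetric]) auto
  ultimately have "2 * p * ((2 * p + 2 - m) * S 1 - 2 * (p + 1) * R * S 2) = (\<Sum>e\<in>B. infsum (h e) ?M)"
    by (rule has_sum_unique)
  also have "\<dots> \<le> 0" using h(2) by (rule sum_nonpos)
  finally have "(2 * p + 2 - m) * S 1 - 2 * (p + 1) * R * S 2 \<le> 0"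
    using p by (simp add: mult_le_0_iff)
  then show "(2 * p + 2 - of_nat (dim (set ws))) * S 1 \<le> 2 * (p + 1) * R * S 2"
    using B(5) by (simp add: m_def)
qed

section \<open>Comparing zeta sums\<close>

text \<open>The zeta sum of the theorem on an arbitrary inner product space, with \<open>q\<close>
  written where \<open>psum\<close> has \<open>R\<close>.\<close>

definition zsum :: "'a::real_inner set \<Rightarrow> real \<Rightarrow> real \<Rightarrow> real" where
  "zsum L s q = (\<Sum>\<^sub>\<infinity>z\<in>L - {0}. (q + (norm z)\<^sup>2) powr (- s))"

definition zsummable :: "'a::real_inner set \<Rightarrow> real \<Rightarrow> real \<Rightarrow> bool" where
  "zsummable L s q \<longleftrightarrow> (\<lambda>z. (q + (norm z)\<^sup>2) powr (- s)) summable_on (L - {0})"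

lemma has_sum_zsum:
  "zsummable L s q \<Longrightarrow> ((\<lambda>z. (q + (norm z)\<^sup>2) powr (- s)) has_sum zsum L s q) (L - {0})"
  unfolding zsum_def zsummable_def by (rule has_sum_infsum)

lemma zsummable_imp_summable:
  assumes L: "zsummable L s q" "M \<subseteq> L" and s: "s > 0" and q: "q \<ge> 0" and R: "R > 0" "R \<ge> q"
  shows "(\<lambda>x. (R + (norm x)\<^sup>2) powr (- s)) summable_on M"
proof -
  have "(\<lambda>x. (R + (norm x)\<^sup>2) powr (- s)) summable_on M - {0}"
  proof (rule summable_on_comparison_test)
    show "(\<lambda>x. (q + (norm x)\<^sup>2) powr (- s)) summable_on M - {0}"
      using L unfolding zsummable_def by (auto intro: summable_on_subset)
    fix x assume "x \<in> M - {0}"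
    then show "(R + (norm x)\<^sup>2) powr (- s) \<le> (q + (norm x)\<^sup>2) powr (- s)"
      using R q s by (intro powr_mono2') (auto intro: add_nonneg_pos)
  qed simp
  then have "(\<lambda>x. (R + (norm x)\<^sup>2) powr (- s)) summable_on insert 0 (M - {0})"
    by (simp only: summable_on_insert_iff)
  then show ?thesis by (rule summable_on_subset) auto
qed

text \<open>Replacing the \<open>i\<close>-th vector by the vanishing combination puts 0 into the
  list, so the volume \<open>\<bar>c i\<bar> * vol vs\<close> is 0.\<close>

lemma independent_sum_eq_0:
  assumes "vol vs > 0" "(\<Sum>i<length vs. c i *\<^sub>R vs ! i) = 0" "i < length vs"
  shows "c i = 0"
proof -
  have "vol (vs[i := 0]) = \<bar>c i\<bar> * vol vs"
    using vol_list_update[OF assms(3), of c] assms(2) by simp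
  moreover have "0 \<in> set (vs[i := 0])"
    using assms(3) by (simp add: set_update_memI)
  then have "vol (vs[i := 0]) = 0"
    unfolding vol_eq_0_iff using dependent_zero by blast
  ultimately show ?thesis using assms(1) by simp
qed

lemma res_eq_0_independent:
  assumes vol: "vol (us @ ws) > 0" and b: "b \<in> span (set us)" "res (set ws) b = 0"
  shows "b = 0"
proof -
  obtain c where c: "b = (\<Sum>i<length us. c i *\<^sub>R us ! i)"
    using span_set_conv_sum[OF b(1)] by blast
  have "vol (map (res (set ws)) us) > 0"
    using vol vol_nonneg[of ws] vol_nonneg[of "map (res (set ws)) us"]
    by (auto simp: vol_append zero_less_mult_iff)
  moreover have "(\<Sum>i<length (map (res (set ws)) us). c i *\<^sub>R map (res (set ws)) us ! i) = 0"
    using b(2) by (simp add: c linear_sum[OF linear_res] res_scale)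
  ultimately have "c i = 0" if "i < length us" for i
    using independent_sum_eq_0[of "map (res (set ws)) us" c i] that by simp
  then show ?thesis by (simp add: c)
qed

text \<open>Only finitely many points of \<open>M\<close> come within distance 1 of
  \<open>- u\<close>, and none of them equals \<open>- u\<close>.\<close>

lemma semistable_dist_pos:
  assumes M: "additive_subgroup M" "semistable M" and u: "u \<notin> M"
  obtains \<delta> where "\<delta> > 0" "\<And>x. x \<in> M \<Longrightarrow> \<delta> \<le> norm (x + u)"
proof -
  define F where "F = insert 1 ((\<lambda>x. norm (x + u)) ` (M \<inter> cball 0 (norm u + 1)))"
  have fin: "finite F" unfolding F_def using finite_semistable_cball[OF M] by simp
  have pos: "f > 0" if "f \<in> F" for f
  proof -
    have "x + u \<noteq> 0" if "x \<in> M" for x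
      using additive_subgroup_minus[OF M(1) that] u by (metis add.inverse_unique)
    then show ?thesis using that by (auto simp: F_def)
  qed
  have "Min F \<le> norm (x + u)" if x: "x \<in> M" for x
  proof (cases "norm (x + u) < 1")
    case True
    have "norm x \<le> norm (x + u) + norm u"
      using norm_triangle_ineq4[of "x + u" u] by simp
    then have "norm (x + u) \<in> F" using True x by (auto simp: F_def)
    then show ?thesis using fin by simp
  next
    case False
    have "Min F \<le> 1" using fin by (intro Min_le) (auto simp: F_def)
    then show ?thesis using False by simp
  qed
  moreover have "Min F > 0" using fin pos by (subst Min_gr_iff) (auto simp: F_def)
  ultimately show ?thesis using that by blast
qed

text \<open>Both lattices fibre over the projection of \<open>B\<close>. The fibre over
  \<open>\<rho> b\<close> is, at height \<open>norm (\<rho> b)\<close>, the translate of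
  \<open>M\<close> by \<open>b - \<rho> b\<close> in \<open>L\<close> and \<open>M\<close> itself in
  \<open>L'\<close>. Fibrewise this is \<open>psum_le\<close> with
  \<open>R = q + (norm (\<rho> b))\<^sup>2\<close>; in the case of equality \<open>psum_less\<close>
  puts every \<open>b - \<rho> b\<close> into \<open>M\<close>.\<close>

lemma zsum_orthogonalize:
  fixes us ws :: "'a::euclidean_space list"
  assumes s: "s > 0" and q: "q \<ge> 0" and vol: "vol (us @ ws) > 0"
    and L: "L = int_span (us @ ws)" and L': "L' = int_span (map (res (set ws)) us @ ws)"
    and summ: "zsummable L s q" "zsummable L' s q" and ss: "semistable (int_span ws)"
  shows "zsum L s q \<le> zsum L' s q" and "zsum L s q = zsum L' s q \<Longrightarrow> L = L'"
proof -
  define M where "M = int_span ws"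
  define B where "B = int_span us"
  define \<rho> where "\<rho> = res (set ws)"
  \<comment> \<open>The origin is missing from the fibre over 0 alone, and that fibre is the same in
    \<open>L\<close> and \<open>L'\<close>.\<close>
  define I where "I b = (if b = 0 then M - {0} else M)" for b :: 'a
  have M: "additive_subgroup M" "M \<subseteq> span (set ws)" "semistable M"
    and B: "additive_subgroup B" "B \<subseteq> span (set us)"
    using ss by (auto simp: M_def B_def additive_subgroup_int_span int_span_subset_span)
  note lin = linear_res[of "set ws", folded \<rho>_def]
  have rhoM: "\<rho> x = 0" if "x \<in> M" for x
    using that M(2) by (auto simp: \<rho>_def res_eq_0_iff)
  have rho0: "b = 0" if "b \<in> B" "\<rho> b = 0" for b
    using res_eq_0_independent[OF vol] that B(2) by (auto simp: \<rho>_def)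
  have pi: "b - \<rho> b \<in> span (set ws)" for b
    unfolding \<rho>_def by (rule res_diff)
  have swap: "{b + x | b x. b \<in> A \<and> x \<in> M} = {x + b | x b. x \<in> M \<and> b \<in> A}" for A :: "'a set"
    by (rule Collect_cong) (metis add.commute)
  have L_eq1: "L = {x + b | x b. x \<in> M \<and> b \<in> B}"
    using swap[of B] by (simp only: L int_span_append M_def B_def)
  have "L' = {x + b | x b. x \<in> M \<and> b \<in> \<rho> ` B}"
    using swap[of "\<rho> ` B"]
    by (simp only: L' int_span_append int_span_map[OF linear_res] M_def B_def \<rho>_def)
  then have L_eq2: "L' = {x + \<rho> b | x b. x \<in> M \<and> b \<in> B}"
    by blast
  note L_eq = L_eq1 L_eq2
  have uniq: "b = b'" if "b \<in> B" "b' \<in> B" "\<rho> b = \<rho> b'" for b b'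
    using rho0[OF additive_subgroup_diff[OF B(1) that(1,2)]] linear_diff[OF lin, of b b'] that(3) by simp
  have rr: "\<rho> (\<rho> b) = \<rho> b" for b
    unfolding \<rho>_def by (metis res_orth res_orthogonal span_base)
  \<comment> \<open>\<open>g\<close> will be the identity for \<open>L\<close> and
    \<open>\<rho>\<close> for \<open>L'\<close>; both have the same projection.\<close>
  have bij: "bij_betw (\<lambda>(b, x). x + g b) (Sigma B I) (K - {0})"
    if g: "g 0 = 0" "\<And>b. \<rho> (g b) = \<rho> b" and K: "K = {x + g b | x b. x \<in> M \<and> b \<in> B}"
    for g :: "'a \<Rightarrow> 'a" and K
    unfolding bij_betw_def
  proof
    have IM: "x \<in> M" if "x \<in> I b" for x b
      using that by (simp add: I_def split: if_splits)
    have rho_add: "\<rho> (x + g b) = \<rho> b" if "x \<in> M" for x b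
      using that rhoM g(2) by (simp add: linear_add[OF lin])
    show "inj_on (\<lambda>(b, x). x + g b) (Sigma B I)"
    proof (rule inj_onI, clarify)
      fix b x b' x' assume *: "b \<in> B" "x \<in> I b" "b' \<in> B" "x' \<in> I b'" "x + g b = x' + g b'"
      then have "\<rho> b = \<rho> b'" using rho_add IM by metis
      then have "b = b'" by (rule uniq[OF *(1,3)])
      then show "b = b' \<and> x = x'" using *(5) by simp
    qed
    have "x + g b \<in> K - {0}" if bx: "b \<in> B" "x \<in> I b" for x b
    proof -
      have "x + g b \<noteq> 0"
      proof
        assume 0: "x + g b = 0"
        then have "\<rho> b = 0" using rho_add[OF IM[OF bx(2)], of b] by (simp add: linear_0[OF lin])
        then have "b = 0" by (rule rho0[OF bx(1)])
        then show False using 0 bx(2) g(1) by (simp add: I_def)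
      qed
      then show ?thesis using IM[OF bx(2)] bx(1) unfolding K by blast
    qed
    moreover have "z \<in> (\<lambda>(b, x). x + g b) ` Sigma B I" if z: "z \<in> K - {0}" for z
    proof -
      obtain x b where xb: "x \<in> M" "b \<in> B" "z = x + g b" using z unfolding K by blast
      then have "x \<in> I b" using z g(1) by (auto simp: I_def)
      then show ?thesis using xb by force
    qed
    ultimately show "(\<lambda>(b, x). x + g b) ` Sigma B I = K - {0}" by auto
  qed
  have bij1: "bij_betw (\<lambda>(b, x). x + b) (Sigma B I) (L - {0})"
    by (rule bij[OF _ _ L_eq(1)]) simp_all
  have bij2: "bij_betw (\<lambda>(b, x). x + \<rho> b) (Sigma B I) (L' - {0})"
    by (rule bij[OF _ rr L_eq(2)]) (simp add: linear_0[OF lin])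
  define R where "R b = q + (norm (\<rho> b))\<^sup>2" for b
  have nrm: "q + (norm (x + b))\<^sup>2 = R b + (norm (x + (b - \<rho> b)))\<^sup>2"
    "q + (norm (x + \<rho> b))\<^sup>2 = R b + (norm x)\<^sup>2" if "x \<in> M" for x b
  proof -
    have x: "x \<in> span (set ws)" using that M(2) by blast
    have "x + b = (x + (b - \<rho> b)) + \<rho> b" by simp
    then have "(norm (x + b))\<^sup>2 = (norm (x + (b - \<rho> b)))\<^sup>2 + (norm (\<rho> b))\<^sup>2"
      by (metis norm_sq_add_orth pi x span_add res_orth' \<rho>_def)
    moreover have "(norm (x + \<rho> b))\<^sup>2 = (norm x)\<^sup>2 + (norm (\<rho> b))\<^sup>2"
      by (metis norm_sq_add_orth x res_orth' \<rho>_def)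
    ultimately show "q + (norm (x + b))\<^sup>2 = R b + (norm (x + (b - \<rho> b)))\<^sup>2"
      "q + (norm (x + \<rho> b))\<^sup>2 = R b + (norm x)\<^sup>2" by (simp_all add: R_def)
  qed
  have IM: "I b \<subseteq> M" for b by (auto simp: I_def)
  let ?F1 = "\<lambda>b x. (R b + (norm (x + (b - \<rho> b)))\<^sup>2) powr (- s)"
  let ?F2 = "\<lambda>b x. (R b + (norm x)\<^sup>2) powr (- s)"
  have S1: "((\<lambda>(b, x). ?F1 b x) has_sum zsum L s q) (Sigma B I)"
  proof -
    have "((\<lambda>i. (q + (norm ((\<lambda>(b, x). x + b) i))\<^sup>2) powr (- s)) has_sum zsum L s q) (Sigma B I)"
      using has_sum_zsum[OF summ(1)] by (subst has_sum_reindex_bij_betw[OF bij1])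
    then show ?thesis
    proof (rule has_sum_cong[THEN iffD1, rotated])
      fix i assume "i \<in> Sigma B I"
      then obtain b x where i: "i = (b, x)" "x \<in> M" using IM by auto
      show "(q + (norm ((\<lambda>(b, x). x + b) i))\<^sup>2) powr (- s) = (\<lambda>(b, x). ?F1 b x) i"
        unfolding i(1) by (simp only: prod.case nrm(1)[OF i(2)])
    qed
  qed
  have S2: "((\<lambda>(b, x). ?F2 b x) has_sum zsum L' s q) (Sigma B I)"
  proof -
    have "((\<lambda>i. (q + (norm ((\<lambda>(b, x). x + \<rho> b) i))\<^sup>2) powr (- s)) has_sum zsum L' s q) (Sigma B I)"
      using has_sum_zsum[OF summ(2)] by (subst has_sum_reindex_bij_betw[OF bij2])
    then show ?thesis
    proof (rule has_sum_cong[THEN iffD1, rotated])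
      fix i assume "i \<in> Sigma B I"
      then obtain b x where i: "i = (b, x)" "x \<in> M" using IM by auto
      show "(q + (norm ((\<lambda>(b, x). x + \<rho> b) i))\<^sup>2) powr (- s) = (\<lambda>(b, x). ?F2 b x) i"
        unfolding i(1) by (simp only: prod.case nrm(2)[OF i(2)])
    qed
  qed
  have D1: "((\<lambda>b. infsum (?F1 b) (I b)) has_sum zsum L s q) B"
    and D2: "((\<lambda>b. infsum (?F2 b) (I b)) has_sum zsum L' s q) B"
  proof -
    show "((\<lambda>b. infsum (?F1 b) (I b)) has_sum zsum L s q) B"
      using has_sum_infsum[OF summable_on_Sigma_banach[OF has_sum_imp_summable[OF S1]]]
      by (simp only: infsum_Sigma'_banach[OF has_sum_imp_summable[OF S1]] infsumI[OF S1])
    show "((\<lambda>b. infsum (?F2 b) (I b)) has_sum zsum L' s q) B"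
      using has_sum_infsum[OF summable_on_Sigma_banach[OF has_sum_imp_summable[OF S2]]]
      by (simp only: infsum_Sigma'_banach[OF has_sum_imp_summable[OF S2]] infsumI[OF S2])
  qed
  have grp: "power_group M s (R b) (span (set ws)) (\<Sum>i<length ws. norm (ws ! i))"
    if "b \<in> B" "b \<noteq> 0" for b
  proof -
    have "\<rho> b \<noteq> 0" using rho0[OF that(1)] that(2) by blast
    then have "R b > 0" "R b \<ge> q"
      unfolding R_def using q by (auto intro!: add_nonneg_pos)
    moreover have "M \<subseteq> L" using L_eq(1) additive_subgroup_0[OF B(1)] by force
    ultimately show ?thesis
      unfolding M_def
      by (intro power_group_int_span s zsummable_imp_summable[OF summ(1) _ s q]) (auto simp: M_def)
  qed
  have le: "infsum (?F1 b) (I b) \<le> infsum (?F2 b) (I b)" if b: "b \<in> B" for b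
  proof (cases "b = 0")
    case True
    then show ?thesis by (simp add: linear_0[OF lin])
  next
    case False
    then show ?thesis
      using power_group.psum_le[OF grp[OF b False] pi[of b]]
      by (simp add: I_def power_group.psum_def[OF grp[OF b False]])
  qed
  show "zsum L s q \<le> zsum L' s q"
    using D1 D2 le by (rule has_sum_mono)
  assume eq: "zsum L s q = zsum L' s q"
  have piM: "b - \<rho> b \<in> M" if b: "b \<in> B" for b
  proof (rule ccontr)
    assume nM: "b - \<rho> b \<notin> M"
    then have "b \<noteq> 0" using additive_subgroup_0[OF M(1)] by (auto simp: linear_0[OF lin])
    obtain \<delta> where \<delta>: "\<delta> > 0" "\<And>x. x \<in> M \<Longrightarrow> \<delta> \<le> norm (x + (b - \<rho> b))"
      using semistable_dist_pos[OF M(1,3) nM] by blast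
    have "infsum (?F1 b) (I b) < infsum (?F2 b) (I b)"
      using power_group.psum_less[OF grp[OF b \<open>b \<noteq> 0\<close>] pi[of b] \<delta>] \<open>b \<noteq> 0\<close>
      by (simp add: I_def power_group.psum_def[OF grp[OF b \<open>b \<noteq> 0\<close>]])
    then have "zsum L s q < zsum L' s q"
      using D1 D2 le b by (intro has_sum_strict_mono[OF D1 D2])
    then show False using eq by simp
  qed
  show "L = L'"
  proof (intro equalityI subsetI)
    fix z assume "z \<in> L"
    then obtain x b where z: "x \<in> M" "b \<in> B" "z = x + b" unfolding L_eq(1) by blast
    then have "z = (x + (b - \<rho> b)) + \<rho> b" by simp
    then show "z \<in> L'"
      using z additive_subgroup_add[OF M(1) z(1) piM[OF z(2)]] unfolding L_eq(2) by blast
  next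
    fix z assume "z \<in> L'"
    then obtain x b where z: "x \<in> M" "b \<in> B" "z = x + \<rho> b" unfolding L_eq(2) by blast
    then have "z = (x - (b - \<rho> b)) + b" by simp
    then show "z \<in> L"
      using z additive_subgroup_diff[OF M(1) z(1) piM[OF z(2)]] unfolding L_eq(1) by blast
  qed
qed

section \<open>Shears\<close>

text \<open>For orthogonal \<open>u\<close> and \<open>v\<close> this is a transvection: it has
  determinant 1, its inverse belongs to -\<epsilon>, and squared norms become quadratic polynomials
  in \<epsilon> (\<open>norm_shear\<close>), the form in which \<open>second_variation_le_0\<close>
  takes them.\<close>

definition shear :: "'a::real_inner \<Rightarrow> 'a \<Rightarrow> real \<Rightarrow> 'a \<Rightarrow> 'a" where
  "shear u v \<epsilon> x = x + (\<epsilon> * inner x v) *\<^sub>R u"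

lemma linear_shear: "linear (shear u v \<epsilon>)"
  by (rule linearI) (simp_all add: shear_def inner_add_left algebra_simps)

lemma shear_inverse: "inner u v = 0 \<Longrightarrow> shear u v (- \<epsilon>) (shear u v \<epsilon> x) = x"
  by (simp add: shear_def inner_add_left)

lemma norm_shear:
  "(norm (shear u v \<epsilon> x))\<^sup>2
    = (norm x)\<^sup>2 + 2 * \<epsilon> * (inner x u * inner x v) + \<epsilon>\<^sup>2 * ((inner x v)\<^sup>2 * (norm u)\<^sup>2)"
  unfolding power2_norm_eq_inner shear_def
  by (simp add: inner_add inner_commute power2_eq_square algebra_simps)

lemma norm_shear_ge: "(1 - \<bar>\<epsilon>\<bar> * (norm u * norm v)) * norm x \<le> norm (shear u v \<epsilon> x)"
proof -
  have "norm ((\<epsilon> * inner x v) *\<^sub>R u) \<le> \<bar>\<epsilon>\<bar> * (norm x * norm v) * norm u"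
    using Cauchy_Schwarz_ineq2[of x v] by (auto simp: abs_mult intro!: mult_mono)
  moreover have "norm x - norm ((\<epsilon> * inner x v) *\<^sub>R u) \<le> norm (shear u v \<epsilon> x)"
    unfolding shear_def by (rule norm_diff_ineq)
  ultimately show ?thesis by (simp add: algebra_simps)
qed

text \<open>A linear map multiplies the volumes of all lists of this length in
  \<open>span (set E)\<close> by one common factor. The cross-multiplied form includes volume
  0.\<close>

lemma vol_map_ratio:
  assumes f: "linear f" and len: "length ws = length E" and sp: "set ws \<subseteq> span (set E)"
  shows "vol (map f ws) * vol E = vol ws * vol (map f E)"
proof -
  have "\<exists>c. ws ! i = (\<Sum>j<length E. c j *\<^sub>R E ! j)" if "i < length E" for i
    using span_set_conv_sum[of "ws ! i" E] sp len that by (metis nth_mem subsetD)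
  then obtain c where c: "\<And>i. i < length E \<Longrightarrow> ws ! i = (\<Sum>j<length E. c i j *\<^sub>R E ! j)"
    by metis
  let ?d = "Determinant.det (Matrix.mat (length E) (length E) (\<lambda>(i, j). c i j))"
  have 1: "gram_det ws = ?d\<^sup>2 * gram_det E"
    by (rule gram_det_lincomb[OF len c])
  have 2: "gram_det (map f ws) = (Determinant.det (Matrix.mat (length (map f E)) (length (map f E)) (\<lambda>(i, j). c i j)))\<^sup>2 * gram_det (map f E)"
    by (rule gram_det_lincomb) (use len c in \<open>simp_all add: linear_sum[OF f] linear_scale[OF f]\<close>)
  have "(vol (map f ws) * vol E)\<^sup>2 = (vol ws * vol (map f E))\<^sup>2"
    using 1 2 by (simp add: gram_det_vol power_mult_distrib mult_ac)
  then show ?thesis by (rule power2_eq_imp_eq) auto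
qed

text \<open>By \<open>vol_map_ratio\<close> it is enough to treat one basis. In
  \<open>E = v # u # rest\<close>, where \<open>u # rest\<close> spans the part of the span
  orthogonal to \<open>v\<close>, the shear fixes every vector but \<open>v\<close>, to which it
  adds a multiple of \<open>u\<close>.\<close>

lemma vol_shear:
  fixes u v :: "'a::euclidean_space"
  assumes ws: "vol ws > 0" and uv: "u \<in> span (set ws)" "v \<in> span (set ws)" "inner u v = 0"
  shows "vol (map (shear u v \<epsilon>) ws) = vol ws"
proof (cases "u = 0 \<or> v = 0")
  case True
  then have "shear u v \<epsilon> = id" by (auto simp: shear_def)
  then show ?thesis by simp
next
  case False
  define T where "T = span (set ws) \<inter> {x. inner v x = 0}"
  have subT: "subspace T"
    unfolding T_def by (intro subspace_inter subspace_span subspace_hyperplane)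
  have uT: "u \<in> T" using uv by (simp add: T_def inner_commute)
  have "independent {u}" using False by simp
  then obtain B where B: "{u} \<subseteq> B" "B \<subseteq> T" "independent B" "T \<subseteq> span B"
    using maximal_independent_subset_extend[of "{u}" T] uT by auto
  have "span B \<subseteq> T" using B(2) subT by (rule span_minimal)
  then have vB: "v \<notin> span B" using False by (auto simp: T_def)
  have finB: "finite B" using B(3) by (rule independent_imp_finite)
  obtain rest where rest: "set rest = B - {u}" "distinct rest"
    using finite_distinct_list finB by (metis finite_Diff)
  define E where "E = v # u # rest"
  have setE: "set E = insert v B" using B(1) rest(1) by (auto simp: E_def)
  have "v \<notin> B" using vB span_base by blast
  then have distE: "distinct E" using rest B(1) by (auto simp: E_def)
  have indE: "independent (set E)" using vB B(3) setE by (simp add: independent_insert)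
  have volE: "vol E > 0" using distE indE by (simp add: vol_pos_iff)
  have spE: "span (set E) = span (set ws)"
  proof
    show "span (set E) \<subseteq> span (set ws)"
      using B(2) uv by (intro span_minimal) (auto simp: setE T_def)
    show "span (set ws) \<subseteq> span (set E)"
    proof
      fix x assume x: "x \<in> span (set ws)"
      define k where "k = inner v x / inner v v"
      have "x - k *\<^sub>R v \<in> T"
        using x uv False by (simp add: T_def k_def inner_diff_right span_diff span_scale)
      then have "x - k *\<^sub>R v \<in> span (set E)"
        using B(4) span_mono[of B "set E"] by (auto simp: setE)
      moreover have "k *\<^sub>R v \<in> span (set E)" by (intro span_scale span_base) (simp add: setE)
      ultimately have "x - k *\<^sub>R v + k *\<^sub>R v \<in> span (set E)" by (rule span_add)
      then show "x \<in> span (set E)" by simp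
    qed
  qed
  have len: "length ws = length E"
    using ws volE spE by (metis dim_eq_card_independent dim_span distinct_card vol_pos_iff)
  have "map (shear u v \<epsilon>) (u # rest) = u # rest"
  proof (rule map_idI)
    fix x assume "x \<in> set (u # rest)"
    then have "inner v x = 0" using B(1,2) rest(1) by (auto simp: T_def)
    then show "shear u v \<epsilon> x = x" by (simp add: shear_def inner_commute)
  qed
  then have mapE: "map (shear u v \<epsilon>) E = (v + (\<epsilon> * inner v v) *\<^sub>R u) # u # rest"
    by (simp add: E_def shear_def)
  have "res (set (u # rest)) u = 0"
    by (simp add: res_eq_0_iff span_base)
  then have "vol (map (shear u v \<epsilon>) E) = vol E"
    unfolding mapE by (simp add: E_def res_add res_scale)
  moreover have "vol (map (shear u v \<epsilon>) ws) * vol E = vol ws * vol (map (shear u v \<epsilon>) E)"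
    using spE span_superset[of "set ws"] by (intro vol_map_ratio linear_shear len) auto
  ultimately show ?thesis using volE by simp
qed

text \<open>The residual of \<open>f x\<close> is \<open>f (x - w)\<close> for some \<open>w\<close>
  in the span of the later vectors, and \<open>x - w\<close> is at least as long as the residual of
  \<open>x\<close>; so every factor of the volume shrinks at most by
  \<open>\<kappa>\<close>.\<close>

lemma vol_map_ge:
  assumes f: "linear f" and \<kappa>: "0 \<le> \<kappa>" "\<And>x. \<kappa> * norm x \<le> norm (f x)"
  shows "\<kappa> ^ length xs * vol xs \<le> vol (map f xs)"
proof (induction xs)
  case (Cons x xs)
  have "f x - res (f ` set xs) (f x) \<in> f ` span (set xs)"
    using res_diff[of "f x" "f ` set xs"] linear_span_image[OF f, of "set xs"] by simp
  then obtain w where w: "w \<in> span (set xs)" "f x - res (f ` set xs) (f x) = f w" by auto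
  then have "res (f ` set xs) (f x) = f (x - w)"
    by (simp add: linear_diff[OF f] algebra_simps)
  then have "\<kappa> * norm (res (set xs) x) \<le> norm (res (f ` set xs) (f x))"
    using \<kappa>(2)[of "x - w"] mult_left_mono[OF norm_res_le[OF w(1), of x] \<kappa>(1)] by simp
  then have "(\<kappa> * norm (res (set xs) x)) * (\<kappa> ^ length xs * vol xs)
      \<le> norm (res (f ` set xs) (f x)) * vol (map f xs)"
    using Cons \<kappa>(1) by (intro mult_mono) auto
  then show ?case by (simp add: mult_ac)
qed simp

lemma vol_map_pos:
  assumes f: "linear f" and pos: "vol (map f xs) > 0"
  shows "vol xs > 0"
proof (rule ccontr)
  assume "\<not> vol xs > 0"
  then have "vol xs = 0" using vol_nonneg[of xs] by linarith
  then obtain as v bs where xs: "xs = as @ v # bs" "v \<in> span (set bs)"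
    using vol_eq_0_split by blast
  have "f v \<in> span (f ` set bs)" using xs(2) linear_span_image[OF f] by blast
  then have "vol (map f xs) = 0" by (simp add: xs(1) vol_append res_eq_0_iff)
  then show False using pos by simp
qed

section \<open>Deforming an indecomposable summand\<close>

text \<open>Sublattices of volume at most 2 have bases of bounded norm and a ball contains finitely
  many points of \<open>M\<close>, so finitely many volumes up to 2 occur. This gap leaves room for
  a small deformation.\<close>

lemma semistable_gap:
  assumes M: "additive_subgroup M" "semistable M"
    and proper: "\<And>xs. set xs \<subseteq> M \<Longrightarrow> xs \<noteq> [] \<Longrightarrow> length xs < d \<Longrightarrow> vol xs \<noteq> 1"
  obtains \<gamma> where "0 < \<gamma>" "\<gamma> \<le> 1"
    "\<And>xs. set xs \<subseteq> M \<Longrightarrow> xs \<noteq> [] \<Longrightarrow> length xs < d \<Longrightarrow> vol xs > 0 \<Longrightarrow> 1 + \<gamma> \<le> vol xs"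
proof -
  define C :: real where "C = of_nat d * 2 ^ (d * d) * 2"
  define Q where "Q = {us. set us \<subseteq> M \<inter> cball 0 C \<and> length us \<le> d}"
  have "finite Q"
    unfolding Q_def by (intro finite_lists_length_le finite_semistable_cball[OF M])
  \<comment> \<open>The value 2 keeps the set nonempty and bounds \<open>\<gamma>\<close> by
    1.\<close>
  define F where "F = insert 2 (vol ` {us\<in>Q. vol us > 1})"
  have fin: "finite F" using \<open>finite Q\<close> by (simp add: F_def)
  have F1: "f > 1" if "f \<in> F" for f using that by (auto simp: F_def)
  define \<gamma> where "\<gamma> = Min F - 1"
  have "2 \<in> F" by (simp add: F_def)
  then have "F \<noteq> {}" by blast
  then have "Min F > 1" by (rule F1[OF Min_in[OF fin]])
  moreover have "Min F \<le> 2" using fin \<open>2 \<in> F\<close> by (rule Min_le)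
  moreover have "Min F \<le> vol xs" if xs: "set xs \<subseteq> M" "xs \<noteq> []" "length xs < d" "vol xs > 0" for xs
  proof (cases "vol xs \<le> 2")
    case True
    have "vol xs \<ge> 1" using semistableD[OF M(2) xs(1,4)] .
    then have "vol xs > 1" using proper[OF xs(1-3)] by linarith
    obtain us where us: "length us = length xs" "int_span us = int_span xs"
      "\<And>u. u \<in> set us \<Longrightarrow> norm u \<le> of_nat (length xs) * 2 ^ (length xs * length xs) * vol xs"
      using bounded_basis_exists[OF M xs(1,4)] by metis
    have "of_nat (length xs) * 2 ^ (length xs * length xs) * vol xs \<le> C"
      unfolding C_def using xs(3) True
      by (intro mult_mono power_increasing) (auto intro!: mult_le_mono)
    then have "set us \<subseteq> M \<inter> cball 0 C"
      using us(3) us(2) int_span_least[OF M(1) xs(1)] set_subset_int_span[of us] by fastforce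
    moreover have "vol us = vol xs" by (rule vol_cong_int_span[OF us(1,2)])
    ultimately have "vol xs \<in> F"
      using us(1) xs(3) \<open>vol xs > 1\<close> unfolding F_def Q_def
      by (intro insertI2 image_eqI[of _ _ us]) auto
    then show ?thesis using fin by simp
  next
    case False
    then show ?thesis using \<open>Min F \<le> 2\<close> by linarith
  qed
  ultimately show ?thesis using that[of \<gamma>] by (simp add: \<gamma>_def)
qed

text \<open>Sublattices of the summand of lower positive rank have volume at least
  \<open>1 + \<gamma>\<close> and lose little under a small shear; those of full rank keep their
  volume by \<open>vol_shear\<close>. The complement is fixed, being orthogonal to \<open>v\<close>,
  and \<open>semistable_orthogonal_sum\<close> reassembles the lattice.\<close>

lemma shear_unimodular:
  fixes us ws :: "'a::euclidean_space list"
  assumes len: "length (us @ ws) = DIM('a)" and ss: "semistable (int_span (us @ ws))"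
    and vol: "vol us = 1" "vol ws = 1"
    and orth: "\<And>x y. x \<in> set us \<Longrightarrow> y \<in> set ws \<Longrightarrow> inner x y = 0"
    and proper: "\<And>xs. set xs \<subseteq> int_span ws \<Longrightarrow> xs \<noteq> [] \<Longrightarrow> length xs < length ws \<Longrightarrow> vol xs \<noteq> 1"
    and uv: "u \<in> span (set ws)" "v \<in> span (set ws)" "inner u v = 0"
  obtains \<eta> where "\<eta> > 0" "\<And>\<epsilon>. \<bar>\<epsilon>\<bar> < \<eta> \<Longrightarrow> shear u v \<epsilon> ` int_span (us @ ws) \<in> unimodular_lattices"
proof -
  define M where "M = int_span ws"
  define d where "d = length ws"
  have sub: "set ws \<subseteq> int_span (us @ ws)" "set us \<subseteq> int_span (us @ ws)"
    using set_subset_int_span[of "us @ ws"] by auto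
  have ssM: "semistable M" "semistable (int_span us)"
    unfolding M_def using sub[folded int_span_subset_iff]
    by (auto intro: semistable_subset[OF ss])
  have grpM: "additive_subgroup M" by (simp add: M_def additive_subgroup_int_span)
  have orthspan: "inner x y = 0" if x: "x \<in> int_span us" and y: "y \<in> span (set ws)" for x y
  proof -
    have *: "inner x' y = 0" if "x' \<in> set us" for x'
      using y orth[OF that] by (induction rule: span_induct_alt) (auto simp: inner_add_right)
    have "inner x' y = 0" if "x' \<in> span (set us)" for x'
      using that by (induction rule: span_induct_alt) (auto simp: inner_add_left *)
    then show ?thesis using x int_span_subset_span by blast
  qed
  obtain \<gamma> where \<gamma>: "0 < \<gamma>" "\<gamma> \<le> 1"
    "\<And>xs. set xs \<subseteq> M \<Longrightarrow> xs \<noteq> [] \<Longrightarrow> length xs < d \<Longrightarrow> vol xs > 0 \<Longrightarrow> 1 + \<gamma> \<le> vol xs"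
    using semistable_gap[OF grpM ssM(1), of d] proper unfolding M_def d_def by metis
  define m where "m = norm u * norm v"
  \<comment> \<open>Chosen so that \<open>\<bar>\<epsilon>\<bar> * m \<le> 1\<close> and, by
    Bernoulli, \<open>\<kappa> ^ d \<ge> 1 - \<gamma> / 2\<close>, which is enough as
    \<open>(1 - \<gamma> / 2) * (1 + \<gamma>) \<ge> 1\<close>. The summand 1 keeps the denominator
    positive for \<open>m = 0\<close>.\<close>
  define \<eta> where "\<eta> = \<gamma> / (2 * (of_nat d * m + m + 1))"
  have m: "m \<ge> 0" by (simp add: m_def)
  have "of_nat d * m + m + 1 > 0" using m by (intro add_nonneg_pos) auto
  then have "\<eta> > 0" using \<gamma> by (simp add: \<eta>_def)
  moreover have "shear u v \<epsilon> ` int_span (us @ ws) \<in> unimodular_lattices" if \<epsilon>: "\<bar>\<epsilon>\<bar> < \<eta>" for \<epsilon>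
  proof -
    define A where "A = shear u v \<epsilon>"
    have lin: "linear A" by (simp add: A_def linear_shear)
    have small: "\<bar>\<epsilon>\<bar> * (of_nat d * m + m + 1) \<le> \<gamma> / 2"
      using \<epsilon> \<open>of_nat d * m + m + 1 > 0\<close> by (simp add: \<eta>_def field_simps)
    then have small': "of_nat d * (\<bar>\<epsilon>\<bar> * m) + \<bar>\<epsilon>\<bar> * m + \<bar>\<epsilon>\<bar> \<le> \<gamma> / 2"
      by (simp add: algebra_simps)
    have nn: "0 \<le> of_nat d * (\<bar>\<epsilon>\<bar> * m)" "0 \<le> \<bar>\<epsilon>\<bar> * m" using m by auto
    have small1: "\<bar>\<epsilon>\<bar> * m \<le> 1" and smalld: "of_nat d * (\<bar>\<epsilon>\<bar> * m) \<le> \<gamma> / 2"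
      using small' nn \<gamma>(2) abs_ge_zero[of \<epsilon>] by linarith+
    define \<kappa> where "\<kappa> = 1 - \<bar>\<epsilon>\<bar> * m"
    have \<kappa>: "0 \<le> \<kappa>" "\<kappa> \<le> 1" "\<kappa> * norm x \<le> norm (A x)" for x
      using small1 nn(2) norm_shear_ge[of \<epsilon> u v x] by (auto simp: \<kappa>_def A_def m_def)
    have \<kappa>d: "1 \<le> \<kappa> ^ d * (1 + \<gamma>)"
    proof -
      have "1 + of_nat d * (- (\<bar>\<epsilon>\<bar> * m)) \<le> (1 + - (\<bar>\<epsilon>\<bar> * m)) ^ d"
        using small1 by (intro Bernoulli_inequality) auto
      then have "1 - \<gamma> / 2 \<le> \<kappa> ^ d"
        using smalld by (simp add: \<kappa>_def)
      then have "(1 - \<gamma> / 2) * (1 + \<gamma>) \<le> \<kappa> ^ d * (1 + \<gamma>)"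
        using \<gamma>(1) by (intro mult_right_mono) auto
      moreover have "1 \<le> (1 - \<gamma> / 2) * (1 + \<gamma>)"
        using mult_left_mono[OF \<gamma>(2), of \<gamma>] \<gamma>(1) by (simp add: algebra_simps)
      ultimately show ?thesis by linarith
    qed
    have volA: "vol (map A ws) = 1"
      unfolding A_def using vol_shear[of ws u v \<epsilon>] uv vol(2) by simp
    have Asp: "A x \<in> span (set ws)" if "x \<in> span (set ws)" for x
      unfolding A_def shear_def using that uv by (intro span_add span_scale)
    have Mspan: "M \<subseteq> span (set ws)" by (simp add: M_def int_span_subset_span)
    have "semistable (A ` M)"
      unfolding semistable_def
    proof (intro allI impI)
      fix ys assume "set ys \<subseteq> A ` M"
      then have "\<exists>xs. set xs \<subseteq> M \<and> ys = map A xs"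
      proof (induction ys)
        case (Cons y ys)
        then obtain xs x where "set xs \<subseteq> M" "ys = map A xs" "x \<in> M" "y = A x" by auto
        then show ?case by (intro exI[of _ "x # xs"]) auto
      qed simp
      then obtain xs where xs: "set xs \<subseteq> M" "ys = map A xs" by blast
      show "vol ys = 0 \<or> 1 \<le> vol ys"
      proof (cases "vol ys = 0 \<or> xs = []")
        case True
        then show ?thesis using xs(2) by auto
      next
        case False
        then have "vol (map A xs) > 0" using vol_nonneg[of "map A xs"] xs(2) by (simp add: less_le)
        then have pos: "vol xs > 0" by (rule vol_map_pos[OF lin])
        have "length xs \<le> d"
        proof -
          have "card (set xs) \<le> dim (span (set ws))"
            using pos xs(1) Mspan by (intro independent_card_le_dim) (auto simp: vol_pos_iff)
          moreover have "dim (span (set ws)) \<le> d"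
            by (metis d_def card_length dim_le_card dim_span finite_set order_trans span_superset)
          ultimately show ?thesis using pos by (simp add: vol_pos_iff distinct_card)
        qed
        then consider "length xs < d" | "length xs = d" by linarith
        then show ?thesis
        proof cases
          case 1
          have "1 \<le> \<kappa> ^ d * (1 + \<gamma>)" by (rule \<kappa>d)
          also have "\<dots> \<le> \<kappa> ^ length xs * vol xs"
            using 1 \<kappa> \<gamma> xs(1) False pos
            by (intro mult_mono power_decreasing \<gamma>(3)) auto
          also have "\<dots> \<le> vol (map A xs)" by (rule vol_map_ge[OF lin \<kappa>(1,3)])
          finally show ?thesis using xs(2) by simp
        next
          case 2
          have "vol (map A xs) * vol ws = vol xs * vol (map A ws)"
            using 2 xs(1) Mspan by (intro vol_map_ratio lin) (auto simp: d_def)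
          then have "vol ys = vol xs" using volA vol(2) xs(2) by simp
          then show ?thesis using semistableD[OF ssM(1) xs(1) pos] by simp
        qed
      qed
    qed
    note ssA = this
    have "A x = x" if "x \<in> int_span us" for x
      using orthspan[OF that uv(2)] by (simp add: A_def shear_def)
    then have map_us: "map A us = us"
      using set_subset_int_span[of us] by (intro map_idI) auto
    have eq: "A ` int_span (us @ ws) = int_span (us @ map A ws)"
      using int_span_map[OF lin, of "us @ ws"] map_us by simp
    have eq2: "int_span (us @ map A ws) = {x + y | x y. x \<in> int_span us \<and> y \<in> A ` M}"
      by (simp add: int_span_append int_span_map[OF lin] M_def)
    have "semistable (int_span (us @ map A ws))"
      unfolding eq2
    proof (rule semistable_orthogonal_sum[OF additive_subgroup_int_span _ ssM(2) ssA])
      show "additive_subgroup (A ` M)"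
        by (simp add: M_def int_span_map[OF lin, symmetric] additive_subgroup_int_span)
      fix x y assume "x \<in> int_span us" "y \<in> A ` M"
      then show "inner x y = 0" using orthspan Asp Mspan by blast
    qed
    moreover have "vol (us @ map A ws) = 1"
    proof -
      have "inner x y = 0" if "x \<in> set us" "y \<in> set (map A ws)" for x y
      proof -
        have "y \<in> span (set ws)" using that(2) Asp by (auto simp: span_base)
        moreover have "x \<in> int_span us" using that(1) set_subset_int_span by blast
        ultimately show ?thesis by (intro orthspan)
      qed
      then have "vol (us @ map A ws) = vol us * vol (map A ws)"
        by (rule vol_orthogonal_append)
      then show ?thesis using vol(1) volA by simp
    qed
    ultimately show ?thesis
      using len unfolding unimodular_lattices_def A_def[symmetric] eq by auto
  qed
  ultimately show ?thesis using that by blast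
qed

text \<open>The family of shears used below is isotropic: averaging the second variation over it yields
  a multiple of the second variation of the Laplacian.\<close>
lemma isotropic_sums:
  fixes x :: "'e \<Rightarrow> real"
  assumes fin: "finite E" and d: "d = real (card E)" "d > 0"
  defines "r \<equiv> \<Sum>e\<in>E. (x e)\<^sup>2" and "P \<equiv> {(e, f). e \<in> E \<and> f \<in> E \<and> e \<noteq> f}"
  shows "(\<Sum>(e, f)\<in>P. (x e * x f)\<^sup>2 + ((x e)\<^sup>2 - (x f)\<^sup>2)\<^sup>2 / (2 * d)) = (1 - 1 / d) * r\<^sup>2"
    and "(\<Sum>(e, f)\<in>P. (x f)\<^sup>2 + ((x e)\<^sup>2 + (x f)\<^sup>2) / d) = (d - 1) * (1 + 2 / d) * r"
proof -
  \<comment> \<open>The sum of fourth powers is not a function of the norm. Leaving out the diagonal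
    subtracts \<open>Q\<close>, and the weight \<open>1 / (2 * d)\<close> is the one that adds it
    back.\<close>
  define Q where "Q = (\<Sum>e\<in>E. (x e) ^ 4)"
  have split: "(\<Sum>(e, f)\<in>P. F e f) = (\<Sum>e\<in>E. \<Sum>f\<in>E. F e f) - (\<Sum>e\<in>E. F e e)" for F :: "'e \<Rightarrow> 'e \<Rightarrow> real"
  proof -
    have EE: "E \<times> E = P \<union> (\<lambda>e. (e, e)) ` E" "P \<inter> (\<lambda>e. (e, e)) ` E = {}"
      by (auto simp: P_def)
    have "finite P" using fin by (intro finite_subset[of P "E \<times> E"]) (auto simp: P_def)
    then have "(\<Sum>(e, f)\<in>E \<times> E. F e f) = (\<Sum>(e, f)\<in>P. F e f) + (\<Sum>(e, f)\<in>(\<lambda>e. (e, e)) ` E. F e f)"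
      using fin EE by (simp add: sum.union_disjoint)
    moreover have "(\<Sum>(e, f)\<in>(\<lambda>e. (e, e)) ` E. F e f) = (\<Sum>e\<in>E. F e e)"
      by (subst sum.reindex) (auto intro!: inj_onI)
    ultimately show ?thesis by (simp add: sum.cartesian_product)
  qed
  have p4: "y ^ 4 = (y\<^sup>2)\<^sup>2" for y :: real by simp
  have 1: "(\<Sum>e\<in>E. \<Sum>f\<in>E. (x e * x f)\<^sup>2) = r\<^sup>2"
    by (simp add: r_def power_mult_distrib power2_eq_square[of "sum _ _"] sum_product)
  have 2: "(\<Sum>e\<in>E. \<Sum>f\<in>E. ((x e)\<^sup>2 - (x f)\<^sup>2)\<^sup>2) = 2 * d * Q - 2 * r\<^sup>2"
  proof -
    have "((x e)\<^sup>2 - (x f)\<^sup>2)\<^sup>2 = (x e) ^ 4 + (x f) ^ 4 - 2 * (x e * x f)\<^sup>2" for e f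
      by (simp add: power2_eq_square eval_nat_numeral algebra_simps)
    then show ?thesis
      by (simp add: sum.distrib sum_subtractf sum_distrib_left[symmetric] 1 Q_def d)
  qed
  have 3: "(\<Sum>e\<in>E. \<Sum>f\<in>E. (x e)\<^sup>2) = d * r" "(\<Sum>e\<in>E. \<Sum>f\<in>E. (x f)\<^sup>2) = d * r"
    by (simp_all add: r_def d sum_distrib_left)
  have 4: "(\<Sum>e\<in>E. (x e * x e)\<^sup>2) = Q"
    by (simp add: Q_def power2_eq_square eval_nat_numeral mult_ac)
  show "(\<Sum>(e, f)\<in>P. (x e * x f)\<^sup>2 + ((x e)\<^sup>2 - (x f)\<^sup>2)\<^sup>2 / (2 * d)) = (1 - 1 / d) * r\<^sup>2"
  proof -
    have a: "(\<Sum>e\<in>E. \<Sum>f\<in>E. (x e * x f)\<^sup>2 + ((x e)\<^sup>2 - (x f)\<^sup>2)\<^sup>2 / (2 * d)) = r\<^sup>2 + (2 * d * Q - 2 * r\<^sup>2) / (2 * d)"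
      by (simp only: sum.distrib sum_divide_distrib[symmetric] 1 2)
    have b: "(\<Sum>e\<in>E. (x e * x e)\<^sup>2 + ((x e)\<^sup>2 - (x e)\<^sup>2)\<^sup>2 / (2 * d)) = Q"
      using 4 by simp
    show ?thesis unfolding split a b using d(2) by (simp add: field_simps)
  qed
  show "(\<Sum>(e, f)\<in>P. (x f)\<^sup>2 + ((x e)\<^sup>2 + (x f)\<^sup>2) / d) = (d - 1) * (1 + 2 / d) * r"
  proof -
    have a: "(\<Sum>e\<in>E. \<Sum>f\<in>E. (x f)\<^sup>2 + ((x e)\<^sup>2 + (x f)\<^sup>2) / d) = d * r + (d * r + d * r) / d"
      by (simp only: sum.distrib sum_divide_distrib[symmetric] 3)
    have b: "(\<Sum>e\<in>E. (x e)\<^sup>2 + ((x e)\<^sup>2 + (x e)\<^sup>2) / d) = r + (r + r) / d"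
      by (simp only: sum.distrib sum_divide_distrib[symmetric] r_def)
    show ?thesis unfolding split a b using d(2) by (simp add: field_simps)
  qed
qed

lemma inner_span_eq_0:
  assumes "\<And>a b. a \<in> A \<Longrightarrow> b \<in> B \<Longrightarrow> inner a b = 0" "x \<in> span A" "y \<in> span B"
  shows "inner x y = 0"
proof -
  have 1: "inner a y = 0" if "a \<in> A" for a
    using assms(3) by (induction rule: span_induct_alt) (auto simp: inner_add_right assms(1)[OF that])
  show ?thesis
    using assms(2) by (induction rule: span_induct_alt) (auto simp: inner_add_left 1)
qed

lemma bij_betw_shear:
  assumes "inner u v = 0"
  shows "bij_betw (shear u v \<epsilon>) (L - {0}) (shear u v \<epsilon> ` L - {0})"
proof -
  have inj: "inj (shear u v \<epsilon>)"
    by (rule inj_on_inverseI[where g = "shear u v (- \<epsilon>)"]) (rule shear_inverse[OF assms])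
  have "shear u v \<epsilon> 0 = 0" by (simp add: shear_def)
  then have "shear u v \<epsilon> ` (L - {0}) = shear u v \<epsilon> ` L - {0}"
    by (simp add: image_set_diff[OF inj])
  then show ?thesis
    using inj by (auto simp: bij_betw_def intro: inj_on_subset)
qed

text \<open>Reindexing by the shear turns sums over the sheared lattice into sums over
  \<open>L\<close>; by \<open>norm_shear\<close> they have the shape of
  \<open>second_variation_le_0\<close>, with coefficients bounded by Cauchy-Schwarz.\<close>

lemma shear_second_variation:
  fixes L :: "'a::real_inner set"
  assumes s: "s > 0" and q: "q \<ge> 0" and uv: "inner u v = 0" and L: "zsummable L s q" and \<eta>: "\<eta> > 0"
    and sh: "\<And>\<epsilon>. \<bar>\<epsilon>\<bar> < \<eta> \<Longrightarrow> zsummable (shear u v \<epsilon> ` L) s q \<and> zsum (shear u v \<epsilon> ` L) s q \<le> zsum L s q"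
  defines "X \<equiv> \<lambda>z. q + (norm z)\<^sup>2"
  defines "h \<equiv> \<lambda>z. X z powr (- s) * (4 * s * (s + 1) * (inner z u * inner z v)\<^sup>2 / (X z)\<^sup>2
      - 2 * s * ((inner z v)\<^sup>2 * (norm u)\<^sup>2) / X z)"
  shows "h summable_on (L - {0})" and "infsum h (L - {0}) \<le> 0"
proof -
  define \<kappa> where "\<kappa> = norm u * norm v + (norm u)\<^sup>2 * (norm v)\<^sup>2"
  have \<kappa>: "norm u * norm v \<le> \<kappa>" "(norm u)\<^sup>2 * (norm v)\<^sup>2 \<le> \<kappa>" by (simp_all add: \<kappa>_def)
  have X: "X z > 0" if "z \<noteq> 0" for z using that q by (auto simp: X_def intro!: add_nonneg_pos)
  have kX: "k * (norm z)\<^sup>2 \<le> \<kappa> * X z" if "k \<le> \<kappa>" "0 \<le> k" for k z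
    using that q by (intro mult_mono) (auto simp: X_def)
  have shX: "X z + 2 * \<epsilon> * (inner z u * inner z v) + \<epsilon>\<^sup>2 * ((inner z v)\<^sup>2 * (norm u)\<^sup>2)
      = q + (norm (shear u v \<epsilon> z))\<^sup>2" for z \<epsilon>
    by (simp add: norm_shear X_def)
  have cs: "\<bar>inner z w\<bar> \<le> norm z * norm w" for z w :: 'a by (rule Cauchy_Schwarz_ineq2)
  have g: "(inner z v)\<^sup>2 * (norm u)\<^sup>2 \<le> \<kappa> * X z" for z
  proof -
    have "\<bar>inner z v\<bar>\<^sup>2 \<le> (norm z * norm v)\<^sup>2" using cs by (intro power_mono) auto
    then have "(inner z v)\<^sup>2 * (norm u)\<^sup>2 \<le> (norm z * norm v)\<^sup>2 * (norm u)\<^sup>2"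
      by (intro mult_right_mono) auto
    also have "\<dots> = ((norm u)\<^sup>2 * (norm v)\<^sup>2) * (norm z)\<^sup>2" by (simp add: power_mult_distrib)
    also have "\<dots> \<le> \<kappa> * X z" using \<kappa>(2) by (intro kX) auto
    finally show ?thesis .
  qed
  have c: "\<bar>inner z u * inner z v\<bar> \<le> \<kappa> * X z" for z
  proof -
    have "\<bar>inner z u * inner z v\<bar> \<le> (norm z * norm u) * (norm z * norm v)"
      unfolding abs_mult using cs by (intro mult_mono) auto
    also have "\<dots> = (norm u * norm v) * (norm z)\<^sup>2" by (simp add: power2_eq_square)
    also have "\<dots> \<le> \<kappa> * X z" using \<kappa>(1) by (intro kX) auto
    finally show ?thesis .
  qed
  have summ: "(\<lambda>z. X z powr (- s)) summable_on (L - {0})"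
    using L by (simp add: X_def zsummable_def)
  have nz: "shear u v \<epsilon> z \<noteq> 0" if "z \<noteq> 0" for z \<epsilon>
    using shear_inverse[OF uv, of \<epsilon> z] that by (auto simp: shear_def)
  have pos: "X z + 2 * \<epsilon> * (inner z u * inner z v) + \<epsilon>\<^sup>2 * ((inner z v)\<^sup>2 * (norm u)\<^sup>2) > 0"
    if "z \<in> L - {0}" for z \<epsilon>
    unfolding shX using X[OF nz[of z \<epsilon>]] that by (simp add: X_def)
  have summ': "(\<lambda>z. (X z + 2 * \<epsilon> * (inner z u * inner z v) + \<epsilon>\<^sup>2 * ((inner z v)\<^sup>2 * (norm u)\<^sup>2)) powr (- s)) summable_on (L - {0})"
    and le: "(\<Sum>\<^sub>\<infinity>z\<in>L - {0}. (X z + 2 * \<epsilon> * (inner z u * inner z v) + \<epsilon>\<^sup>2 * ((inner z v)\<^sup>2 * (norm u)\<^sup>2)) powr (- s))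
      \<le> (\<Sum>\<^sub>\<infinity>z\<in>L - {0}. X z powr (- s))" if "\<bar>\<epsilon>\<bar> < \<eta>" for \<epsilon>
    unfolding shX unfolding X_def
    using sh[OF that] summable_on_reindex_bij_betw[OF bij_betw_shear[OF uv], of "\<lambda>z. (q + (norm z)\<^sup>2) powr (- s)" \<epsilon> L]
      infsum_reindex_bij_betw[OF bij_betw_shear[OF uv], of "\<lambda>z. (q + (norm z)\<^sup>2) powr (- s)" \<epsilon> L]
    by (simp_all add: zsummable_def zsum_def)
  have g0: "0 \<le> (inner z v)\<^sup>2 * (norm u)\<^sup>2" for z by simp
  have X': "X z > 0" if "z \<in> L - {0}" for z using X that by simp
  note sv = second_variation_le_0[where p = s and A = "L - {0}" and X = X and \<kappa> = \<kappa> and \<eta> = \<eta>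
      and g = "\<lambda>z. (inner z v)\<^sup>2 * (norm u)\<^sup>2" and c = "\<lambda>z. inner z u * inner z v",
      OF s X' g0 g c summ \<eta> pos summ' le]
  show "h summable_on (L - {0})" "infsum h (L - {0}) \<le> 0"
    unfolding h_def using sv by blast+
qed

text \<open>A lattice maximizing the zeta sum has no indecomposable summand of rank at least two, since some
  shear of the summand increases the sum. For a vector \<open>x\<close> of the summand the averaged second
  variation is controlled by the sum over the orthogonal summand, for which the second moment is
  bounded in terms of its rank.\<close>
lemma maximal_indecomposable_False:
  fixes us ws :: "'a::euclidean_space list"
  defines "L \<equiv> int_span (us @ ws)"
  assumes s: "s > real DIM('a) / 2" and q: "0 \<le> q" "q \<le> (2 * s - real DIM('a)) / (real DIM('a) + 2)"
    and summ: "\<And>L'::'a set. L' \<in> unimodular_lattices \<Longrightarrow> zsummable L' s q"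
    and max: "\<And>L'::'a set. L' \<in> unimodular_lattices \<Longrightarrow> zsum L' s q \<le> zsum L s q"
    and len: "length (us @ ws) = DIM('a)" and ss: "semistable L"
    and vol: "vol us = 1" "vol ws = 1"
    and orth: "\<And>x y. x \<in> set us \<Longrightarrow> y \<in> set ws \<Longrightarrow> inner x y = 0"
    and d2: "length ws \<ge> 2"
    and proper: "\<And>xs. set xs \<subseteq> int_span ws \<Longrightarrow> xs \<noteq> [] \<Longrightarrow> length xs < length ws \<Longrightarrow> vol xs \<noteq> 1"
  shows False
proof -
  have s0: "s > 0" using s by (smt (verit) divide_nonneg_nonneg of_nat_0_le_iff)
  define n where "n = real DIM('a)"
  define d where "d = real (length ws)"
  define m where "m = real (length us)"
  have nmd: "n = m + d" using len by (simp add: n_def m_def d_def flip: of_nat_add)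
  have d: "d \<ge> 2" using d2 by (simp add: d_def)
  have volL: "vol (us @ ws) = 1" using vol_orthogonal_append[OF orth] vol by simp
  have Lmem: "L \<in> unimodular_lattices"
    unfolding unimodular_lattices_def using len volL ss by (auto simp: L_def)
  define M where "M = int_span ws"
  define N where "N = int_span us"
  have grp: "additive_subgroup M" "additive_subgroup N"
    by (simp_all add: M_def N_def additive_subgroup_int_span)
  have L_eq: "L = {x + y | x y. x \<in> M \<and> y \<in> N}"
    unfolding L_def int_span_append M_def N_def by (rule Collect_cong) (metis add.commute)
  have subL: "M \<subseteq> L" "N \<subseteq> L"
    using set_subset_int_span[of "us @ ws"] int_span_subset_iff[of ws "us @ ws"] int_span_subset_iff[of us "us @ ws"]
    by (simp_all add: M_def N_def L_def)
  have MN: "inner x y = 0" if "x \<in> M" "y \<in> N" for x y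
  proof -
    have "x \<in> span (set ws)" "y \<in> span (set us)"
      using that int_span_subset_span unfolding M_def N_def by blast+
    then have "inner y x = 0" by (intro inner_span_eq_0[OF orth])
    then show ?thesis by (simp only: inner_commute)
  qed
  \<comment> \<open>Properness for one-element lists, available since the rank is at least 2. This
    strict inequality is what allows \<open>q\<close> to attain its bound.\<close>
  have Mgt1: "norm x > 1" if x: "x \<in> M" "x \<noteq> 0" for x
  proof -
    have "1 \<le> norm x" using semistable_norm_ge[OF semistable_subset[OF ss subL(1)] x] .
    moreover have "vol [x] \<noteq> 1" using x d2 by (intro proper) (auto simp: M_def)
    ultimately show ?thesis by simp
  qed
  obtain E where E: "E \<subseteq> span (set ws)" "pairwise real_inner_class.orthogonal E" "\<And>e. e \<in> E \<Longrightarrow> norm e = 1"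
    "independent E" "card E = dim (span (set ws))" "span E = span (set ws)"
    using orthonormal_basis_subspace[OF subspace_span[of "set ws"]] by metis
  have finE: "finite E" using E(4) by (rule independent_imp_finite)
  have indws: "independent (set ws)" "distinct ws" "independent (set us)" "distinct us"
    using vol vol_pos_iff[of ws] vol_pos_iff[of us] by auto
  have cardE: "real (card E) = d"
    using E(5) indws by (simp add: d_def dim_eq_card_independent distinct_card)
  have inner_E: "inner e e = 1" if "e \<in> E" for e
    using E(3)[OF that] by (simp add: norm_eq_sqrt_inner)
  have inner_E': "inner e f = 0" if "e \<in> E" "f \<in> E" "e \<noteq> f" for e f
    using E(2) that by (auto simp: pairwise_def real_inner_class.orthogonal_def)
  define X where "X z = q + (norm z)\<^sup>2" for z :: 'a
  define h where "h u v z = X z powr (- s) * (4 * s * (s + 1) * (inner z u * inner z v)\<^sup>2 / (X z)\<^sup>2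
      - 2 * s * ((inner z v)\<^sup>2 * (norm u)\<^sup>2) / X z)" for u v z
  have h: "h u v summable_on (L - {0})" "infsum (h u v) (L - {0}) \<le> 0"
    if uv: "u \<in> span (set ws)" "v \<in> span (set ws)" "inner u v = 0" for u v
  proof -
    obtain \<eta> where \<eta>: "\<eta> > 0" "\<And>\<epsilon>. \<bar>\<epsilon>\<bar> < \<eta> \<Longrightarrow> shear u v \<epsilon> ` int_span (us @ ws) \<in> unimodular_lattices"
      using shear_unimodular[OF len ss[unfolded L_def] vol orth proper uv] by blast
    have "zsummable (shear u v \<epsilon> ` L) s q \<and> zsum (shear u v \<epsilon> ` L) s q \<le> zsum L s q" if "\<bar>\<epsilon>\<bar> < \<eta>" for \<epsilon>
      using summ[OF \<eta>(2)[OF that]] max[OF \<eta>(2)[OF that]] by (simp add: L_def)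
    note sv = shear_second_variation[OF s0 q(1) uv(3) summ[OF Lmem] \<eta>(1) this]
    show "h u v summable_on (L - {0})" "infsum (h u v) (L - {0}) \<le> 0"
      unfolding h_def[abs_def] X_def using sv by simp_all
  qed
  define P where "P = {(e, f). e \<in> E \<and> f \<in> E \<and> e \<noteq> f}"
  have finP: "finite P" using finE by (intro finite_subset[of P "E \<times> E"]) (auto simp: P_def)
  \<comment> \<open>Shears along \<open>e, f\<close> and along the diagonals
    \<open>e + f, e - f\<close>. In the quartic terms the two orders of the diagonals add up to the
    weight \<open>1 / (2 * d)\<close> of \<open>isotropic_sums\<close>; in the quadratic terms their
    squared norm 2 leads to \<open>1 / d\<close>.\<close>
  define H where "H e f z = h e f z + 1 / (4 * d) * (h (e + f) (e - f) z + h (e - f) (e + f) z)" for e f z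
  have Hsum: "\<exists>t\<le>0. (H e f has_sum t) (L - {0})" if "(e, f) \<in> P" for e f
  proof -
    have ef: "e \<in> span (set ws)" "f \<in> span (set ws)" "inner e f = 0" "inner e e = 1" "inner f f = 1"
      using that E(1) inner_E inner_E' by (auto simp: P_def)
    have sp: "e + f \<in> span (set ws)" "e - f \<in> span (set ws)" "inner (e + f) (e - f) = 0" "inner (e - f) (e + f) = 0"
      using ef by (auto simp: span_add span_diff inner_add inner_diff inner_commute)
    note h1 = h[OF ef(1-3)] and h2 = h[OF sp(1,2,3)] and h3 = h[OF sp(2,1,4)]
    have "(H e f has_sum (infsum (h e f) (L - {0}) + 1 / (4 * d) * (infsum (h (e + f) (e - f)) (L - {0})
        + infsum (h (e - f) (e + f)) (L - {0})))) (L - {0})"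
      unfolding H_def using h1(1) h2(1) h3(1)
      by (intro has_sum_add has_sum_cmult_right has_sum_infsum)
    moreover have "1 / (4 * d) * (infsum (h (e + f) (e - f)) (L - {0}) + infsum (h (e - f) (e + f)) (L - {0})) \<le> 0"
      using h2(2) h3(2) d by (intro mult_nonneg_nonpos) auto
    ultimately show ?thesis using h1(2) by (intro exI conjI) auto
  qed
  then obtain t where t: "\<And>i. i \<in> P \<Longrightarrow> t i \<le> 0" "\<And>i. i \<in> P \<Longrightarrow> ((\<lambda>z. case i of (e, f) \<Rightarrow> H e f z) has_sum t i) (L - {0})"
  proof -
    assume *: "\<And>t. (\<And>i. i \<in> P \<Longrightarrow> t i \<le> 0) \<Longrightarrow>
      (\<And>i. i \<in> P \<Longrightarrow> ((\<lambda>z. case i of (e, f) \<Rightarrow> H e f z) has_sum t i) (L - {0})) \<Longrightarrow> thesis"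
    have "\<forall>i\<in>P. \<exists>t\<le>0. ((\<lambda>z. case i of (e, f) \<Rightarrow> H e f z) has_sum t) (L - {0})"
      using Hsum by (auto simp: case_prod_unfold)
    then show thesis using * by metis
  qed
  define r where "r z = (\<Sum>e\<in>E. (inner z e)\<^sup>2)" for z
  \<comment> \<open>Up to the factor \<open>c\<close> this is the sum over all pairs: it depends on
    \<open>z\<close> only through the squared length \<open>r z\<close> of its component in the
    summand and through \<open>X z\<close>. The coefficient \<open>d + 2\<close> is
    \<open>d * (1 + 2 / d)\<close> from \<open>isotropic_sums\<close>.\<close>
  define T where "T z = r z * (2 * (s + 1) * r z * (X z powr (- s) / (X z)\<^sup>2) - (d + 2) * (X z powr (- s) / X z))" for z
  define c where "c = 2 * s * (d - 1) / d"
  have c: "c > 0" using s0 d by (simp add: c_def)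
  have HT: "(\<Sum>(e, f)\<in>P. H e f z) = c * T z" for z
  proof -
    define x where "x e = inner z e" for e
    have 1: "H e f z = X z powr (- s) * (4 * s * (s + 1) / (X z)\<^sup>2 * ((x e * x f)\<^sup>2 + ((x e)\<^sup>2 - (x f)\<^sup>2)\<^sup>2 / (2 * d))
        - 2 * s / X z * ((x f)\<^sup>2 + ((x e)\<^sup>2 + (x f)\<^sup>2) / d))" if "(e, f) \<in> P" for e f
    proof -
      have ef: "inner e f = 0" "inner f e = 0" "inner e e = 1" "inner f f = 1"
        using that inner_E inner_E' by (auto simp: P_def)
      then have nn: "(norm e)\<^sup>2 = 1" "(norm (e + f))\<^sup>2 = 2" "(norm (e - f))\<^sup>2 = 2"
        unfolding power2_norm_eq_inner by (simp_all add: inner_add inner_diff)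
      define A B K where "A = 4 * s * (s + 1) / (X z)\<^sup>2" and "B = 2 * s / X z" and "K = X z powr (- s)"
      have hh: "h u v z = K * (A * (inner z u * inner z v)\<^sup>2 - B * ((inner z v)\<^sup>2 * (norm u)\<^sup>2))" for u v
        by (simp add: h_def A_def B_def K_def)
      have pr: "(x e + x f) * (x e - x f) = (x e)\<^sup>2 - (x f)\<^sup>2" "(x e - x f) * (x e + x f) = (x e)\<^sup>2 - (x f)\<^sup>2"
        by (simp_all add: power2_eq_square algebra_simps)
      have sq: "(x e + x f)\<^sup>2 + (x e - x f)\<^sup>2 = 2 * ((x e)\<^sup>2 + (x f)\<^sup>2)"
        by (simp add: power2_eq_square algebra_simps)
      have "H e f z = K * (A * (x e * x f)\<^sup>2 - B * (x f)\<^sup>2)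
          + 1 / (4 * d) * (K * (A * ((x e)\<^sup>2 - (x f)\<^sup>2)\<^sup>2 - B * ((x e - x f)\<^sup>2 * 2))
            + K * (A * ((x e)\<^sup>2 - (x f)\<^sup>2)\<^sup>2 - B * ((x e + x f)\<^sup>2 * 2)))"
        unfolding H_def hh nn inner_add_right inner_diff_right x_def[symmetric] pr by simp
      also have "\<dots> = K * (A * ((x e * x f)\<^sup>2 + ((x e)\<^sup>2 - (x f)\<^sup>2)\<^sup>2 / (2 * d))
          - B * ((x f)\<^sup>2 + ((x e + x f)\<^sup>2 + (x e - x f)\<^sup>2) / (2 * d)))"
        using d by (simp add: field_simps)
      also have "((x e + x f)\<^sup>2 + (x e - x f)\<^sup>2) / (2 * d) = ((x e)\<^sup>2 + (x f)\<^sup>2) / d"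
        unfolding sq by (rule mult_divide_mult_cancel_left) simp
      finally show ?thesis by (simp add: A_def B_def K_def)
    qed
    have "(\<Sum>(e, f)\<in>P. H e f z) = X z powr (- s) * (4 * s * (s + 1) / (X z)\<^sup>2 * (\<Sum>(e, f)\<in>P. (x e * x f)\<^sup>2 + ((x e)\<^sup>2 - (x f)\<^sup>2)\<^sup>2 / (2 * d))
        - 2 * s / X z * (\<Sum>(e, f)\<in>P. (x f)\<^sup>2 + ((x e)\<^sup>2 + (x f)\<^sup>2) / d))"
      unfolding sum_distrib_left sum_subtractf[symmetric] using 1
      by (intro sum.cong) auto
    also have "\<dots> = X z powr (- s) * (4 * s * (s + 1) / (X z)\<^sup>2 * ((1 - 1 / d) * (r z)\<^sup>2)
        - 2 * s / X z * ((d - 1) * (1 + 2 / d) * r z))"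
      using isotropic_sums[OF finE cardE[symmetric], of x] d by (simp add: P_def r_def x_def)
    also have "\<dots> = c * T z"
    proof -
      have e1: "1 - 1 / d = (d - 1) / d" "1 + 2 / d = (d + 2) / d" using d by (simp_all add: field_simps)
      have "K * (4 * s * (s + 1) / Y * ((d - 1) / d * R\<^sup>2) - 2 * s / Z * ((d - 1) * ((d + 2) / d) * R))
          = 2 * s * (d - 1) / d * (R * (2 * (s + 1) * R * (K / Y) - (d + 2) * (K / Z)))" for K Y Z R :: real
        by (simp add: divide_inverse power2_eq_square algebra_simps)
      then show ?thesis unfolding c_def T_def e1 .
    qed
    finally show ?thesis .
  qed
  have "((\<lambda>z. \<Sum>i\<in>P. case i of (e, f) \<Rightarrow> H e f z) has_sum (\<Sum>i\<in>P. t i)) (L - {0})"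
    by (rule has_sum_finite_sum[OF finP t(2)])
  then have "((\<lambda>z. c * T z) has_sum (\<Sum>i\<in>P. t i)) (L - {0})"
    unfolding HT .
  then have T: "(T has_sum (\<Sum>i\<in>P. t i) / c) (L - {0})"
    using c by (simp add: has_sum_cmult_right_iff)
  have t0: "(\<Sum>i\<in>P. t i) / c \<le> 0"
    using c t(1) by (intro divide_nonpos_pos sum_nonpos)
  \<comment> \<open>Fibres over the summand; the origin is absent from the fibre over 0
    only.\<close>
  define J where "J x = (if x = 0 then N - {0} else N)" for x :: 'a
  have bij: "bij_betw (\<lambda>(x, y). x + y) (Sigma M J) (L - {0})"
    unfolding bij_betw_def
  proof
    have nrm: "(norm (x + y))\<^sup>2 = (norm x)\<^sup>2 + (norm y)\<^sup>2" if "x \<in> M" "y \<in> N" for x y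
      using norm_sq_add_orth MN that by blast
    show "inj_on (\<lambda>(x, y). x + y) (Sigma M J)"
    proof (rule inj_onI, clarify)
      fix x y x' y' assume *: "x \<in> M" "y \<in> J x" "x' \<in> M" "y' \<in> J x'" "x + y = x' + y'"
      then have yN: "y \<in> N" "y' \<in> N" by (auto simp: J_def split: if_splits)
      have "x - x' \<in> M" "y - y' \<in> N"
        using * yN grp by (auto intro: additive_subgroup_diff)
      moreover have "(x - x') + (y - y') = 0" using *(5) by (simp add: algebra_simps)
      ultimately have "(norm (x - x'))\<^sup>2 + (norm (y - y'))\<^sup>2 = 0"
        using nrm[of "x - x'" "y - y'"] by simp
      then show "x = x' \<and> y = y'" by (simp add: sum_power2_eq_zero_iff)
    qed
    have "x + y \<in> L - {0}" if xy: "x \<in> M" "y \<in> J x" for x y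
    proof -
      have yN: "y \<in> N" using xy by (auto simp: J_def split: if_splits)
      have "x + y \<noteq> 0"
      proof
        assume "x + y = 0"
        then have "x = 0 \<and> y = 0" using nrm[OF xy(1) yN] by (simp add: sum_power2_eq_zero_iff)
        then show False using xy by (simp add: J_def)
      qed
      then show ?thesis using xy(1) yN unfolding L_eq by blast
    qed
    moreover have "z \<in> (\<lambda>(x, y). x + y) ` Sigma M J" if z: "z \<in> L - {0}" for z
    proof -
      obtain x y where xy: "x \<in> M" "y \<in> N" "z = x + y" using z unfolding L_eq by blast
      then have "y \<in> J x" using z by (auto simp: J_def)
      then show ?thesis using xy by force
    qed
    ultimately show "(\<lambda>(x, y). x + y) ` Sigma M J = L - {0}" by auto
  qed
  have T2: "((\<lambda>(x, y). T (x + y)) has_sum (\<Sum>i\<in>P. t i) / c) (Sigma M J)"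
    using T has_sum_reindex_bij_betw[OF bij, of T] by (simp add: case_prod_unfold)
  have T3: "((\<lambda>x. \<Sum>\<^sub>\<infinity>y\<in>J x. T (x + y)) has_sum (\<Sum>i\<in>P. t i) / c) M"
    using has_sum_infsum[OF summable_on_Sigma_banach[OF has_sum_imp_summable[OF T2]]]
    by (simp only: infsum_Sigma'_banach[OF has_sum_imp_summable[OF T2]] infsumI[OF T2])
  have rz: "r (x + y) = (norm x)\<^sup>2" "X (x + y) = (q + (norm x)\<^sup>2) + (norm y)\<^sup>2"
    if xy: "x \<in> M" "y \<in> N" for x y
  proof -
    have "x \<in> span E" using xy(1) int_span_subset_span E(6) by (auto simp: M_def)
    then have x: "(\<Sum>e\<in>E. inner x e *\<^sub>R e) = x"
      using orthonormal_basis_expand[OF E(2,3) _ finE] by blast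
    have "inner x (\<Sum>e\<in>E. inner x e *\<^sub>R e) = (\<Sum>e\<in>E. (inner x e)\<^sup>2)"
      by (simp add: inner_sum_right power2_eq_square)
    then have "(\<Sum>e\<in>E. (inner x e)\<^sup>2) = (norm x)\<^sup>2"
      using x by (simp add: power2_norm_eq_inner)
    moreover have "inner y e = 0" if "e \<in> E" for e
    proof -
      have "e \<in> span (set ws)" "y \<in> span (set us)"
        using that E(1) xy(2) int_span_subset_span unfolding N_def by blast+
      then show ?thesis by (intro inner_span_eq_0[OF orth])
    qed
    ultimately show "r (x + y) = (norm x)\<^sup>2" by (simp add: r_def inner_add_left)
    show "X (x + y) = (q + (norm x)\<^sup>2) + (norm y)\<^sup>2"
      using norm_sq_add_orth[OF MN[OF xy]] by (simp add: X_def)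
  qed
  \<comment> \<open>On the fibre over \<open>x\<close> the sum over the complement is a power sum
    with \<open>R = q + \<rho>\<close>, so \<open>power_sum_second_moment\<close> bounds
    \<open>S 2\<close> from below by a multiple of \<open>S 1\<close>.\<close>
  have Tpos: "(\<Sum>\<^sub>\<infinity>y\<in>J x. T (x + y)) > 0" if x: "x \<in> M" "x \<noteq> 0" for x
  proof -
    define \<rho> where "\<rho> = (norm x)\<^sup>2"
    define R where "R = q + \<rho>"
    have \<rho>: "\<rho> > 1" using Mgt1[OF x] by (simp add: \<rho>_def power_less_one_iff one_less_power)
    have R: "R > 0" "R \<ge> q" using \<rho> q(1) by (simp_all add: R_def)
    have sumN: "(\<lambda>y. (R + (norm y)\<^sup>2) powr (- s)) summable_on int_span us"
      using subL(2) by (intro zsummable_imp_summable[OF summ[OF Lmem] _ s0 q(1) R]) (simp add: N_def)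
    define S where "S k = (\<Sum>\<^sub>\<infinity>y\<in>N. (R + (norm y)\<^sup>2) powr (- s - k))" for k
    note psm = power_sum_second_moment[OF s0 R(1) sumN, folded N_def, folded S_def]
    have dimus: "real (dim (set us)) = m"
      using indws by (simp add: m_def dim_eq_card_independent distinct_card)
    have Tsum: "((\<lambda>y. T (x + y)) has_sum \<rho> * (2 * (s + 1) * \<rho> * S 2 - (d + 2) * S 1)) N"
    proof -
      have "((\<lambda>y. \<rho> * (2 * (s + 1) * \<rho> * (R + (norm y)\<^sup>2) powr (- s - 2) - (d + 2) * (R + (norm y)\<^sup>2) powr (- s - 1)))
          has_sum \<rho> * (2 * (s + 1) * \<rho> * S 2 - (d + 2) * S 1)) N"
        unfolding S_def using psm(1,2)
        by (intro has_sum_cmult_right has_sum_difference has_sum_infsum)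
      then show ?thesis
      proof (rule has_sum_cong[THEN iffD1, rotated])
        fix y assume y: "y \<in> N"
        have Xp: "R + (norm y)\<^sup>2 > 0" using R by (intro add_pos_nonneg) auto
        have "X (x + y) = R + (norm y)\<^sup>2" "r (x + y) = \<rho>"
          using rz[OF x(1) y] by (simp_all add: R_def \<rho>_def)
        then show "\<rho> * (2 * (s + 1) * \<rho> * (R + (norm y)\<^sup>2) powr (- s - 2) - (d + 2) * (R + (norm y)\<^sup>2) powr (- s - 1)) = T (x + y)"
          using Xp by (simp add: T_def powr_diff)
      qed
    qed
    have S1: "S 1 > 0"
    proof -
      have "(R + (norm (0::'a))\<^sup>2) powr (- s - 1) \<le> S 1"
        using finite_sum_le_infsum[OF psm(1), of "{0}"] additive_subgroup_0[OF grp(2)] by (simp add: S_def)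
      moreover have "(R + (norm (0::'a))\<^sup>2) powr (- s - 1) > 0" using R by simp
      ultimately show ?thesis by linarith
    qed
    have "(2 * s + 2 - m) * S 1 \<le> 2 * (s + 1) * R * S 2"
      using psm(3) dimus by simp
    then have "\<rho> * ((2 * s + 2 - m) * S 1) \<le> R * (2 * (s + 1) * \<rho> * S 2)"
      using mult_left_mono[of _ _ \<rho>] \<rho> by (simp add: mult_ac)
    \<comment> \<open>Cancelling \<open>\<rho> * (d + 2)\<close> leaves
      \<open>q * (d + 2) < \<rho> * (2 * s - n)\<close>; here the bound on \<open>q\<close> enters,
      with \<open>d \<le> n\<close> and \<open>\<rho> > 1\<close>.\<close>
    moreover have "R * ((d + 2) * S 1) < \<rho> * ((2 * s + 2 - m) * S 1)"
    proof -
      have "q * (d + 2) \<le> q * (n + 2)" using q(1) nmd by (intro mult_left_mono) (auto simp: m_def)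
      also have "\<dots> \<le> 2 * s - n"
        using q(2) by (simp add: n_def pos_le_divide_eq add_nonneg_pos)
      also have "\<dots> < \<rho> * (2 * s - n)" using s \<rho> by (simp add: n_def)
      finally have "R * (d + 2) < \<rho> * (2 * s + 2 - m)"
        by (simp add: R_def nmd algebra_simps)
      then have "R * (d + 2) * S 1 < \<rho> * (2 * s + 2 - m) * S 1" using S1 by (rule mult_strict_right_mono)
      then show ?thesis by (simp add: mult_ac)
    qed
    ultimately have "R * ((d + 2) * S 1) < R * (2 * (s + 1) * \<rho> * S 2)" by linarith
    then have "(d + 2) * S 1 < 2 * (s + 1) * \<rho> * S 2" using R(1) by (simp add: mult_less_cancel_left_pos)
    then have "\<rho> * (2 * (s + 1) * \<rho> * S 2 - (d + 2) * S 1) > 0" using \<rho> by simp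
    then show ?thesis using infsumI[OF Tsum] x(2) by (simp add: J_def)
  qed
  have Tzero: "(\<Sum>\<^sub>\<infinity>y\<in>J 0. T (0 + y)) = 0"
  proof (rule infsum_0)
    fix y assume "y \<in> J 0"
    then have "r (0 + y) = (norm (0::'a))\<^sup>2"
      using additive_subgroup_0[OF grp(1)] by (intro rz) (auto simp: J_def)
    then show "T (0 + y) = 0" by (simp add: T_def)
  qed
  have nonneg: "0 \<le> (\<Sum>\<^sub>\<infinity>y\<in>J x. T (x + y))" if "x \<in> M" for x
    using Tpos[OF that] Tzero by (cases "x = 0") (auto simp: less_imp_le)
  obtain w where w: "w \<in> set ws" using d2 by (cases ws) auto
  have "w \<in> M" using w set_subset_int_span unfolding M_def by blast
  moreover have "w \<noteq> 0" using w indws(1) dependent_zero by blast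
  ultimately have "(\<Sum>\<^sub>\<infinity>y\<in>J w. T (w + y)) > 0" by (rule Tpos)
  \<comment> \<open>All fibre sums are nonnegative and the one over \<open>w\<close> is positive,
    whereas maximality bounds their total by 0.\<close>
  then have "0 < (\<Sum>i\<in>P. t i) / c"
    using nonneg \<open>w \<in> M\<close> by (intro has_sum_strict_mono[OF _ T3, of "\<lambda>_. 0" 0 w]) auto
  then show False using t0 by linarith
qed

section \<open>Compactness and existence of a maximum\<close>

lemma summable_int_powr:
  fixes a :: real
  assumes a: "a > 1/2"
  shows "(\<lambda>k::int. (1 + (of_int k)\<^sup>2) powr (- a)) summable_on UNIV"
proof -
  let ?f = "\<lambda>k::int. (1 + (real_of_int k)\<^sup>2) powr (- a)"
  have "summable (\<lambda>n. ?f (int n))"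
  proof (rule summable_comparison_test')
    show "summable (\<lambda>n. of_nat n powr (- 2 * a) :: real)"
      using a by (simp add: summable_real_powr_iff)
    fix n :: nat assume n: "n \<ge> 1"
    have "(1 + (real n)\<^sup>2) powr (- a) \<le> ((real n)\<^sup>2) powr (- a)"
      using a n by (intro powr_mono2') auto
    also have "\<dots> = real n powr (- 2 * a)"
      using n by (simp add: powr_powr flip: powr_numeral)
    finally show "norm (?f (int n)) \<le> of_nat n powr (- 2 * a)" by simp
  qed
  then have nat: "(\<lambda>n. ?f (int n)) summable_on UNIV"
    by (rule summable_nonneg_imp_summable_on) simp
  have "?f summable_on range int"
    using nat by (subst summable_on_reindex) (auto simp: o_def)
  moreover have "?f summable_on range (\<lambda>n. - int n)"
    using nat by (subst summable_on_reindex) (auto simp: o_def inj_on_def)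
  ultimately have "?f summable_on (range int \<union> range (\<lambda>n. - int n))"
    by (rule summable_on_union)
  moreover have "range int \<union> range (\<lambda>n. - int n) = UNIV"
  proof -
    have "k \<in> range int \<union> range (\<lambda>n. - int n)" for k
      by (cases k rule: int_cases2) auto
    then show ?thesis by auto
  qed
  ultimately show ?thesis by simp
qed

text \<open>Each \<open>1 + (z i)\<^sup>2\<close> is at most the full base, so distributing the
  exponent evenly bounds the term by a product of one-dimensional ones with exponent
  \<open>s / n > 1/2\<close>.\<close>

lemma summable_lattice_powr:
  fixes s :: real
  assumes s: "s > real CARD('n) / 2"
  shows "(\<lambda>z::'n::finite \<Rightarrow> int. (1 + (\<Sum>i\<in>UNIV. (of_int (z i))\<^sup>2)) powr (- s)) summable_on UNIV"
proof (rule summable_on_comparison_test)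
  define n where "n = real CARD('n)"
  have n: "n > 0" by (simp add: n_def)
  have s0: "s > 0" using s n by (simp add: n_def)
  let ?f = "\<lambda>k::int. (1 + (real_of_int k)\<^sup>2) powr (- (s / n))"
  have "s / n > 1/2" using s n by (simp add: n_def field_simps)
  then have "?f summable_on UNIV" by (rule summable_int_powr)
  then have "Infinite_Sum.abs_summable_on ?f UNIV" by simp
  then have "Infinite_Set_Sum.abs_summable_on ?f UNIV" by (simp only: abs_summable_equivalent)
  then have "Infinite_Set_Sum.abs_summable_on (\<lambda>z::'n \<Rightarrow> int. \<Prod>i\<in>UNIV. ?f (z i)) (PiE UNIV (\<lambda>_. UNIV))"
    by (intro abs_summable_on_prod_PiE) auto
  then have "Infinite_Sum.abs_summable_on (\<lambda>z::'n \<Rightarrow> int. \<Prod>i\<in>UNIV. ?f (z i)) UNIV"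
    by (simp only: abs_summable_equivalent PiE_UNIV)
  then show "(\<lambda>z::'n \<Rightarrow> int. \<Prod>i\<in>UNIV. ?f (z i)) summable_on UNIV"
    by (rule abs_summable_summable)
  fix z :: "'n \<Rightarrow> int"
  define Y where "Y = 1 + (\<Sum>i\<in>UNIV. (real_of_int (z i))\<^sup>2)"
  have Y: "Y \<ge> 1" by (simp add: Y_def sum_nonneg)
  have "Y powr (- s) = (Y powr (- (s / n))) ^ CARD('n)"
    using Y n by (simp add: powr_realpow[symmetric] powr_powr n_def)
  also have "\<dots> = (\<Prod>i\<in>(UNIV::'n set). Y powr (- (s / n)))" by simp
  also have "\<dots> \<le> (\<Prod>i\<in>UNIV. ?f (z i))"
  proof (rule prod_mono)
    fix i :: 'n
    have "(real_of_int (z i))\<^sup>2 \<le> (\<Sum>i\<in>UNIV. (real_of_int (z i))\<^sup>2)"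
      by (rule member_le_sum) auto
    then show "0 \<le> Y powr (- (s / n)) \<and> Y powr (- (s / n)) \<le> ?f (z i)"
      using s0 n by (auto simp: Y_def intro!: powr_mono2' add_pos_nonneg)
  qed
  finally show "(1 + (\<Sum>i\<in>UNIV. (of_int (z i))\<^sup>2)) powr (- s) \<le> (\<Prod>i\<in>UNIV. ?f (z i))"
    by (simp only: Y_def)
qed simp

section \<open>Lattices as matrices of basis vectors\<close>

definition idx_list :: "'n::finite list" where
  "idx_list = (SOME xs. distinct xs \<and> set xs = UNIV)"

lemma idx_list: "distinct (idx_list :: 'n::finite list)" "set (idx_list :: 'n list) = UNIV"
  and length_idx_list: "length (idx_list :: 'n list) = CARD('n)"
proof -
  have "\<exists>xs :: 'n list. distinct xs \<and> set xs = UNIV"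
    using finite_distinct_list[of "UNIV :: 'n set"] by auto
  then have "distinct (idx_list :: 'n list) \<and> set (idx_list :: 'n list) = UNIV"
    unfolding idx_list_def by (rule someI_ex)
  then show "distinct (idx_list :: 'n list)" "set (idx_list :: 'n list) = UNIV" by auto
  then show "length (idx_list :: 'n list) = CARD('n)" by (metis distinct_card)
qed

text \<open>Matrices carry the topology in which bases form a compact set, while volumes live on
  lists; this is the translation.\<close>

definition rows_list :: "'a ^ 'n \<Rightarrow> 'a list" where
  "rows_list b = map (($) b) idx_list"

definition row_comb :: "'a::real_vector ^ 'n \<Rightarrow> ('n \<Rightarrow> real) \<Rightarrow> 'a" where
  "row_comb b x = (\<Sum>i\<in>UNIV. x i *\<^sub>R b $ i)"

lemma length_rows_list [simp]: "length (rows_list (b :: 'a ^ 'n)) = CARD('n)"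
  by (simp add: rows_list_def length_idx_list)

lemma bij_betw_idx: "bij_betw (nth (idx_list :: 'n::finite list)) {..<CARD('n)} UNIV"
  by (rule bij_betw_nth) (simp_all add: idx_list length_idx_list)

lemma sum_rows_list:
  fixes b :: "'a::real_vector ^ 'n"
  shows "(\<Sum>k<length (rows_list b). x (idx_list ! k) *\<^sub>R rows_list b ! k) = row_comb b x"
proof -
  have "(\<Sum>k<CARD('n). x (idx_list ! k) *\<^sub>R b $ (idx_list ! k)) = row_comb b x"
    unfolding row_comb_def by (rule sum.reindex_bij_betw[OF bij_betw_idx])
  then show ?thesis by (simp add: rows_list_def length_idx_list)
qed

lemma int_span_rows_list:
  fixes b :: "'a::real_vector ^ 'n"
  shows "int_span (rows_list b) = range (\<lambda>z. row_comb b (\<lambda>i. of_int (z i)))"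
proof
  show "range (\<lambda>z. row_comb b (\<lambda>i. of_int (z i))) \<subseteq> int_span (rows_list b)"
    unfolding int_span_def sum_rows_list[symmetric] by auto
  show "int_span (rows_list b) \<subseteq> range (\<lambda>z. row_comb b (\<lambda>i. of_int (z i)))"
  proof
    fix x assume "x \<in> int_span (rows_list b)"
    then obtain c :: "nat \<Rightarrow> int" where x: "x = (\<Sum>k<length (rows_list b). of_int (c k) *\<^sub>R rows_list b ! k)"
      unfolding int_span_def by blast
    define j where "j = the_inv_into {..<CARD('n)} (nth (idx_list :: 'n list))"
    have "j (idx_list ! k) = k" if "k < CARD('n)" for k
      unfolding j_def using bij_betw_idx that by (intro the_inv_into_f_f) (auto simp: bij_betw_def)
    then have "x = (\<Sum>k<length (rows_list b). of_int (c (j (idx_list ! k))) *\<^sub>R rows_list b ! k)"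
      unfolding x by (intro sum.cong) auto
    also have "\<dots> = row_comb b (\<lambda>i. of_int (c (j i)))"
      by (rule sum_rows_list[of "\<lambda>i. of_int (c (j i))"])
    finally show "x \<in> range (\<lambda>z. row_comb b (\<lambda>i. of_int (z i)))"
      by (intro image_eqI[of _ _ "\<lambda>i. c (j i)"]) auto
  qed
qed

lemma rows_list_surj:
  assumes "length vs = CARD('n)"
  obtains b :: "'a ^ 'n" where "rows_list b = vs"
proof
  define j where "j = the_inv_into {..<CARD('n)} (nth (idx_list :: 'n list))"
  have j: "j (idx_list ! k) = k" if "k < CARD('n)" for k
    unfolding j_def using bij_betw_idx that by (intro the_inv_into_f_f) (auto simp: bij_betw_def)
  show "rows_list (\<chi> i. vs ! j i :: 'a ^ 'n) = vs"
    by (rule nth_equalityI) (use assms j in \<open>auto simp: rows_list_def length_idx_list\<close>)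
qed

lemma row_comb_eq_0:
  fixes b :: "'a::euclidean_space ^ 'n"
  assumes "vol (rows_list b) > 0" "row_comb b x = 0"
  shows "x i = 0"
proof -
  have "i \<in> set idx_list" by (simp add: idx_list)
  then obtain k where k: "k < CARD('n)" "i = idx_list ! k"
    unfolding in_set_conv_nth length_idx_list by blast
  have "(\<Sum>k<length (rows_list b). x (idx_list ! k) *\<^sub>R rows_list b ! k) = 0"
    using assms(2) by (simp only: sum_rows_list)
  from independent_sum_eq_0[OF assms(1) this, of k] k show ?thesis by simp
qed

lemma row_comb_scale: "row_comb b (\<lambda>i. k * x i) = k *\<^sub>R row_comb b x"
  by (simp add: row_comb_def scaleR_sum_right)

text \<open>Independence made uniform: the norm of a combination has a positive minimum over the
  bases in \<open>K\<close> and the unit coefficient vectors, and homogeneity extends the bound to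
  all coefficients.\<close>

lemma row_comb_lower_bound:
  fixes K :: "('a::euclidean_space ^ 'n) set"
  assumes K: "compact K" "K \<noteq> {}" and pos: "\<And>b. b \<in> K \<Longrightarrow> vol (rows_list b) > 0"
  obtains c where "c > 0" "\<And>b x. b \<in> K \<Longrightarrow> c * (\<Sum>i\<in>UNIV. (x i)\<^sup>2) \<le> (norm (row_comb b x))\<^sup>2"
proof -
  define F where "F = (\<lambda>(b :: 'a ^ 'n, x :: real ^ 'n). norm (row_comb b (($) x)))"
  have "compact (K \<times> sphere (0 :: real ^ 'n) 1)" using K(1) by (intro compact_Times compact_sphere)
  moreover have "K \<times> sphere (0 :: real ^ 'n) 1 \<noteq> {}" using K(2) by simp
  moreover have "continuous_on (K \<times> sphere (0 :: real ^ 'n) 1) F"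
    unfolding F_def row_comb_def case_prod_unfold by (intro continuous_intros)
  ultimately obtain p where p: "p \<in> K \<times> sphere (0 :: real ^ 'n) 1"
    "\<forall>y\<in>K \<times> sphere (0 :: real ^ 'n) 1. F p \<le> F y"
    using continuous_attains_inf by blast
  obtain b0 x0 where bx: "p = (b0, x0)" "b0 \<in> K" "norm x0 = 1" using p(1) by auto
  have Fp: "F p > 0"
  proof -
    have "row_comb b0 (($) x0) \<noteq> 0"
    proof
      assume "row_comb b0 (($) x0) = 0"
      then have "x0 $ i = 0" for i using row_comb_eq_0[OF pos[OF bx(2)]] by blast
      then have "x0 = 0" by (simp add: Finite_Cartesian_Product.vec_eq_iff)
      then show False using bx(3) by simp
    qed
    then show ?thesis by (simp add: F_def bx)
  qed
  have "(F p)\<^sup>2 * (\<Sum>i\<in>UNIV. (x i)\<^sup>2) \<le> (norm (row_comb b x))\<^sup>2" if b: "b \<in> K" for b x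
  proof -
    define y :: "real ^ 'n" where "y = (\<chi> i. x i)"
    have ny: "(norm y)\<^sup>2 = (\<Sum>i\<in>UNIV. (x i)\<^sup>2)"
      by (simp add: y_def norm_vec_def L2_set_def sum_nonneg)
    show ?thesis
    proof (cases "y = 0")
      case True
      then have "(\<Sum>i\<in>UNIV. (x i)\<^sup>2) = 0" using ny by simp
      then show ?thesis by simp
    next
      case False
      define u where "u = y /\<^sub>R norm y"
      have "F p \<le> F (b, u)" using p(2) b False by (simp add: u_def)
      moreover have "F (b, u) = norm (row_comb b x) / norm y"
      proof -
        have "row_comb b (($) u) = row_comb b (\<lambda>i. inverse (norm y) * x i)"
          by (simp add: row_comb_def u_def y_def)
        also have "\<dots> = inverse (norm y) *\<^sub>R row_comb b x" by (rule row_comb_scale)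
        finally show ?thesis by (simp add: F_def divide_inverse mult.commute)
      qed
      ultimately have "F p * norm y \<le> norm (row_comb b x)"
        using False by (simp add: pos_le_divide_eq)
      then have "(F p * norm y)\<^sup>2 \<le> (norm (row_comb b x))\<^sup>2"
        using Fp by (intro power_mono) auto
      then show ?thesis by (simp add: power_mult_distrib ny)
    qed
  qed
  then show ?thesis using that[of "(F p)\<^sup>2"] Fp by simp
qed

text \<open>Summing over coefficient vectors gives an index set common to all bases, so the zeta sum
  becomes a function of the matrix \<open>b\<close>.\<close>

lemma zsum_row_comb:
  fixes b :: "'a::euclidean_space ^ 'n" and s q :: real
  assumes pos: "vol (rows_list b) > 0"
  defines "f \<equiv> \<lambda>z. (q + (norm (row_comb b (\<lambda>i. of_int (z i))))\<^sup>2) powr (- s)"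
  shows "zsum (int_span (rows_list b)) s q = (\<Sum>\<^sub>\<infinity>z\<in>UNIV - {\<lambda>_. 0}. f z)"
    and "zsummable (int_span (rows_list b)) s q \<longleftrightarrow> f summable_on (UNIV - {\<lambda>_. 0})"
proof -
  let ?\<phi> = "\<lambda>z::'n \<Rightarrow> int. row_comb b (\<lambda>i. of_int (z i))"
  have inj: "inj ?\<phi>"
  proof (rule injI)
    fix z w :: "'n \<Rightarrow> int" assume "?\<phi> z = ?\<phi> w"
    then have "row_comb b (\<lambda>i. of_int (z i) - of_int (w i)) = 0"
      by (simp add: row_comb_def scaleR_diff_left sum_subtractf)
    then have "of_int (z i) - of_int (w i) = (0::real)" for i
      using row_comb_eq_0[OF pos] by blast
    then show "z = w" by auto
  qed
  have "?\<phi> (\<lambda>_. 0) = 0" by (simp add: row_comb_def)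
  then have "?\<phi> ` (UNIV - {\<lambda>_. 0}) = range ?\<phi> - {0}"
    by (simp add: image_set_diff[OF inj])
  then have bij: "bij_betw ?\<phi> (UNIV - {\<lambda>_. 0}) (int_span (rows_list b) - {0})"
    using inj by (auto simp: bij_betw_def int_span_rows_list intro: inj_on_subset)
  show "zsum (int_span (rows_list b)) s q = (\<Sum>\<^sub>\<infinity>z\<in>UNIV - {\<lambda>_. 0}. f z)"
    unfolding zsum_def f_def
    by (rule infsum_reindex_bij_betw[OF bij, of "\<lambda>x. (q + (norm x)\<^sup>2) powr (- s)", symmetric])
  show "zsummable (int_span (rows_list b)) s q \<longleftrightarrow> f summable_on (UNIV - {\<lambda>_. 0})"
    unfolding zsummable_def f_def
    by (rule summable_on_reindex_bij_betw[OF bij, of "\<lambda>x. (q + (norm x)\<^sup>2) powr (- s)", symmetric])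
qed

text \<open>A summable bound for all bases in \<open>K\<close> at once. A nonzero integer vector has
  squared norm at least 1, so \<open>Y z\<close> is at most twice its sum of squares; this is the
  origin of \<open>c / 2\<close> and covers \<open>q = 0\<close>.\<close>

lemma zsum_majorant:
  fixes K :: "('a::euclidean_space ^ 'n) set"
  assumes K: "compact K" "K \<noteq> {}" and pos: "\<And>b. b \<in> K \<Longrightarrow> vol (rows_list b) > 0"
    and s: "s > real CARD('n) / 2" and q: "q \<ge> 0"
  obtains B where "B summable_on (UNIV - {\<lambda>_. 0})"
    "\<And>b z. b \<in> K \<Longrightarrow> z \<noteq> (\<lambda>_. 0) \<Longrightarrow> 0 < q + (norm (row_comb b (\<lambda>i. of_int (z i :: int))))\<^sup>2
      \<and> (q + (norm (row_comb b (\<lambda>i. of_int (z i))))\<^sup>2) powr (- s) \<le> B z"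
proof -
  have s0: "s > 0" using s by (smt (verit) divide_nonneg_nonneg of_nat_0_le_iff)
  obtain c where c: "c > 0" "\<And>b x. b \<in> K \<Longrightarrow> c * (\<Sum>i\<in>UNIV. (x i)\<^sup>2) \<le> (norm (row_comb b x))\<^sup>2"
    using row_comb_lower_bound[OF K pos] by blast
  define Y where "Y z = 1 + (\<Sum>i\<in>UNIV. (real_of_int (z i))\<^sup>2)" for z :: "'n \<Rightarrow> int"
  define B where "B z = (c / 2) powr (- s) * Y z powr (- s)" for z
  have "B summable_on UNIV"
    unfolding B_def Y_def by (intro summable_on_cmult_right summable_lattice_powr s)
  then have "B summable_on (UNIV - {\<lambda>_. 0})" by (rule summable_on_subset) simp
  moreover have "0 < q + (norm (row_comb b (\<lambda>i. of_int (z i))))\<^sup>2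
      \<and> (q + (norm (row_comb b (\<lambda>i. of_int (z i))))\<^sup>2) powr (- s) \<le> B z"
    if b: "b \<in> K" and z: "z \<noteq> (\<lambda>_. 0)" for b z
  proof -
    obtain i where "z i \<noteq> 0" using z by blast
    then have "1 \<le> (z i)\<^sup>2" by (simp add: int_one_le_iff_zero_less)
    then have "1 \<le> (real_of_int (z i))\<^sup>2" by (metis of_int_1_le_iff of_int_power)
    also have "\<dots> \<le> (\<Sum>i\<in>UNIV. (real_of_int (z i))\<^sup>2)" by (rule member_le_sum) auto
    finally have "Y z \<le> 2 * (\<Sum>i\<in>UNIV. (real_of_int (z i))\<^sup>2)" "Y z \<ge> 1" by (simp_all add: Y_def)
    then have "c / 2 * Y z \<le> c * (\<Sum>i\<in>UNIV. (real_of_int (z i))\<^sup>2)"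
      using c(1) by simp
    also have "\<dots> \<le> q + (norm (row_comb b (\<lambda>i. of_int (z i))))\<^sup>2"
      using c(2)[OF b, of "\<lambda>i. of_int (z i)"] q by simp
    finally have le: "c / 2 * Y z \<le> q + (norm (row_comb b (\<lambda>i. of_int (z i))))\<^sup>2" .
    have p: "0 < c / 2 * Y z" using c(1) \<open>Y z \<ge> 1\<close> by simp
    have "(q + (norm (row_comb b (\<lambda>i. of_int (z i))))\<^sup>2) powr (- s) \<le> (c / 2 * Y z) powr (- s)"
      using le p s0 by (intro powr_mono2') auto
    also have "\<dots> = B z"
      unfolding B_def by (rule powr_mult)
    finally show ?thesis using le p by linarith
  qed
  ultimately show ?thesis using that by blast
qed

section \<open>The compact set of bounded basis matrices\<close>

lemma unimodular_rows:
  fixes L :: "(real ^ 'n) set"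
  assumes "L \<in> unimodular_lattices"
  obtains b :: "(real ^ 'n) ^ 'n" where "L = int_span (rows_list b)" "vol (rows_list b) = 1"
    "semistable L" "\<forall>i. norm (b $ i) \<le> of_nat CARD('n) * 2 ^ (CARD('n) * CARD('n))"
proof -
  obtain vs where vs: "length vs = CARD('n)" "vol vs = 1" "int_span vs = L" "semistable L"
    using assms by (auto simp: unimodular_lattices_def)
  have "additive_subgroup L" "set vs \<subseteq> L" "vol vs > 0"
    using vs(2,3) additive_subgroup_int_span[of vs] set_subset_int_span[of vs] by auto
  then obtain us where us: "length us = length vs" "int_span us = int_span vs"
    "\<And>u. u \<in> set us \<Longrightarrow> norm u \<le> of_nat (length vs) * 2 ^ (length vs * length vs) * vol vs"
    using bounded_basis_exists[OF _ vs(4)] by blast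
  obtain b :: "(real ^ 'n) ^ 'n" where b: "rows_list b = us"
    using rows_list_surj us(1) vs(1) by metis
  have "b $ i \<in> set us" for i
    unfolding b[symmetric] rows_list_def using idx_list(2) by auto
  then have "norm (b $ i) \<le> of_nat CARD('n) * 2 ^ (CARD('n) * CARD('n))" for i
    using us(3) vs by fastforce
  moreover have "vol us = 1" using vol_cong_int_span[OF us(1,2)] vs(2) by simp
  ultimately show ?thesis using that[of b] us vs b by simp
qed

text \<open>This is \<open>zsum_majorant\<close> for a compact set consisting of a single
  basis.\<close>

lemma unimodular_zsummable:
  fixes L :: "(real ^ 'n) set"
  assumes L: "L \<in> unimodular_lattices" and s: "s > real CARD('n) / 2" and q: "q \<ge> 0"
  shows "zsummable L s q"
proof -
  obtain b :: "(real ^ 'n) ^ 'n" where b: "L = int_span (rows_list b)" "vol (rows_list b) = 1"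
    using unimodular_rows[OF L] by metis
  obtain B where B: "B summable_on (UNIV - {\<lambda>_. 0})"
    "\<And>b' z. b' \<in> {b} \<Longrightarrow> z \<noteq> (\<lambda>_. 0) \<Longrightarrow> 0 < q + (norm (row_comb b' (\<lambda>i. of_int (z i :: int))))\<^sup>2
      \<and> (q + (norm (row_comb b' (\<lambda>i. of_int (z i))))\<^sup>2) powr (- s) \<le> B z"
    using zsum_majorant[of "{b}" s q] b(2) s q by auto
  have "vol (rows_list b) > 0" using b(2) by simp
  show ?thesis
    unfolding b(1) zsum_row_comb(2)[OF \<open>vol (rows_list b) > 0\<close>]
    by (rule summable_on_comparison_test[OF B(1)]) (use B(2)[of b] in auto)
qed

text \<open>The Leibniz sum is a polynomial in the inner products, so continuity extends to
  dependent lists, where Gram-Schmidt residuals may jump. Closedness is therefore tested on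
  \<open>gram_det\<close>.\<close>

lemma continuous_on_gram_det:
  assumes len: "\<And>b. length (F b) = k" and cont: "\<And>i. i < k \<Longrightarrow> continuous_on S (\<lambda>b. F b ! i)"
  shows "continuous_on S (\<lambda>b. gram_det (F b))"
  unfolding gram_det_def len
proof (intro continuous_on_sum continuous_on_mult continuous_on_const continuous_on_prod continuous_on_inner cont)
  fix p i assume "p \<in> {p. p permutes {..<k}}" "i \<in> {..<k}"
  then show "p i < k" "i < k"
    using permutes_in_image[of p "{..<k}" i] by auto
qed

text \<open>By \<open>unimodular_rows\<close> every lattice of the family has its basis matrix in
  one compact set \<open>K\<close>, and the zeta sum is continuous there as a uniform limit of
  finite sums.\<close>

lemma zsum_attains_max:
  assumes ne: "(unimodular_lattices :: (real ^ 'n) set set) \<noteq> {}"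
    and s: "s > real CARD('n) / 2" and q: "q \<ge> 0"
  obtains L :: "(real ^ 'n) set" where "L \<in> unimodular_lattices"
    "\<And>L' :: (real ^ 'n) set. L' \<in> unimodular_lattices \<Longrightarrow> zsum L' s q \<le> zsum L s q"
proof -
  define C :: real where "C = of_nat CARD('n) * 2 ^ (CARD('n) * CARD('n))"
  define G where "G zs b = gram_det (map (\<lambda>z. row_comb b (\<lambda>i. of_int (z i))) zs)"
    for zs :: "('n \<Rightarrow> int) list" and b :: "(real ^ 'n) ^ 'n"
  define K where "K = {b :: (real ^ 'n) ^ 'n. (\<forall>i. norm (b $ i) \<le> C) \<and> gram_det (rows_list b) = 1
    \<and> (\<forall>zs. G zs b \<in> {0} \<union> {1..})}"
  have gram: "vol vs = 1 \<longleftrightarrow> gram_det vs = 1" "(vol vs = 0 \<or> 1 \<le> vol vs) \<longleftrightarrow> gram_det vs \<in> {0} \<union> {1..}"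
    for vs :: "(real ^ 'n) list"
  proof -
    have "1 \<le> (vol vs)\<^sup>2 \<longleftrightarrow> 1 \<le> vol vs"
      using abs_le_square_iff[of 1 "vol vs"] by simp
    then show "vol vs = 1 \<longleftrightarrow> gram_det vs = 1" "(vol vs = 0 \<or> 1 \<le> vol vs) \<longleftrightarrow> gram_det vs \<in> {0} \<union> {1..}"
      using power2_eq_1_iff[of "vol vs"] vol_nonneg[of vs] by (auto simp: gram_det_vol)
  qed
  have "(\<forall>zs. G zs b \<in> {0} \<union> {1..}) \<longleftrightarrow> semistable (int_span (rows_list b))" for b
  proof -
    have "set vs \<subseteq> int_span (rows_list b) \<longleftrightarrow> (\<exists>zs. vs = map (\<lambda>z. row_comb b (\<lambda>i. of_int (z i))) zs)" for vs
    proof (induction vs)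
      case (Cons v vs)
      show ?case
      proof
        assume "set (v # vs) \<subseteq> int_span (rows_list b)"
        then obtain zs z where "vs = map (\<lambda>z. row_comb b (\<lambda>i. of_int (z i))) zs" "v = row_comb b (\<lambda>i. of_int (z i))"
          using Cons by (auto simp: int_span_rows_list)
        then show "\<exists>zs. v # vs = map (\<lambda>z. row_comb b (\<lambda>i. of_int (z i))) zs"
          by (intro exI[of _ "z # zs"]) simp
      qed (auto simp: int_span_rows_list)
    qed simp
    then show ?thesis
      unfolding semistable_def gram(2) G_def by (metis (no_types, lifting))
  qed
  then have K_iff: "b \<in> K \<longleftrightarrow> (\<forall>i. norm (b $ i) \<le> C) \<and> vol (rows_list b) = 1 \<and> semistable (int_span (rows_list b))" for b
    unfolding K_def gram(1) by blast
  have contG: "continuous_on UNIV (G zs)" for zs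
    unfolding G_def row_comb_def
    by (rule continuous_on_gram_det[of _ "length zs"]) (auto intro!: continuous_intros)
  have contD: "continuous_on UNIV (\<lambda>b :: (real ^ 'n) ^ 'n. gram_det (rows_list b))"
    unfolding rows_list_def
    by (rule continuous_on_gram_det[of _ "length idx_list"]) (auto intro!: continuous_intros)
  have "closed K"
  proof -
    have "closed {b :: (real ^ 'n) ^ 'n. norm (b $ i) \<le> C}" for i
      by (intro closed_Collect_le continuous_intros)
    moreover have "closed ((\<lambda>b :: (real ^ 'n) ^ 'n. gram_det (rows_list b)) -` {1})"
      using contD by (intro closed_vimage) auto
    moreover have "closed (G zs -` ({0} \<union> {1..}))" for zs
      using contG by (intro closed_vimage) auto
    moreover have "K = (\<Inter>i. {b. norm (b $ i) \<le> C}) \<inter> ((\<lambda>b. gram_det (rows_list b)) -` {1})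
        \<inter> (\<Inter>zs. G zs -` ({0} \<union> {1..}))"
      unfolding K_def by auto
    ultimately show ?thesis by (simp only:) (intro closed_Int closed_INT, auto)
  qed
  moreover have "bounded K"
  proof (rule boundedI)
    fix b assume "b \<in> K"
    have "norm b \<le> (\<Sum>i\<in>UNIV. norm (b $ i))"
      unfolding norm_vec_def by (rule L2_set_le_sum) simp
    also have "\<dots> \<le> (\<Sum>i\<in>(UNIV :: 'n set). C)"
      using \<open>b \<in> K\<close> by (intro sum_mono) (auto simp: K_def)
    finally show "norm b \<le> (\<Sum>i\<in>(UNIV :: 'n set). C)" .
  qed
  ultimately have comp: "compact K" by (simp add: compact_eq_bounded_closed)
  have memK: "\<exists>b\<in>K. L = int_span (rows_list b)" if "L \<in> unimodular_lattices" for L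
  proof -
    obtain b :: "(real ^ 'n) ^ 'n" where "L = int_span (rows_list b)" "vol (rows_list b) = 1"
      "semistable L" "\<forall>i. norm (b $ i) \<le> of_nat CARD('n) * 2 ^ (CARD('n) * CARD('n))"
      by (rule unimodular_rows[OF \<open>L \<in> unimodular_lattices\<close>])
    then show ?thesis unfolding K_iff C_def by (intro bexI[of _ b]) (auto simp: K_iff C_def)
  qed
  then have "K \<noteq> {}" using ne by blast
  have posK: "vol (rows_list b) > 0" if "b \<in> K" for b using that by (simp add: K_iff)
  obtain B where B: "B summable_on (UNIV - {\<lambda>_. 0})"
    "\<And>b z. b \<in> K \<Longrightarrow> z \<noteq> (\<lambda>_. 0) \<Longrightarrow> 0 < q + (norm (row_comb b (\<lambda>i. of_int (z i :: int))))\<^sup>2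
      \<and> (q + (norm (row_comb b (\<lambda>i. of_int (z i))))\<^sup>2) powr (- s) \<le> B z"
    using zsum_majorant[OF comp \<open>K \<noteq> {}\<close> posK s q] by blast
  define f where "f z b = (q + (norm (row_comb b (\<lambda>i. of_int (z i))))\<^sup>2) powr (- s)"
    for z :: "'n \<Rightarrow> int" and b :: "(real ^ 'n) ^ 'n"
  have "continuous_on K (\<lambda>b. \<Sum>\<^sub>\<infinity>z\<in>UNIV - {\<lambda>_. 0}. f z b)"
  proof (rule uniform_limit_theorem)
    show "uniform_limit K (\<lambda>Z b. \<Sum>z\<in>Z. f z b) (\<lambda>b. \<Sum>\<^sub>\<infinity>z\<in>UNIV - {\<lambda>_. 0}. f z b)
        (finite_subsets_at_top (UNIV - {\<lambda>_. 0}))"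
      using B by (intro Weierstrass_m_test_general[where M = B]) (auto simp: f_def)
    show "\<forall>\<^sub>F Z in finite_subsets_at_top (UNIV - {\<lambda>_. 0}). continuous_on K (\<lambda>b. \<Sum>z\<in>Z. f z b)"
    proof (rule eventually_finite_subsets_at_top_weakI)
      fix Z :: "('n \<Rightarrow> int) set" assume Z: "finite Z" "Z \<subseteq> UNIV - {\<lambda>_. 0}"
      show "continuous_on K (\<lambda>b. \<Sum>z\<in>Z. f z b)"
      proof (rule continuous_on_sum)
        fix z assume "z \<in> Z"
        then have "z \<noteq> (\<lambda>_. 0)" using Z by auto
        then have "\<forall>b\<in>K. q + (norm (row_comb b (\<lambda>i. of_int (z i))))\<^sup>2 \<noteq> 0"
          using B(2) by fastforce
        then show "continuous_on K (f z)"
          unfolding f_def row_comb_def by (intro continuous_intros)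
      qed
    qed
  qed simp
  then obtain b where b: "b \<in> K" "\<forall>b'\<in>K. (\<Sum>\<^sub>\<infinity>z\<in>UNIV - {\<lambda>_. 0}. f z b') \<le> (\<Sum>\<^sub>\<infinity>z\<in>UNIV - {\<lambda>_. 0}. f z b)"
    using continuous_attains_sup[OF comp \<open>K \<noteq> {}\<close>] by blast
  have zf: "zsum (int_span (rows_list b)) s q = (\<Sum>\<^sub>\<infinity>z\<in>UNIV - {\<lambda>_. 0}. f z b)" if "b \<in> K" for b
    unfolding f_def by (rule zsum_row_comb(1)[OF posK[OF that]])
  show ?thesis
  proof (rule that[of "int_span (rows_list b)"])
    show "int_span (rows_list b) \<in> unimodular_lattices"
      using b(1) unfolding unimodular_lattices_def K_iff by (auto intro!: exI[of _ "rows_list b"])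
    fix L' :: "(real ^ 'n) set" assume "L' \<in> unimodular_lattices"
    then obtain b' where b': "b' \<in> K" "L' = int_span (rows_list b')" using memK by blast
    then show "zsum L' s q \<le> zsum (int_span (rows_list b)) s q"
      using b zf by simp
  qed
qed

section \<open>Maximizers are isometric to the integer lattice\<close>

text \<open>The orthogonal sum of \<open>ws\<close> and the projection of \<open>L\<close> away from
  it again belongs to the family: both parts are semistable, the projection because
  \<open>vol ws = 1\<close>. Maximality of \<open>L\<close> forces equality in
  \<open>zsum_orthogonalize\<close>, so \<open>L\<close> is this sum.\<close>

lemma maximal_splits:
  fixes L :: "'a::euclidean_space set"
  assumes L: "L \<in> unimodular_lattices" and s: "s > 0" and q: "q \<ge> 0"
    and summ: "\<And>L'::'a set. L' \<in> unimodular_lattices \<Longrightarrow> zsummable L' s q"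
    and max: "\<And>L'::'a set. L' \<in> unimodular_lattices \<Longrightarrow> zsum L' s q \<le> zsum L s q"
    and ws: "set ws \<subseteq> L" "vol ws = 1"
  obtains us where "L = int_span (us @ ws)" "length (us @ ws) = DIM('a)" "vol us = 1"
    "\<forall>x\<in>set us. \<forall>y\<in>set ws. inner x y = 0"
proof -
  obtain bs where bs: "length bs = DIM('a)" "vol bs = 1" "int_span bs = L" "semistable L"
    using L by (auto simp: unimodular_lattices_def)
  obtain vs where vs: "int_span (vs @ ws) = int_span bs" "length (vs @ ws) = length bs"
    by (rule vol_1_extend[of bs ws]) (use bs ws in auto)
  have vol: "vol (vs @ ws) = 1" using vol_cong_int_span[OF vs(2,1)] bs(2) by simp
  define us where "us = map (res (set ws)) vs"
  define L' where "L' = int_span (us @ ws)"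
  have orth: "inner x y = 0" if "x \<in> set us" "y \<in> set ws" for x y
    using that by (auto simp: us_def res_orth span_base)
  have volus: "vol us = 1" using vol ws(2) by (simp add: vol_append us_def)
  have orthspan: "inner x y = 0" if "x \<in> int_span us" "y \<in> int_span ws" for x y
    using that int_span_subset_span by (intro inner_span_eq_0[OF orth]) blast+
  have "semistable (res (set ws) ` L)" by (rule semistable_res_image[OF bs(4) ws])
  moreover have "int_span us \<subseteq> res (set ws) ` L"
    using set_subset_int_span[of "vs @ ws"] int_span_subset_iff[of vs "vs @ ws"] vs(1) bs(3)
    unfolding us_def int_span_map[OF linear_res] by auto
  ultimately have "semistable (int_span us)" by (rule semistable_subset)
  moreover have ssws: "semistable (int_span ws)"
  proof -
    have "additive_subgroup L" using bs(3) additive_subgroup_int_span by metis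
    from int_span_least[OF this ws(1)] show ?thesis by (rule semistable_subset[OF bs(4)])
  qed
  ultimately have "semistable L'"
    unfolding L'_def int_span_append using orthspan
    by (intro semistable_orthogonal_sum additive_subgroup_int_span)
  moreover have len: "length (us @ ws) = DIM('a)" using vs(2) bs(1) by (simp add: us_def)
  moreover have "vol (us @ ws) = 1" using vol_orthogonal_append[OF orth] volus ws(2) by simp
  ultimately have L': "L' \<in> unimodular_lattices"
    unfolding unimodular_lattices_def L'_def by auto
  have Lvs: "L = int_span (vs @ ws)" using vs(1) bs(3) by simp
  have volpos: "vol (vs @ ws) > 0" using vol by simp
  note cmp = zsum_orthogonalize[OF s q volpos Lvs L'_def[unfolded us_def] summ[OF L] summ[OF L'] ssws]
  have "zsum L s q = zsum L' s q"
    using cmp(1) max[OF L'] by linarith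
  then have "L = L'" by (rule cmp(2))
  then show ?thesis using that[of us] len volus orth unfolding L'_def by blast
qed

lemma vol_orthonormal:
  assumes "distinct vs" "pairwise real_inner_class.orthogonal (set vs)" "\<And>v. v \<in> set vs \<Longrightarrow> norm v = 1"
  shows "vol vs = 1"
  using assms
proof (induction vs)
  case (Cons v vs)
  have "res (set vs) v = v"
    using Cons.prems(1,2)
    by (intro res_orthogonal) (auto simp: pairwise_def real_inner_class.orthogonal_def)
  moreover have "vol vs = 1"
    using Cons.prems by (intro Cons.IH) (auto simp: pairwise_insert)
  ultimately show ?case using Cons.prems(3) by simp
qed simp

text \<open>A longest orthonormal list in \<open>L\<close> splits off. In a nontrivial complement a
  shortest nonempty list of volume 1 would be indecomposable: of length 1 it would prolong the
  orthonormal list, of length at least 2 it contradicts \<open>maximal_indecomposable_False\<close>.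
  These two extremal choices take the place of a full decomposition.\<close>

lemma maximal_orthonormal_basis:
  fixes L :: "'a::euclidean_space set"
  assumes L: "L \<in> unimodular_lattices"
    and s: "s > real DIM('a) / 2" and q: "0 \<le> q" "q \<le> (2 * s - real DIM('a)) / (real DIM('a) + 2)"
    and summ: "\<And>L'::'a set. L' \<in> unimodular_lattices \<Longrightarrow> zsummable L' s q"
    and max: "\<And>L'::'a set. L' \<in> unimodular_lattices \<Longrightarrow> zsum L' s q \<le> zsum L s q"
  obtains vs where "L = int_span vs" "length vs = DIM('a)" "distinct vs"
    "pairwise real_inner_class.orthogonal (set vs)" "\<forall>v\<in>set vs. norm v = 1"
proof -
  have s0: "s > 0" using s by (smt (verit) divide_nonneg_nonneg of_nat_0_le_iff)
  have ssL: "semistable L" using L by (auto simp: unimodular_lattices_def)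
  note split = maximal_splits[OF L s0 q(1) summ max]
  define ON where "ON vs \<longleftrightarrow> set vs \<subseteq> L \<and> distinct vs \<and> pairwise real_inner_class.orthogonal (set vs)
    \<and> (\<forall>v\<in>set vs. norm v = 1)" for vs
  have ON_len: "length vs < Suc DIM('a)" if "ON vs" for vs
  proof -
    have "vol vs = 1" using that by (intro vol_orthonormal) (auto simp: ON_def)
    then have "independent (set vs)" "distinct vs" using vol_pos_iff[of vs] by auto
    then have "length vs \<le> DIM('a)"
      using independent_bound[of "set vs"] by (simp add: distinct_card)
    then show ?thesis by simp
  qed
  have "ON []" by (simp add: ON_def)
  then obtain vs where vs: "ON vs" "\<And>vs'. ON vs' \<Longrightarrow> length vs' \<le> length vs"
    using ex_has_greatest_nat[of ON "[]" length "Suc DIM('a)"] ON_len by (meson less_imp_le)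
  have "vol vs = 1" using vs(1) by (intro vol_orthonormal) (auto simp: ON_def)
  moreover have "set vs \<subseteq> L" using vs(1) by (simp add: ON_def)
  ultimately obtain us where us: "L = int_span (us @ vs)" "length (us @ vs) = DIM('a)" "vol us = 1"
    "\<forall>x\<in>set us. \<forall>y\<in>set vs. inner x y = 0"
    using split by blast
  have "us = []"
  proof (rule ccontr)
    assume "us \<noteq> []"
    define Q where "Q xs \<longleftrightarrow> set xs \<subseteq> int_span us \<and> xs \<noteq> [] \<and> vol xs = 1" for xs
    \<comment> \<open>The complement itself has volume 1, so a shortest such list exists.\<close>
    have "Q us" using us(3) \<open>us \<noteq> []\<close> set_subset_int_span by (auto simp: Q_def)
    then obtain ws where ws: "Q ws" "\<And>xs. Q xs \<Longrightarrow> length ws \<le> length xs"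
      using ex_has_least_nat[of Q us length] by blast
    have subL: "int_span us \<subseteq> L"
      unfolding us(1) int_span_subset_iff using set_subset_int_span[of "us @ vs"] by simp
    have "length ws \<ge> 2"
    proof (rule ccontr)
      assume "\<not> length ws \<ge> 2"
      moreover have "length ws \<noteq> 0" using ws(1) by (simp add: Q_def)
      ultimately have "length ws = 1" by linarith
      then obtain x where x: "ws = [x]" by (cases ws) auto
      have nx: "x \<in> int_span us" "norm x = 1" using ws(1) x by (auto simp: Q_def)
      have xv: "inner x v = 0" if "v \<in> set vs" for v
      proof -
        have "x \<in> span (set us)" using nx(1) int_span_subset_span by blast
        moreover have "v \<in> span (set vs)" using that by (rule span_base)
        ultimately show ?thesis by (intro inner_span_eq_0[OF us(4)[rule_format]])
      qed
      have "x \<notin> set vs" using xv[of x] nx(2) by (auto simp: norm_eq_sqrt_inner)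
      then have "ON (x # vs)"
        using vs(1) nx subL xv unfolding ON_def
        by (auto simp: pairwise_insert real_inner_class.orthogonal_def inner_commute)
      from vs(2)[OF this] show False by simp
    qed
    have wsL: "set ws \<subseteq> L" "vol ws = 1" using ws(1) subL by (auto simp: Q_def)
    obtain us' where us': "L = int_span (us' @ ws)" "length (us' @ ws) = DIM('a)" "vol us' = 1"
      "\<forall>x\<in>set us'. \<forall>y\<in>set ws. inner x y = 0"
      using split wsL by blast
    have "vol xs \<noteq> 1" if "set xs \<subseteq> int_span ws" "xs \<noteq> []" "length xs < length ws" for xs
    proof
      assume "vol xs = 1"
      have "int_span ws \<subseteq> int_span us"
        using ws(1) int_span_subset_iff[of ws us] by (simp add: Q_def)
      then have "Q xs" using that \<open>vol xs = 1\<close> by (auto simp: Q_def)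
      then show False using ws(2) that(3) by fastforce
    qed
    then show False
      using maximal_indecomposable_False[OF s q summ max[unfolded us'(1)] us'(2) ssL[unfolded us'(1)] us'(3) wsL(2) us'(4)[rule_format] \<open>length ws \<ge> 2\<close>]
      by blast
  qed
  then show ?thesis
    using that[of vs] us(1,2) vs(1) by (simp add: ON_def)
qed

lemma zsum_isometry:
  assumes R: "orthogonal_transformation R"
  shows "zsum (R ` L) s q = zsum L s q"
proof -
  have inj: "inj R" using R by (rule orthogonal_transformation_inj)
  have "R 0 = 0" using R orthogonal_transformation_linear linear_0 by blast
  then have "R ` (L - {0}) = R ` L - {0}" by (simp add: image_set_diff[OF inj])
  then have bij: "bij_betw R (L - {0}) (R ` L - {0})"
    using inj by (auto simp: bij_betw_def intro: inj_on_subset)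
  have "norm (R x) = norm x" for x using R by (simp add: orthogonal_transformation_norm)
  then show ?thesis
    using infsum_reindex_bij_betw[OF bij, of "\<lambda>z. (q + (norm z)\<^sup>2) powr (- s)"] by (simp add: zsum_def)
qed

text \<open>The isometry is the coordinate map \<open>R\<close> of the orthonormal basis, with
  inverse \<open>T\<close>.\<close>

lemma orthonormal_isomorphic_to_Zn:
  fixes vs :: "(real ^ 'n) list"
  assumes len: "length vs = CARD('n)" and dist: "distinct vs"
    and orth: "pairwise real_inner_class.orthogonal (set vs)" and norm: "\<And>v. v \<in> set vs \<Longrightarrow> norm v = 1"
  shows "isomorphic_to_Zn (int_span vs)"
proof -
  obtain b :: "(real ^ 'n) ^ 'n" where b: "rows_list b = vs"
    using rows_list_surj[OF len] by blast
  have bset: "b $ i \<in> set vs" for i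
    unfolding b[symmetric] rows_list_def by (simp add: idx_list)
  have inj: "b $ i \<noteq> b $ j" if "i \<noteq> j" for i j
    using dist that unfolding b[symmetric] rows_list_def by (auto simp: distinct_map idx_list inj_on_def)
  have inner_b: "inner (b $ i) (b $ j) = (if i = j then 1 else 0)" for i j
  proof (cases "i = j")
    case True
    then show ?thesis using norm[OF bset[of i]] by (simp add: norm_eq_sqrt_inner)
  next
    case False
    then show ?thesis
      using orth bset inj[OF False] by (auto simp: pairwise_def real_inner_class.orthogonal_def)
  qed
  define R where "R x = (\<chi> i. inner x (b $ i))" for x
  define T where "T y = row_comb b (($) y)" for y :: "real ^ 'n"
  have "linear R"
    unfolding R_def by (rule linearI) (simp_all add: Finite_Cartesian_Product.vec_eq_iff inner_add_left)
  have linT: "linear T"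
    unfolding T_def row_comb_def
    by (rule linearI) (simp_all add: scaleR_left_distrib sum.distrib scaleR_sum_right)
  have RT: "R (T y) = y" for y
    unfolding R_def T_def row_comb_def
    by (simp add: Finite_Cartesian_Product.vec_eq_iff inner_sum_left inner_b if_distrib cong: if_cong)
  have "inner (T x) (T y) = inner x y" for x y
  proof -
    have "inner (T x) (T y) = (\<Sum>i\<in>UNIV. x $ i * inner (b $ i) (T y))"
      by (simp add: T_def row_comb_def inner_sum_left)
    also have "\<dots> = (\<Sum>i\<in>UNIV. x $ i * R (T y) $ i)"
      by (simp add: R_def inner_commute)
    finally show ?thesis by (simp add: RT inner_vec_def)
  qed
  then have orthT: "orthogonal_transformation T"
    using linT by (simp add: orthogonal_transformation_def)
  have TR: "T (R x) = x" for x
    using orthogonal_transformation_surj[OF orthT] RT by (metis surjD)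
  have "inner (R x) (R y) = inner x y" for x y
    using orthT TR unfolding orthogonal_transformation_def by metis
  then have orthR: "orthogonal_transformation R"
    using \<open>linear R\<close> by (simp add: orthogonal_transformation_def)
  have "int_span vs = T ` Zn"
  proof -
    have "T ` Zn = range (\<lambda>z. row_comb b (\<lambda>i. of_int (z i)))"
    proof (intro equalityI subsetI)
      fix x assume "x \<in> T ` Zn"
      then obtain y where y: "\<And>i. y $ i \<in> \<int>" "x = T y" by (auto simp: Zn_def)
      then have "y $ i = of_int \<lfloor>y $ i\<rfloor>" for i by simp
      then have "x = row_comb b (\<lambda>i. of_int \<lfloor>y $ i\<rfloor>)"
        unfolding y(2) T_def row_comb_def by (intro sum.cong) auto
      then show "x \<in> range (\<lambda>z. row_comb b (\<lambda>i. of_int (z i)))"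
        by (intro image_eqI[of _ _ "\<lambda>i. \<lfloor>y $ i\<rfloor>"]) auto
    next
      fix x assume "x \<in> range (\<lambda>z. row_comb b (\<lambda>i. of_int (z i)))"
      then obtain z :: "'n \<Rightarrow> int" where "x = row_comb b (\<lambda>i. of_int (z i))" by auto
      then have "x = T (\<chi> i. of_int (z i))" by (simp add: T_def row_comb_def)
      then show "x \<in> T ` Zn" by (intro image_eqI[of _ _ "\<chi> i. of_int (z i)"]) (auto simp: Zn_def)
    qed
    then show ?thesis unfolding b[symmetric] int_span_rows_list ..
  qed
  then have "R ` int_span vs = Zn" by (simp add: image_image RT)
  then show ?thesis using orthR unfolding isomorphic_to_Zn_def by blast
qed

lemma epstein_zeta_eq_zsum: "epstein_zeta' L s q = zsum L s q"
  by (simp add: epstein_zeta'_def zsum_def add.commute)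

theorem theorem4p1:
  fixes L :: "(real^'n) set" and s q :: real
  assumes "full_rank_lattice L" and "stable_lattice L"
    and "s > real CARD('n) / 2"
    and "0 \<le> q" and "q \<le> (2 * s - real CARD('n)) / (real CARD('n) + 2)"
  shows "epstein_zeta' L s q \<le> epstein_zeta' (Zn :: (real^'n) set) s q \<and>
         (epstein_zeta' L s q = epstein_zeta' (Zn :: (real^'n) set) s q \<longleftrightarrow> isomorphic_to_Zn L)"
proof -
  have L: "L \<in> unimodular_lattices"
    by (rule stable_lattice_unimodular[OF assms(1,2)])
  have summ: "zsummable L' s q" if "L' \<in> unimodular_lattices" for L' :: "(real^'n) set"
    by (rule unimodular_zsummable[OF that assms(3,4)])
  have iso_eq: "zsum L' s q = zsum (Zn :: (real^'n) set) s q" if "isomorphic_to_Zn L'" for L' :: "(real^'n) set"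
    using that zsum_isometry unfolding isomorphic_to_Zn_def by metis
  have iso: "isomorphic_to_Zn L'"
    if mem: "L' \<in> unimodular_lattices" and mx: "\<And>L'' :: (real^'n) set. L'' \<in> unimodular_lattices \<Longrightarrow> zsum L'' s q \<le> zsum L' s q"
    for L' :: "(real^'n) set"
  proof -
    obtain vs where vs: "L' = int_span vs" "length vs = DIM(real^'n)" "distinct vs"
      "pairwise real_inner_class.orthogonal (set vs)" "\<forall>v\<in>set vs. norm v = 1"
      by (rule maximal_orthonormal_basis[OF mem _ assms(4) _ summ mx]) (use assms in auto)
    then show ?thesis
      unfolding vs(1) by (intro orthonormal_isomorphic_to_Zn) auto
  qed
  \<comment> \<open>The value at \<open>Zn\<close> enters through the maximizer \<open>M\<close>,
    which is isometric to \<open>Zn\<close>. If \<open>L\<close> reaches that value, it is a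
    maximizer as well, and \<open>iso\<close> applies to it.\<close>
  obtain M :: "(real^'n) set" where M: "M \<in> unimodular_lattices"
    "\<And>L' :: (real^'n) set. L' \<in> unimodular_lattices \<Longrightarrow> zsum L' s q \<le> zsum M s q"
    by (rule zsum_attains_max[OF _ assms(3,4)]) (use L in auto)
  have M_eq: "zsum M s q = zsum (Zn :: (real^'n) set) s q"
    using iso[OF M] by (rule iso_eq)
  show ?thesis
    unfolding epstein_zeta_eq_zsum
    using M(2)[OF L] M_eq iso[OF L] iso_eq M(2) by (metis order_refl)
qed

end
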